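(* Let $G$ be a finite simple graph of Class $2$ of odd order $n$. Then $es_{\chi'}(G) =\frac{n-3}{2}$ if and only if at least one of the following holds: (a) $n\ge 5$ and $G$ is isomorphic to $K_n^-$, or to $K_{n-2} \cup K_2$, or to $K_{n-2} \cup \overline{K_2}$, or to $\overline {K_2 \cup \cdots \cup K_2\cup K_{1,2}}$ (with $\frac{n-3}{2}$ copies of $K_2$), or $G$ is an $(n-3)$-regular graph; (b) $G$ is isomorphic to $K_{2m+1} \cup K_{2m+1} \cup K_1$ or to $K_{2m+1} \cup K_{2m+1} \cup K_{2m+1}$ for some positive integer $m$.
   Context: All graphs are finite, simple and have at least one edge. $\chi'(G)$ is the chromatic index and $\Delta(G)$ the maximum degree of $G$. $G$ is of Class 2 if $\chi'(G)=\Delta(G)+1$. The chromatic edge stability index $es_{\chi'}(G)$ is the minimum cardinality of a set of edges $F\subseteq E(G)$ such that $\chi'(G\setminus F)<\chi'(G)$, where $G\setminus F$ is $G$ with the edges of $F$ deleted (all vertices are kept). $K_n$ is the complete graph of order $n$, $K_n^-$ is $K_n$ with one edge deleted, $K_{1,2}$ is the complete bipartite graph with part sizes $1$ and $2$, $\overline{H}$ is the complement of the graph $H$, and $\cup$ between graphs denotes vertex-disjoint union. *)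

theory Defs
  imports Complex_Main
begin

datatype 'a ugraph = UGraph (vertices: "'a set") (edges: "'a set set")

definition simple_graph :: "'a ugraph \<Rightarrow> bool" where
  "simple_graph G \<longleftrightarrow>
     finite (vertices G) \<and> (\<forall>e \<in> edges G. e \<subseteq> vertices G \<and> card e = 2)"

definition graph_order :: "'a ugraph \<Rightarrow> nat" where
  "graph_order G = card (vertices G)"

definition degree :: "'a ugraph \<Rightarrow> 'a \<Rightarrow> nat" where
  "degree G v = card {e \<in> edges G. v \<in> e}"

definition max_degree :: "'a ugraph \<Rightarrow> nat" where
  "max_degree G = Max (degree G ` vertices G)"

definition regular :: "nat \<Rightarrow> 'a ugraph \<Rightarrow> bool" where
  "regular k G \<longleftrightarrow> (\<forall>v \<in> vertices G. degree G v = k)"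

definition proper_edge_colouring :: "'a ugraph \<Rightarrow> nat \<Rightarrow> ('a set \<Rightarrow> nat) \<Rightarrow> bool" where
  "proper_edge_colouring G k c \<longleftrightarrow>
     (\<forall>e \<in> edges G. c e < k) \<and>
     (\<forall>e \<in> edges G. \<forall>e' \<in> edges G. e \<noteq> e' \<and> e \<inter> e' \<noteq> {} \<longrightarrow> c e \<noteq> c e')"

definition chromatic_index :: "'a ugraph \<Rightarrow> nat" where
  "chromatic_index G = (LEAST k. \<exists>c. proper_edge_colouring G k c)"

definition class2 :: "'a ugraph \<Rightarrow> bool" where
  "class2 G \<longleftrightarrow> chromatic_index G = max_degree G + 1"

definition delete_edges :: "'a ugraph \<Rightarrow> 'a set set \<Rightarrow> 'a ugraph" where
  "delete_edges G F = UGraph (vertices G) (edges G - F)"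

definition chromatic_edge_stability_index :: "'a ugraph \<Rightarrow> nat" where
  "chromatic_edge_stability_index G =
     (LEAST k. \<exists>F \<subseteq> edges G. card F = k \<and>
        chromatic_index (delete_edges G F) < chromatic_index G)"

definition graph_iso :: "'a ugraph \<Rightarrow> 'b ugraph \<Rightarrow> bool" where
  "graph_iso G H \<longleftrightarrow>
     (\<exists>f. bij_betw f (vertices G) (vertices H) \<and> (`) f ` edges G = edges H)"

definition complete_graph :: "nat \<Rightarrow> nat ugraph" where
  "complete_graph n = UGraph {..<n} {e. e \<subseteq> {..<n} \<and> card e = 2}"

text \<open>
  Any two edges of a complete graph are equivalent under an automorphism, so for
  \<open>n \<ge> 2\<close> the choice of the deleted edge is immaterial up to isomorphism.
\<close>
definition complete_graph_minus_edge :: "nat \<Rightarrow> nat ugraph" where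
  "complete_graph_minus_edge n = delete_edges (complete_graph n) {{0, 1}}"

definition complete_bipartite :: "nat \<Rightarrow> nat \<Rightarrow> (nat + nat) ugraph" where
  "complete_bipartite a b =
     UGraph ({..<a} <+> {..<b}) {{Inl i, Inr j} | i j. i < a \<and> j < b}"

definition complement :: "'a ugraph \<Rightarrow> 'a ugraph" where
  "complement G =
     UGraph (vertices G) {e. e \<subseteq> vertices G \<and> card e = 2 \<and> e \<notin> edges G}"

definition disjoint_union :: "'a ugraph \<Rightarrow> 'b ugraph \<Rightarrow> ('a + 'b) ugraph" where
  "disjoint_union G H =
     UGraph (vertices G <+> vertices H) ((`) Inl ` edges G \<union> (`) Inr ` edges H)"

text \<open>The vertex-disjoint union of \<open>k\<close> copies of \<open>G\<close>; the first component numbers the copy.\<close>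
definition copies :: "nat \<Rightarrow> 'a ugraph \<Rightarrow> (nat \<times> 'a) ugraph" where
  "copies k G =
     UGraph ({..<k} \<times> vertices G) {Pair i ` e | i e. i < k \<and> e \<in> edges G}"

end

theory Submission
  imports Defs
begin

text \<open>
Let \<open>k = \<Delta> + 1\<close> and \<open>n = 2q + 3\<close>, and suppose that \<open>q\<close> is the least number of edges whose deletion
makes \<open>k - 1\<close> colours suffice. Deleting a colour class saves a colour, so in every proper \<open>k\<close>-colouring every
class has \<open>q\<close> or \<open>q + 1\<close> edges: either three vertices or a single vertex lack a given colour. Call
a colour small in the first case and big in the second. The number \<open>s\<close> of small colours is
determined by the degrees. The whole argument exploits that this must remain true after any
recolouring; no sequence of Kempe exchanges and single recolourings may lead to five vertices
lacking the same colour.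

Deleting \<open>q\<close> edges leaves at most \<open>(k - 1)(q + 1)\<close> edges, which forces \<open>s \<ge> 1\<close>. If \<open>s = 1\<close> then the
degree sum leaves only \<open>\<Delta> \<in> {n - 3, n - 2, n - 1}\<close>, with a complement that is 2-regular, a matching
together with a path on three vertices, or a single edge; these are the dense graphs of the list
(\<open>dense_cases\<close>). So let \<open>s \<ge> 2\<close>.

Two facts are the tools. If a colour \<open>a\<close> is small and \<open>v\<close> lacks \<open>b\<close>, then the Kempe chain of \<open>a\<close> and
\<open>b\<close> through \<open>v\<close> ends at a vertex lacking \<open>a\<close> (\<open>linked_end\<close>). If \<open>u\<close> lacks a small colour \<open>a\<close>, then all
colours missing at vertices of a Vizing fan at \<open>u\<close> that starts with an edge of small colour are linked
to \<open>u\<close> in this way (\<open>fan_linked\<close>); counting them shows that the fan consists of vertices of degree \<open>\<Delta>\<close>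
(\<open>full_small_neighbour\<close>). It follows that every vertex of degree less than \<open>\<Delta>\<close>, called deficient, lacks
all small colours in every colouring, and hence that there are at most two such vertices.

With two deficient vertices, each small colour has just one other vertex lacking it, and the
fans make all the other vertices pairwise adjacent; an edge from them to a deficient vertex would
need too many big colours. This gives \<open>K\<^sub>n\<^sub>-\<^sub>2\<close> plus two vertices. With at most one deficient vertex, one
counts for each small colour \<open>a\<close> the edges at the vertices lacking \<open>a\<close>. Each vertex is linked to only
one of these, so too many big colours would leave many edges whose ends are not linked. Such an edge
can be given ends that lack the same small colour, and two of them of one colour could both be
recoloured (\<open>two_monochromatic_pairs\<close>). The counts collide unless all colours are small. Then adjacency
coincides with being linked, and as this has to survive every Kempe exchange it is transitive: apart
from an isolated deficient vertex, the graph consists of two or three copies of \<open>K\<^sub>k\<close>.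

Conversely, the average colour class of the listed graphs is smaller than \<open>q + 1\<close>, which bounds the
stability index from above. The matching lower bound counts edges, either of the whole graph or of
its cliques of odd order: with \<open>2m\<close> colours at most \<open>2m\<^sup>2\<close> of the \<open>(2m + 1)m\<close> edges of \<open>K\<^sub>2\<^sub>m\<^sub>+\<^sub>1\<close> can be
coloured.
\<close>

section \<open>Colour classes and Kempe components\<close>

locale sgraph =
  fixes G :: "'a ugraph"
  assumes simple: "simple_graph G"
begin

abbreviation "V \<equiv> vertices G"
abbreviation "E \<equiv> edges G"

text \<open>
All statements about sizes of colour classes are made through the set of vertices that a class
leaves uncovered, since this set behaves well under recolouring.
\<close>
definition lack :: "('a set \<Rightarrow> nat) \<Rightarrow> nat \<Rightarrow> 'a set" where
  "lack c a = {v \<in> V. \<forall>e\<in>E. v \<in> e \<longrightarrow> c e \<noteq> a}"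

definition closed_under :: "('a set \<Rightarrow> nat) \<Rightarrow> nat set \<Rightarrow> 'a set \<Rightarrow> bool" where
  "closed_under c A X \<longleftrightarrow> X \<subseteq> V \<and> (\<forall>e\<in>E. c e \<in> A \<and> e \<inter> X \<noteq> {} \<longrightarrow> e \<subseteq> X)"

text \<open>
The vertex set of the Kempe chain through \<open>v\<close>.
\<close>
definition kempe :: "('a set \<Rightarrow> nat) \<Rightarrow> nat \<Rightarrow> nat \<Rightarrow> 'a \<Rightarrow> 'a set" where
  "kempe c a b v = {y. (v, y) \<in> {(x, y). {x, y} \<in> E \<and> c {x, y} \<in> {a, b}}\<^sup>*}"

text \<open>
The set \<open>X\<close> need not be one Kempe chain: unions and complements of chains are exchanged as well.
\<close>
definition kempe_swap :: "('a set \<Rightarrow> nat) \<Rightarrow> nat \<Rightarrow> nat \<Rightarrow> 'a set \<Rightarrow> 'a set \<Rightarrow> nat" where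
  "kempe_swap c a b X e = (if e \<subseteq> X then (if c e = a then b else if c e = b then a else c e) else c e)"

lemma finite_V: "finite V"
  using simple by (simp add: simple_graph_def)

lemma edge_subset: "e \<in> E \<Longrightarrow> e \<subseteq> V"
  using simple by (simp add: simple_graph_def)

lemma edge_card: "e \<in> E \<Longrightarrow> card e = 2"
  using simple by (simp add: simple_graph_def)

lemma finite_E: "finite E"
  by (rule finite_subset[of _ "Pow V"]) (use edge_subset finite_V in auto)

lemma finite_edge: "e \<in> E \<Longrightarrow> finite e"
  using edge_card by (metis card.infinite zero_neq_numeral)

lemma edge_at:
  assumes "e \<in> E" "v \<in> e" obtains y where "e = {v, y}" "y \<noteq> v" "y \<in> V" "v \<in> V"
proof -
  obtain x y where xy: "e = {x, y}" "x \<noteq> y"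
    using edge_card[OF assms(1)] by (auto simp: card_2_iff)
  then show ?thesis
    using that[of x] that[of y] assms edge_subset[OF assms(1)] by (auto simp: insert_commute)
qed

lemma edge_neq: "{x, y} \<in> E \<Longrightarrow> x \<noteq> y"
  using edge_card[of "{x, y}"] by auto

lemma edge_in_V: "{x, y} \<in> E \<Longrightarrow> x \<in> V \<and> y \<in> V"
  using edge_subset by auto

lemma lack_V: "lack c a \<subseteq> V"
  by (auto simp: lack_def)

lemma finite_lack: "finite (lack c a)"
  using finite_subset[OF lack_V finite_V] .

lemma lackD: "v \<in> lack c a \<Longrightarrow> {v, y} \<in> E \<Longrightarrow> c {v, y} \<noteq> a"
  by (auto simp: lack_def)

lemma lackD': "v \<in> lack c a \<Longrightarrow> {y, v} \<in> E \<Longrightarrow> c {y, v} \<noteq> a"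
  by (auto simp: lack_def)

lemma not_lack_edge:
  assumes "v \<in> V" "v \<notin> lack c a"
  obtains y where "{v, y} \<in> E" "c {v, y} = a" "y \<in> V" "y \<noteq> v"
proof -
  obtain e where e: "e \<in> E" "v \<in> e" "c e = a"
    using assms by (auto simp: lack_def)
  then obtain y where "e = {v, y}" "y \<noteq> v" "y \<in> V"
    using edge_at by metis
  then show ?thesis using that e by auto
qed

lemma kempe_refl: "v \<in> kempe c a b v"
  by (simp add: kempe_def)

lemma kempe_V: assumes "v \<in> V" shows "kempe c a b v \<subseteq> V"
proof
  fix y assume "y \<in> kempe c a b v"
  then have "(v, y) \<in> {(x, y). {x, y} \<in> E \<and> c {x, y} \<in> {a, b}}\<^sup>*" by (simp add: kempe_def)
  then show "y \<in> V"
    by (induction rule: rtrancl_induct) (use assms edge_in_V in auto)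
qed

lemma kempe_commute: "kempe c a b v = kempe c b a v"
  unfolding kempe_def by (simp add: insert_commute)

lemma kempe_sym: assumes "y \<in> kempe c a b v" shows "v \<in> kempe c a b y"
proof -
  let ?R = "{(x, y). {x, y} \<in> E \<and> c {x, y} \<in> {a, b}}"
  have "sym ?R" by (auto simp: sym_def insert_commute)
  then have "sym (?R\<^sup>*)" by (rule sym_rtrancl)
  then show ?thesis using assms unfolding kempe_def by (auto dest: symD)
qed

lemma kempe_eq: assumes "y \<in> kempe c a b v" shows "kempe c a b y = kempe c a b v"
proof -
  have "z \<in> kempe c a b w" if "z \<in> kempe c a b u" "u \<in> kempe c a b w" for z u w
    using that unfolding kempe_def by auto
  then show ?thesis using assms kempe_sym by blast
qed

lemma kempe_closed: assumes "v \<in> V" shows "closed_under c {a, b} (kempe c a b v)"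
  unfolding closed_under_def
proof (intro conjI ballI impI)
  show "kempe c a b v \<subseteq> V" using kempe_V[OF assms] .
  fix e assume e: "e \<in> E" "c e \<in> {a, b} \<and> e \<inter> kempe c a b v \<noteq> {}"
  then obtain x where x: "x \<in> e" "x \<in> kempe c a b v" by auto
  obtain y where y: "e = {x, y}" using edge_at[OF e(1) x(1)] by metis
  have "y \<in> kempe c a b v"
    using x(2) e y unfolding kempe_def by (auto intro: rtrancl_into_rtrancl)
  then show "e \<subseteq> kempe c a b v" using x y by auto
qed

lemma closed_underD:
  "closed_under c A X \<Longrightarrow> {x, y} \<in> E \<Longrightarrow> c {x, y} \<in> A \<Longrightarrow> x \<in> X \<Longrightarrow> y \<in> X"
  unfolding closed_under_def by blast

lemma closed_under_Un: "closed_under c A X \<Longrightarrow> closed_under c A Y \<Longrightarrow> closed_under c A (X \<union> Y)"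
  unfolding closed_under_def by blast

lemma closed_under_Compl:
  assumes "closed_under c A X" shows "closed_under c A (V - X)"
  unfolding closed_under_def
proof (intro conjI ballI impI)
  show "V - X \<subseteq> V" by auto
  fix e assume e: "e \<in> E" "c e \<in> A \<and> e \<inter> (V - X) \<noteq> {}"
  have "e \<subseteq> X" if "e \<inter> X \<noteq> {}"
    using that e assms unfolding closed_under_def by blast
  then show "e \<subseteq> V - X" using e edge_subset[OF e(1)] by blast
qed

lemma kempe_swap_commute: "a \<noteq> b \<Longrightarrow> kempe_swap c a b X = kempe_swap c b a X"
  by (auto simp: kempe_swap_def fun_eq_iff)

lemma lack_swap_left:
  assumes "closed_under c {a, b} X" "a \<noteq> b"
  shows "lack (kempe_swap c a b X) a = (lack c a - X) \<union> (lack c b \<inter> X)"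
proof (rule set_eqI)
  fix v
  have inside: "kempe_swap c a b X e = a \<longleftrightarrow> c e = b" if "e \<in> E" "v \<in> e" "v \<in> X" for e
  proof -
    have "c e \<in> {a, b} \<Longrightarrow> e \<subseteq> X" using assms(1) that by (auto simp: closed_under_def)
    then show ?thesis using assms(2) by (simp add: kempe_swap_def)
  qed
  have outside: "kempe_swap c a b X e = c e" if "v \<in> e" "v \<notin> X" for e
  proof -
    have "\<not> e \<subseteq> X" using that by blast
    then show ?thesis by (simp add: kempe_swap_def)
  qed
  show "v \<in> lack (kempe_swap c a b X) a \<longleftrightarrow> v \<in> (lack c a - X) \<union> (lack c b \<inter> X)"
    by (cases "v \<in> X") (simp_all add: lack_def inside outside cong: conj_cong)
qed

lemma lack_swap_right:
  assumes "closed_under c {a, b} X" "a \<noteq> b"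
  shows "lack (kempe_swap c a b X) b = (lack c b - X) \<union> (lack c a \<inter> X)"
  using lack_swap_left[of c b a X] assms by (simp add: kempe_swap_commute insert_commute)

lemma kempe_swap_other: "d \<noteq> a \<Longrightarrow> d \<noteq> b \<Longrightarrow> kempe_swap c a b X e = d \<longleftrightarrow> c e = d"
  by (auto simp: kempe_swap_def)

lemma lack_cong: "(\<And>e. e \<in> E \<Longrightarrow> c e = d \<longleftrightarrow> c' e = d) \<Longrightarrow> lack c d = lack c' d"
  by (auto simp: lack_def)

lemma kempe_cong:
  assumes "\<And>e. e \<in> E \<Longrightarrow> c e \<in> {a, b} \<longleftrightarrow> c' e \<in> {a, b}" shows "kempe c a b v = kempe c' a b v"
proof -
  have "{(x, y). {x, y} \<in> E \<and> c {x, y} \<in> {a, b}} = {(x, y). {x, y} \<in> E \<and> c' {x, y} \<in> {a, b}}"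
    using assms by blast
  then show ?thesis by (simp add: kempe_def)
qed

lemma lack_swap_other: "d \<noteq> a \<Longrightarrow> d \<noteq> b \<Longrightarrow> lack (kempe_swap c a b X) d = lack c d"
  by (rule lack_cong) (simp add: kempe_swap_other)

lemma kempe_swap_edge_out: "x \<notin> X \<Longrightarrow> kempe_swap c a b X {x, y} = c {x, y}"
  by (simp add: kempe_swap_def)

end

locale colour_graph = sgraph +
  fixes k :: nat
  assumes degree_less: "v \<in> V \<Longrightarrow> degree G v < k"
begin

abbreviation "proper c \<equiv> proper_edge_colouring G k c"

definition miss :: "('a set \<Rightarrow> nat) \<Rightarrow> 'a \<Rightarrow> nat set" where
  "miss c v = {a. a < k \<and> v \<in> lack c a}"

lemma proper_range: "proper c \<Longrightarrow> e \<in> E \<Longrightarrow> c e < k"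
  by (auto simp: proper_edge_colouring_def)

lemma proper_eq:
  "proper c \<Longrightarrow> {x, y} \<in> E \<Longrightarrow> {x, z} \<in> E \<Longrightarrow> c {x, y} = c {x, z} \<Longrightarrow> y = z"
  unfolding proper_edge_colouring_def by (metis Int_iff doubleton_eq_iff empty_iff insertI1)

lemma proper_eqE:
  "proper c \<Longrightarrow> e \<in> E \<Longrightarrow> e' \<in> E \<Longrightarrow> v \<in> e \<Longrightarrow> v \<in> e' \<Longrightarrow> c e = c e' \<Longrightarrow> e = e'"
  unfolding proper_edge_colouring_def by (metis Int_iff empty_iff)

lemma finite_miss: "finite (miss c v)"
  by (simp add: miss_def)

lemma card_miss:
  assumes "proper c" "v \<in> V" shows "card (miss c v) + degree G v = k"
proof -
  let ?D = "{e \<in> E. v \<in> e}"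
  have inj: "inj_on c ?D" using assms(1) proper_eqE by (auto simp: inj_on_def)
  have "miss c v = {..<k} - c ` ?D"
    using assms(2) by (auto simp: miss_def lack_def)
  moreover have "c ` ?D \<subseteq> {..<k}" using proper_range[OF assms(1)] by auto
  moreover have "card (c ` ?D) = degree G v"
    using card_image[OF inj] by (simp add: degree_def)
  ultimately have "card (miss c v) = k - degree G v"
    using finite_E by (simp add: card_Diff_subset)
  then show ?thesis using degree_less[OF assms(2)] by simp
qed

lemma miss_nonempty: "proper c \<Longrightarrow> v \<in> V \<Longrightarrow> miss c v \<noteq> {}"
  using card_miss degree_less by fastforce

lemma proper_swap:
  assumes "proper c" "closed_under c {a, b} X" "a < k" "b < k"
  shows "proper (kempe_swap c a b X)"
  unfolding proper_edge_colouring_def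
proof (intro conjI ballI impI)
  fix e assume "e \<in> E" then show "kempe_swap c a b X e < k"
    using assms proper_range by (auto simp: kempe_swap_def)
next
  fix e e' assume e: "e \<in> E" "e' \<in> E" and ne: "e \<noteq> e' \<and> e \<inter> e' \<noteq> {}"
  then obtain v where v: "v \<in> e" "v \<in> e'" by auto
  have "c e \<noteq> c e'" using assms(1) e ne by (auto simp: proper_edge_colouring_def)
  moreover have "e \<subseteq> X \<longleftrightarrow> e' \<subseteq> X" if "c e \<in> {a, b}" "c e' \<in> {a, b}"
    using that v e assms(2) unfolding closed_under_def by blast
  ultimately show "kempe_swap c a b X e \<noteq> kempe_swap c a b X e'"
    by (auto simp: kempe_swap_def)
qed

text \<open>
The edges of colour \<open>a\<close> inside \<open>X\<close> pair off the vertices of \<open>X\<close> that do not lack \<open>a\<close>.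
\<close>
lemma card_closed:
  assumes "proper c" "closed_under c {a} X"
  shows "card X = 2 * card {e \<in> E. c e = a \<and> e \<subseteq> X} + card (X \<inter> lack c a)"
proof -
  let ?M = "{e \<in> E. c e = a \<and> e \<subseteq> X}"
  have X: "X \<subseteq> V" using assms(2) by (simp add: closed_under_def)
  have fin: "finite X" using X finite_V finite_subset by blast
  have "x \<in> \<Union>?M" if x: "x \<in> X" "x \<notin> lack c a" for x
  proof -
    obtain e where "e \<in> E" "x \<in> e" "c e = a" using x X by (auto simp: lack_def)
    then show ?thesis using x(1) assms(2) by (fastforce simp: closed_under_def)
  qed
  then have eq: "X = \<Union>?M \<union> (X \<inter> lack c a)" by auto
  have disj: "\<Union>?M \<inter> (X \<inter> lack c a) = {}" by (auto simp: lack_def)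
  have "card (\<Union>?M) = (\<Sum>e\<in>?M. card e)"
    by (rule card_Union_disjoint)
      (use finite_edge in \<open>auto simp: pairwise_def disjnt_def dest: proper_eqE[OF assms(1)]\<close>)
  also have "\<dots> = 2 * card ?M" using edge_card by simp
  finally have "card (\<Union>?M) = 2 * card ?M" .
  moreover have "finite (\<Union>?M)" using fin by (auto intro: finite_subset)
  ultimately show ?thesis
    using card_Un_disjoint[OF _ _ disj] fin eq by simp
qed

lemma card_lack:
  assumes "proper c" shows "card V = 2 * card {e \<in> E. c e = a} + card (lack c a)"
proof -
  have "closed_under c {a} V" using edge_subset by (auto simp: closed_under_def)
  moreover have "{e \<in> E. c e = a \<and> e \<subseteq> V} = {e \<in> E. c e = a}" using edge_subset by auto
  moreover have "V \<inter> lack c a = lack c a" using lack_V by auto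
  ultimately show ?thesis using card_closed[OF assms, of a V] by simp
qed

lemma closed_under_subset: "closed_under c A X \<Longrightarrow> B \<subseteq> A \<Longrightarrow> closed_under c B X"
  by (auto simp: closed_under_def)

text \<open>
A connected graph has at least as many edges as vertices, minus one. Among the vertex sets that
contain \<open>v\<close> and satisfy this bound, a largest one must be the whole chain, because it could
otherwise be extended along an edge leaving it.
\<close>
lemma kempe_card_edges:
  assumes "v \<in> V"
  shows "card (kempe c a b v) \<le> 1 + card {e \<in> E. c e \<in> {a, b} \<and> e \<subseteq> kempe c a b v}"
proof -
  let ?X = "kempe c a b v" and ?F = "\<lambda>Y. {e \<in> E. c e \<in> {a, b} \<and> e \<subseteq> Y}"
  have finX: "finite ?X" by (rule finite_subset[OF kempe_V[OF assms] finite_V])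
  have finF: "finite (?F Y)" for Y using finite_E by simp
  define P where "P Y \<longleftrightarrow> v \<in> Y \<and> Y \<subseteq> ?X \<and> card Y \<le> 1 + card (?F Y)" for Y
  have "P {v}" by (simp add: P_def kempe_refl)
  moreover have "\<forall>Y. P Y \<longrightarrow> card Y < Suc (card ?X)"
    using finX by (auto simp: P_def less_Suc_eq_le intro: card_mono)
  ultimately have "\<exists>Y. P Y \<and> (\<forall>Z. P Z \<longrightarrow> card Z \<le> card Y)"
    by (rule ex_has_greatest_nat[of P "{v}" card])
  then obtain Y where Y: "P Y" and max: "\<And>Z. P Z \<Longrightarrow> card Z \<le> card Y"
    by metis
  have "?X \<subseteq> Y"
  proof
    fix y assume "y \<in> ?X"
    then have "(v, y) \<in> {(x, y). {x, y} \<in> E \<and> c {x, y} \<in> {a, b}}\<^sup>*" by (simp add: kempe_def)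
    then show "y \<in> Y"
    proof (induction rule: rtrancl_induct)
      case base then show ?case using Y by (simp add: P_def)
    next
      case (step y z)
      have yz: "{y, z} \<in> E" "c {y, z} \<in> {a, b}" using step by auto
      show ?case
      proof (rule ccontr)
        assume z: "z \<notin> Y"
        have finY: "finite Y" using Y finX finite_subset by (auto simp: P_def)
        have "z \<in> ?X" using closed_underD[OF kempe_closed[OF assms, of c a b] yz] step.IH Y
          by (auto simp: P_def)
        moreover have "insert {y, z} (?F Y) \<subseteq> ?F (insert z Y)"
          using yz step.IH by auto
        moreover have "{y, z} \<notin> ?F Y" using z by auto
        ultimately have "P (insert z Y)"
          using Y card_mono[OF finF, of "insert {y, z} (?F Y)" "insert z Y"] finF[of Y] finY z
          by (auto simp: P_def)
        then show False using max[of "insert z Y"] finY z by simp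
      qed
    qed
  qed
  then have "?X = Y" using Y by (auto simp: P_def)
  then show ?thesis using Y by (simp add: P_def)
qed

text \<open>
A Kempe chain is a path or a cycle and so has no end or two ends. This consequence can be had by
counting edges, without ever describing the shape of the chain.
\<close>
lemma kempe_ends:
  assumes "proper c" "v \<in> V" "a \<noteq> b"
  defines "X \<equiv> kempe c a b v"
  shows "card (X \<inter> lack c a) + card (X \<inter> lack c b) \<le> 2"
    and "even (card (X \<inter> lack c a) + card (X \<inter> lack c b))"
proof -
  have cl: "closed_under c {a, b} X" unfolding X_def using kempe_closed[OF assms(2)] .
  have a: "card X = 2 * card {e \<in> E. c e = a \<and> e \<subseteq> X} + card (X \<inter> lack c a)"
    using card_closed[OF assms(1) closed_under_subset[OF cl]] by auto
  have b: "card X = 2 * card {e \<in> E. c e = b \<and> e \<subseteq> X} + card (X \<inter> lack c b)"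
    using card_closed[OF assms(1) closed_under_subset[OF cl]] by auto
  have "{e \<in> E. c e \<in> {a, b} \<and> e \<subseteq> X} = {e \<in> E. c e = a \<and> e \<subseteq> X} \<union> {e \<in> E. c e = b \<and> e \<subseteq> X}"
    by auto
  moreover have "card ({e \<in> E. c e = a \<and> e \<subseteq> X} \<union> {e \<in> E. c e = b \<and> e \<subseteq> X})
      = card {e \<in> E. c e = a \<and> e \<subseteq> X} + card {e \<in> E. c e = b \<and> e \<subseteq> X}"
    by (rule card_Un_disjoint) (use finite_E assms(3) in auto)
  ultimately have "card X \<le> 1 + card {e \<in> E. c e = a \<and> e \<subseteq> X} + card {e \<in> E. c e = b \<and> e \<subseteq> X}"
    using kempe_card_edges[OF assms(2), of c a b] by (simp add: X_def)
  then show "card (X \<inter> lack c a) + card (X \<inter> lack c b) \<le> 2" using a b by linarith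
  show "even (card (X \<inter> lack c a) + card (X \<inter> lack c b))" using arg_cong[OF a, of even] arg_cong[OF b, of even] by simp
qed

lemma proper_recolour:
  assumes "proper c" "{u, v} \<in> E" "a < k" "u \<in> lack c a" "v \<in> lack c a"
  shows "proper (c({u, v} := a))"
  unfolding proper_edge_colouring_def
proof (intro conjI ballI impI)
  fix e assume "e \<in> E" then show "(c({u, v} := a)) e < k"
    using assms proper_range by auto
next
  fix e e' assume e: "e \<in> E" "e' \<in> E" and ne: "e \<noteq> e' \<and> e \<inter> e' \<noteq> {}"
  have cc: "c e \<noteq> c e'" using assms(1) e ne by (auto simp: proper_edge_colouring_def)
  have "c f \<noteq> a" if "f \<in> E" "f \<inter> {u, v} \<noteq> {}" for f
    using that assms(4,5) by (auto simp: lack_def)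
  then show "(c({u, v} := a)) e \<noteq> (c({u, v} := a)) e'"
    using cc e ne by (metis Int_commute fun_upd_apply)
qed

lemma lack_recolour_old:
  assumes "proper c" "{u, v} \<in> E" "c {u, v} \<noteq> a"
  shows "lack (c({u, v} := a)) (c {u, v}) = lack c (c {u, v}) \<union> {u, v}"
proof -
  have "e = {u, v}" if "e \<in> E" "c e = c {u, v}" "u \<in> e \<or> v \<in> e" for e
    using proper_eqE[OF assms(1) that(1) assms(2)] that by auto
  then show ?thesis
    using assms edge_in_V[OF assms(2)] by (auto simp: lack_def)
qed

lemma lack_recolour_other:
  assumes "d \<noteq> a" "d \<noteq> c {u, v}"
  shows "lack (c({u, v} := a)) d = lack c d"
  by (rule lack_cong) (use assms in auto)

end

section \<open>Chains and fans in tight graphs\<close>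

lemma card_exchange:
  assumes "finite A" "u \<in> A" "v = u \<or> v \<notin> A"
  shows "card (insert v (A - {u})) = card A"
proof (cases "v = u")
  case True then show ?thesis using assms by (simp add: insert_absorb)
next
  case False
  then show ?thesis using assms card.remove[OF assms(1,2)] by simp
qed

text \<open>
What the recolouring arguments use of the stability index: a class missing five vertices could be deleted too
cheaply. Five vertices lacking one colour are the contradiction at which every recolouring aims.
\<close>
locale tight_graph = colour_graph +
  assumes odd_order: "odd (card V)"
    and card_lack_le: "proper c \<Longrightarrow> a < k \<Longrightarrow> card (lack c a) \<le> 3"
begin

definition small :: "('a set \<Rightarrow> nat) \<Rightarrow> nat set" where
  "small c = {a. a < k \<and> card (lack c a) = 3}"

lemma smallD: "a \<in> small c \<Longrightarrow> a < k" "a \<in> small c \<Longrightarrow> card (lack c a) = 3"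
  by (simp_all add: small_def)

lemma card_lack_cases:
  assumes "proper c" "a < k" shows "card (lack c a) = 1 \<or> card (lack c a) = 3"
proof -
  have "odd (card (lack c a))"
    using arg_cong[OF card_lack[OF assms(1), of a], of even] odd_order by simp
  then obtain m where "card (lack c a) = 2 * m + 1" by (elim oddE)
  then show ?thesis using card_lack_le[OF assms] by arith
qed

lemma not_small_unique:
  assumes "proper c" "a < k" "a \<notin> small c" "x \<in> lack c a" "y \<in> lack c a"
  shows "x = y"
proof -
  have "card (lack c a) = 1" using card_lack_cases[OF assms(1,2)] assms by (auto simp: small_def)
  then show ?thesis using assms(4,5) by (auto simp: card_1_singleton_iff)
qed

lemma small_if_two:
  assumes "proper c" "a < k" "x \<in> lack c a" "y \<in> lack c a" "x \<noteq> y"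
  shows "a \<in> small c"
  using not_small_unique[OF assms(1,2) _ assms(3,4)] assms(5) by blast

lemma no_large_lack:
  assumes "proper c" "a < k" "S \<subseteq> lack c a" shows "card S \<le> 3"
  using card_lack_le[OF assms(1,2)] card_mono[OF finite_lack assms(3)] by simp

text \<open>
Recolouring \<open>uv\<close> with \<open>a\<close> would add \<open>u\<close> and \<open>v\<close> to the three vertices that lack the colour of \<open>uv\<close>.
\<close>
lemma small_edge_ends:
  assumes "proper c" "{u, v} \<in> E" "c {u, v} \<in> small c" "a < k" "u \<in> lack c a" "v \<in> lack c a"
  shows False
proof -
  let ?c = "c({u, v} := a)" and ?b = "c {u, v}"
  have ne: "?b \<noteq> a" using lackD assms by blast
  have "lack ?c ?b = lack c ?b \<union> {u, v}" using lack_recolour_old[OF assms(1,2) ne] .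
  moreover have "u \<notin> lack c ?b" "v \<notin> lack c ?b" using lackD lackD' assms(2) by blast+
  then have "lack c ?b \<inter> {u, v} = {}" by blast
  then have "card (lack c ?b \<union> {u, v}) = 5"
    using edge_neq[OF assms(2)] smallD(2)[OF assms(3)] finite_lack by (simp add: card_Un_disjoint)
  moreover have "proper ?c" using proper_recolour assms by blast
  ultimately show False using card_lack_le[of ?c ?b] smallD(1)[OF assms(3)] by simp
qed

text \<open>
A chain both of whose ends lack \<open>b\<close> could be exchanged, and then five vertices would lack \<open>a\<close>.
\<close>
lemma linked_end:
  assumes "proper c" "a \<in> small c" "b < k" "a \<noteq> b" "v \<in> lack c b"
  obtains g where "kempe c a b v \<inter> lack c a = {g}" "kempe c a b v \<inter> lack c b = {v}"
proof -
  let ?X = "kempe c a b v"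
  have a: "a < k" using smallD assms by blast
  have v: "v \<in> V" using assms lack_V by blast
  have cl: "closed_under c {a, b} ?X" using kempe_closed[OF v] .
  have fin: "finite (?X \<inter> lack c d)" for d using finite_lack by blast
  have vX: "v \<in> ?X \<inter> lack c b" using kempe_refl assms by auto
  have b1: "card (?X \<inter> lack c b) \<ge> 1"
    using vX fin by (metis One_nat_def Suc_leI card_gt_0_iff empty_iff)
  have "card (?X \<inter> lack c a) = 1 \<and> card (?X \<inter> lack c b) = 1"
  proof (rule ccontr)
    assume "\<not> ?thesis"
    then have z: "card (?X \<inter> lack c a) = 0" and t: "card (?X \<inter> lack c b) = 2"
      using kempe_ends[OF assms(1) v assms(4)] b1
      by (auto simp: le_Suc_eq numeral_2_eq_2)
    have "lack (kempe_swap c a b ?X) a = lack c a \<union> (lack c b \<inter> ?X)"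
      using lack_swap_left[OF cl assms(4)] z fin by auto
    moreover have "lack c a \<inter> (lack c b \<inter> ?X) = {}" using z fin by auto
    ultimately have "card (lack (kempe_swap c a b ?X) a) = 5"
      using t smallD(2)[OF assms(2)] finite_lack fin by (simp add: card_Un_disjoint Int_commute)
    then show False
      using card_lack_le[OF proper_swap[OF assms(1) cl a assms(3)] a] by simp
  qed
  then obtain g where "?X \<inter> lack c a = {g}" "?X \<inter> lack c b = {v}"
    using vX by (metis card_1_singletonE singletonD)
  then show thesis using that by blast
qed

lemma linked_unique:
  assumes "proper c" "a \<in> small c" "b < k" "a \<noteq> b" "v \<in> lack c b" "w \<in> lack c b"
    "u \<in> kempe c a b v" "u \<in> kempe c a b w"
  shows "v = w"
proof -
  have "kempe c a b v = kempe c a b w" using kempe_eq assms(7,8) by metis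
  then have "w \<in> kempe c a b v" using kempe_refl by metis
  then show ?thesis using linked_end[OF assms(1-5)] assms(6) by blast
qed

lemma linked_unique_left:
  assumes "proper c" "a \<in> small c" "b < k" "a \<noteq> b" "v \<in> lack c b" "u \<in> lack c a" "w \<in> lack c a"
    "u \<in> kempe c a b v" "w \<in> kempe c a b v"
  shows "u = w"
proof -
  obtain g where "kempe c a b v \<inter> lack c a = {g}" by (rule linked_end[OF assms(1-5)])
  then show ?thesis using assms(6-9) by (metis IntI singletonD)
qed

text \<open>
Exchanging the colours on the chain between \<open>u\<close> and \<open>v\<close> just makes these two vertices trade the
colours they lack; all class sizes stay as they are.
\<close>
lemma linked_swap:
  assumes "proper c" "a \<in> small c" "b < k" "a \<noteq> b" "v \<in> lack c b"
    "u \<in> lack c a" "u \<in> kempe c a b v"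
  defines "c' \<equiv> kempe_swap c a b (kempe c a b v)"
  shows "proper c'" "lack c' a = insert v (lack c a - {u})" "lack c' b = insert u (lack c b - {v})"
    "\<And>d. d \<noteq> a \<Longrightarrow> d \<noteq> b \<Longrightarrow> lack c' d = lack c d" "a \<in> small c'" "b \<in> small c' \<longleftrightarrow> b \<in> small c"
    "\<And>d. d \<noteq> a \<Longrightarrow> d \<noteq> b \<Longrightarrow> d \<in> small c' \<longleftrightarrow> d \<in> small c"
proof -
  let ?X = "kempe c a b v"
  have v: "v \<in> V" using assms lack_V by blast
  have cl: "closed_under c {a, b} ?X" using kempe_closed[OF v] .
  obtain g where "?X \<inter> lack c a = {g}" and b: "?X \<inter> lack c b = {v}"
    using linked_end[OF assms(1-5)] by blast
  then have a: "?X \<inter> lack c a = {u}" using assms(6,7) by auto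
  show p: "proper c'" unfolding c'_def using proper_swap[OF assms(1) cl smallD(1)[OF assms(2)] assms(3)] .
  show la: "lack c' a = insert v (lack c a - {u})"
    unfolding c'_def lack_swap_left[OF cl assms(4)] using a b by auto
  show lb: "lack c' b = insert u (lack c b - {v})"
    unfolding c'_def lack_swap_right[OF cl assms(4)] using a b by auto
  show other: "\<And>d. d \<noteq> a \<Longrightarrow> d \<noteq> b \<Longrightarrow> lack c' d = lack c d"
    unfolding c'_def using lack_swap_other by simp
  have va: "v = u \<or> v \<notin> lack c a" using a kempe_refl[of v c a b] by auto
  have ub: "u = v \<or> u \<notin> lack c b" using b assms(7) by auto
  have "card (lack c' a) = card (lack c a)"
    unfolding la using card_exchange[OF finite_lack assms(6) va] .
  then show "a \<in> small c'" using assms(2) by (simp add: small_def)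
  have "card (lack c' b) = card (lack c b)"
    unfolding lb using card_exchange[OF finite_lack assms(5) ub] .
  then show "b \<in> small c' \<longleftrightarrow> b \<in> small c" by (simp add: small_def)
  show "\<And>d. d \<noteq> a \<Longrightarrow> d \<noteq> b \<Longrightarrow> d \<in> small c' \<longleftrightarrow> d \<in> small c"
    using other by (simp add: small_def)
qed

text \<open>
A big colour \<open>b\<close>, lacked by \<open>v\<close> alone, can be turned into a small one at the expense of \<open>a\<close>, by an
exchange on everything outside the chain of \<open>v\<close>. It is then lacked by \<open>v\<close> and by the two vertices
lacking \<open>a\<close> to which \<open>v\<close> is not linked.
\<close>
lemma promote:
  assumes "proper c" "a \<in> small c" "b < k" "b \<notin> small c" "v \<in> lack c b"
  obtains c' g where "proper c'" "g \<in> lack c a" "lack c' a = {g}"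
    "lack c' b = insert v (lack c a - {g})" "b \<in> small c'" "a \<notin> small c'" "g \<in> kempe c a b v"
    "\<And>d. d \<noteq> a \<Longrightarrow> d \<noteq> b \<Longrightarrow> lack c' d = lack c d"
    "\<And>d. d \<noteq> a \<Longrightarrow> d \<noteq> b \<Longrightarrow> d \<in> small c' \<longleftrightarrow> d \<in> small c"
    "\<And>e d. d \<noteq> a \<Longrightarrow> d \<noteq> b \<Longrightarrow> c' e = d \<longleftrightarrow> c e = d"
proof -
  let ?X = "kempe c a b v"
  have ne: "a \<noteq> b" using assms by auto
  have v: "v \<in> V" using assms lack_V by blast
  have cl: "closed_under c {a, b} (V - ?X)" using kempe_closed[OF v] by (rule closed_under_Compl)
  obtain g where a: "?X \<inter> lack c a = {g}" and b: "?X \<inter> lack c b = {v}"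
    using linked_end[OF assms(1-3) ne assms(5)] by blast
  have bb: "lack c b = {v}" using not_small_unique[OF assms(1,3,4)] assms(5) by blast
  define c' where "c' = kempe_swap c a b (V - ?X)"
  have p: "proper c'" unfolding c'_def using proper_swap[OF assms(1) cl smallD(1)[OF assms(2)] assms(3)] .
  have la: "lack c' a = {g}"
    unfolding c'_def lack_swap_left[OF cl ne] using a bb lack_V[of c a] kempe_refl[of v c a b] by auto
  have lb: "lack c' b = insert v (lack c a - {g})"
    unfolding c'_def lack_swap_right[OF cl ne] using a bb lack_V[of c a] kempe_refl[of v c a b] v by auto
  have other: "\<And>d. d \<noteq> a \<Longrightarrow> d \<noteq> b \<Longrightarrow> lack c' d = lack c d"
    unfolding c'_def using lack_swap_other by simp
  have g: "g \<in> lack c a" "g \<in> ?X" using a by auto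
  have "card (lack c a - {g}) = 2" using g smallD(2)[OF assms(2)] finite_lack by simp
  moreover have "v \<notin> lack c a - {g}" using a kempe_refl[of v c a b] by auto
  ultimately have "card (lack c' b) = 3" unfolding lb using finite_lack by simp
  then have "b \<in> small c'" using assms by (simp add: small_def)
  moreover have "a \<notin> small c'" using la by (simp add: small_def)
  moreover have "\<And>d. d \<noteq> a \<Longrightarrow> d \<noteq> b \<Longrightarrow> d \<in> small c' \<longleftrightarrow> d \<in> small c"
    using other by (simp add: small_def)
  moreover have "\<And>e d. d \<noteq> a \<Longrightarrow> d \<noteq> b \<Longrightarrow> c' e = d \<longleftrightarrow> c e = d"
    unfolding c'_def using kempe_swap_other by blast
  ultimately show thesis using that p la lb other g by blast
qed

text \<open>
A path in the sense of Vizing's fans at \<open>u\<close>, starting with the edge from \<open>u\<close> to \<open>v0\<close>. The list is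
reversed, so that its head is the vertex reached last and the recursion follows the fan back.
\<close>
fun fan :: "('a set \<Rightarrow> nat) \<Rightarrow> 'a \<Rightarrow> 'a \<Rightarrow> 'a list \<Rightarrow> bool" where
  "fan c u v0 [] \<longleftrightarrow> False"
| "fan c u v0 [v] \<longleftrightarrow> v = v0 \<and> {u, v} \<in> E"
| "fan c u v0 (v # w # ws) \<longleftrightarrow>
     fan c u v0 (w # ws) \<and> {u, v} \<in> E \<and> v \<notin> set (w # ws) \<and> w \<in> lack c (c {u, v})"

lemma fan_edge: "fan c u v0 vs \<Longrightarrow> v \<in> set vs \<Longrightarrow> {u, v} \<in> E"
proof (induction vs)
  case (Cons a vs) then show ?case by (cases vs) auto
qed simp

lemma fan_start: "fan c u v0 vs \<Longrightarrow> v0 \<in> set vs"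
proof (induction vs)
  case (Cons a vs) then show ?case by (cases vs) auto
qed simp

lemma fan_suffix: "fan c u v0 (ws @ v # vs) \<Longrightarrow> fan c u v0 (v # vs)"
proof (induction ws)
  case (Cons a ws) then show ?case by (cases ws) auto
qed simp

lemma fan_transfer:
  assumes "fan c u v0 vs" "\<And>x. x \<in> set vs \<Longrightarrow> c' {u, x} = c {u, x}"
    "\<And>x y. x \<in> set (tl vs) \<Longrightarrow> y \<in> set vs \<Longrightarrow> x \<in> lack c (c {u, y}) \<Longrightarrow> x \<in> lack c' (c {u, y})"
  shows "fan c' u v0 vs"
  using assms
proof (induction c u v0 vs rule: fan.induct)
  case (3 c u v0 v w ws)
  have "fan c' u v0 (w # ws)"
  proof (rule "3.IH")
    show "fan c u v0 (w # ws)" using "3.prems"(1) by simp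
    show "\<And>x. x \<in> set (w # ws) \<Longrightarrow> c' {u, x} = c {u, x}" using "3.prems"(2) by simp
    show "\<And>x y. x \<in> set (tl (w # ws)) \<Longrightarrow> y \<in> set (w # ws) \<Longrightarrow> x \<in> lack c (c {u, y})
      \<Longrightarrow> x \<in> lack c' (c {u, y})" using "3.prems"(3) by simp
  qed
  moreover have "w \<in> lack c' (c' {u, v})" using "3.prems"(1) "3.prems"(2)[of v] "3.prems"(3)[of w v] by simp
  ultimately show ?case using "3.prems"(1) by simp
qed auto

text \<open>
The last edge of the fan can take the colour \<open>a\<close>, which frees its own colour at \<open>u\<close> for the edge
before it, and so on. In the end the edge from \<open>u\<close> to \<open>v0\<close> has given up its small colour and no edge has
taken it. Starting from the last edge makes every intermediate colouring proper.
\<close>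
lemma fan_rotate:
  assumes "proper c" "fan c u v0 (v # ws)" "c {u, v0} \<in> small c" "a < k" "u \<in> lack c a" "v \<in> lack c a"
  shows False
  using assms
proof (induction ws arbitrary: c v a)
  case Nil
  have v: "v = v0" "{u, v} \<in> E" using Nil.prems(2) by auto
  then show ?case using small_edge_ends[OF Nil.prems(1) v(2) _ Nil.prems(4,5,6)] Nil.prems(3) by simp
next
  case (Cons w ws)
  let ?c = "c({u, v} := a)" and ?b = "c {u, v}"
  have uv: "{u, v} \<in> E" and f: "fan c u v0 (w # ws)" and vn: "v \<notin> set (w # ws)" and w: "w \<in> lack c ?b"
    using Cons.prems(2) unfolding fan.simps(3) by blast+
  have v0: "v0 \<in> set (w # ws)" "{u, v0} \<in> E" using fan_start[OF f] fan_edge[OF f fan_start[OF f]] by simp_all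
  have ne: "?b \<noteq> a" using lackD[OF Cons.prems(5) uv] .
  have edge_ne: "{u, x} \<noteq> {u, v}" if "x \<in> set (w # ws)" for x using that vn by (auto simp: doubleton_eq_iff)
  have b0: "c {u, v0} \<noteq> ?b" using proper_eq[OF Cons.prems(1) v0(2) uv] v0(1) vn by blast
  have a0: "c {u, v0} \<noteq> a" using lackD[OF Cons.prems(5) v0(2)] .
  have c0: "?c {u, v0} = c {u, v0}" using edge_ne[OF v0(1)] by simp
  have old: "lack ?c ?b = lack c ?b \<union> {u, v}" using lack_recolour_old[OF Cons.prems(1) uv ne] .
  show ?case
  proof (rule Cons.IH[of ?c w ?b])
    show "proper ?c" using proper_recolour[OF Cons.prems(1) uv Cons.prems(4-6)] .
    show "fan ?c u v0 (w # ws)"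
    proof (rule fan_transfer[OF f])
      show "?c {u, x} = c {u, x}" if "x \<in> set (w # ws)" for x using edge_ne[OF that] by simp
      fix x y assume x: "x \<in> set (tl (w # ws))" and y: "y \<in> set (w # ws)" and l: "x \<in> lack c (c {u, y})"
      have "c {u, y} \<noteq> a" using lackD[OF Cons.prems(5) fan_edge[OF f y]] .
      then show "x \<in> lack ?c (c {u, y})"
        using l old lack_recolour_other[of "c {u, y}" a c u v] by (cases "c {u, y} = ?b") auto
    qed
    show "?c {u, v0} \<in> small ?c"
      using Cons.prems(3) lack_recolour_other[of "c {u, v0}" a c u v, OF a0 b0] by (simp only: c0 small_def mem_Collect_eq)
    show "?b < k" using proper_range[OF Cons.prems(1) uv] .
    show "u \<in> lack ?c ?b" "w \<in> lack ?c ?b" using old w by auto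
  qed
qed

text \<open>
If \<open>u\<close> were not on the chain of \<open>v\<close>, an exchange on that chain would make \<open>v\<close> lack \<open>a\<close> and the fan could
be rotated. The exchange does not destroy the fan: by induction the earlier fan vertices lacking \<open>b\<close>
are linked to \<open>u\<close>, so they do not lie on the chain of \<open>v\<close>.
\<close>
lemma fan_linked:
  assumes "proper c" "fan c u v0 (v # ws)" "c {u, v0} \<in> small c" "a \<in> small c" "u \<in> lack c a"
    "b \<in> miss c v"
  shows "b \<noteq> a \<and> u \<in> kempe c a b v"
  using assms(2,6)
proof (induction ws arbitrary: v b rule: length_induct)
  case (1 ws)
  have a: "a < k" using smallD assms(4) by blast
  have b: "b < k" "v \<in> lack c b" using "1.prems" by (auto simp: miss_def)
  have ne: "b \<noteq> a" using fan_rotate[OF assms(1) "1.prems"(1) assms(3) a assms(5)] b by auto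
  let ?X = "kempe c a b v"
  define c' where "c' = kempe_swap c a b ?X"
  have "u \<in> ?X"
  proof (rule ccontr)
    assume u: "u \<notin> ?X"
    obtain g where g: "?X \<inter> lack c a = {g}" "?X \<inter> lack c b = {v}"
      using linked_end[OF assms(1,4) b(1) ne[symmetric] b(2)] by blast
    then have g': "g \<in> lack c a" "g \<in> ?X" by auto
    note sw = linked_swap[OF assms(1,4) b(1) ne[symmetric] b(2) g', folded c'_def]
    have ua: "u \<in> lack c' a" "v \<in> lack c' a" using sw(2) assms(5) u g' by auto
    have cu: "c' {u, x} = c {u, x}" for x unfolding c'_def using kempe_swap_edge_out[OF u] .
    have f': "fan c' u v0 (v # ws)"
    proof (rule fan_transfer[OF "1.prems"(1)])
      show "c' {u, x} = c {u, x}" for x by (rule cu)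
      fix x y assume x: "x \<in> set (tl (v # ws))" and y: "y \<in> set (v # ws)" and l: "x \<in> lack c (c {u, y})"
      have uy: "{u, y} \<in> E" using fan_edge[OF "1.prems"(1) y] .
      have ya: "c {u, y} \<noteq> a" using lackD[OF assms(5) uy] .
      show "x \<in> lack c' (c {u, y})"
      proof (cases "c {u, y} = b")
        case False then show ?thesis using sw(4) ya l by simp
      next
        case True
        obtain ps vs where ws: "ws = ps @ x # vs" using x by (auto dest: split_list)
        have fx: "fan c u v0 (x # vs)" using "1.prems"(1) fan_suffix[of c u v0 "v # ps"] ws by simp
        have "b \<in> miss c x" using l True b(1) by (simp add: miss_def)
        moreover have "length vs < length ws" using ws by simp
        ultimately have ux: "u \<in> kempe c a b x" using "1.IH" fx by blast
        have "x \<noteq> v" using ux u by auto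
        then show ?thesis using sw(3) l True by simp
      qed
    qed
    have "c {u, v0} \<noteq> a" using lackD[OF assms(5)] fan_edge[OF "1.prems"(1)] fan_start[OF "1.prems"(1)] by blast
    then have "c' {u, v0} \<in> small c'" using sw(6,7) assms(3) cu by (cases "c {u, v0} = b") auto
    then show False using fan_rotate[OF sw(1) f' _ a ua] by blast
  qed
  then show ?case using ne by blast
qed

end

context sgraph
begin

definition nbrs :: "'a \<Rightarrow> 'a set" where
  "nbrs v = {y. {v, y} \<in> E}"

lemma nbrs_V: "nbrs v \<subseteq> V"
  using edge_in_V by (auto simp: nbrs_def)

lemma finite_nbrs: "finite (nbrs v)"
  using finite_subset[OF nbrs_V finite_V] .

lemma degree_nbrs: "degree G v = card (nbrs v)"
proof -
  have "{e \<in> E. v \<in> e} = (\<lambda>y. {v, y}) ` nbrs v"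
  proof (rule set_eqI)
    fix e show "e \<in> {e \<in> E. v \<in> e} \<longleftrightarrow> e \<in> (\<lambda>y. {v, y}) ` nbrs v"
      using edge_at[of e v] by (auto simp: nbrs_def)
  qed
  moreover have "inj_on (\<lambda>y. {v, y}) (nbrs v)" by (auto simp: inj_on_def doubleton_eq_iff)
  ultimately show ?thesis by (simp add: degree_def card_image)
qed

end

context colour_graph
begin

text \<open>
The vertices at which more than one of the \<open>k\<close> colours is missing.
\<close>
definition deficient :: "'a set" where
  "deficient = {v \<in> V. Suc (degree G v) < k}"

lemma deficient_V: "deficient \<subseteq> V"
  by (auto simp: deficient_def)

lemma finite_deficient: "finite deficient"
  using finite_subset[OF deficient_V finite_V] .

lemma card_miss_full:
  assumes "proper c" "v \<in> V" shows "card (miss c v) = 1 \<longleftrightarrow> v \<notin> deficient"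
  using card_miss[OF assms] degree_less[OF assms(2)] assms(2) by (auto simp: deficient_def)

lemma miss_full:
  assumes "proper c" "v \<in> V" "v \<notin> deficient" "v \<in> lack c a" "a < k" shows "miss c v = {a}"
proof -
  have "card (miss c v) = 1" using card_miss_full assms by blast
  then obtain b where "miss c v = {b}" by (auto simp: card_1_singleton_iff)
  moreover have "a \<in> miss c v" using assms by (simp add: miss_def)
  ultimately show ?thesis by simp
qed

lemma full_lack_unique:
  assumes "proper c" "v \<in> V" "v \<notin> deficient" "v \<in> lack c a" "a < k" "v \<in> lack c b" "b < k" shows "a = b"
  using miss_full[OF assms(1-5)] miss_full[OF assms(1-3,6,7)] by simp

lemma missD: "a \<in> miss c v \<Longrightarrow> a < k" "a \<in> miss c v \<Longrightarrow> v \<in> lack c a"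
  by (simp_all add: miss_def)

lemma obtain_miss:
  assumes "proper c" "v \<in> V" obtains a where "a < k" "v \<in> lack c a"
  using miss_nonempty[OF assms] that by (auto simp: miss_def)

lemma sum_lack_miss:
  assumes "proper c" shows "(\<Sum>a<k. card (lack c a)) = (\<Sum>v\<in>V. card (miss c v))"
proof -
  have "(\<Sum>a<k. card (lack c a)) = (\<Sum>a<k. \<Sum>v\<in>V. if v \<in> lack c a then 1 else 0)"
    using finite_V lack_V by (intro sum.cong) (auto simp: sum.If_cases Int_absorb1 Int_commute)
  also have "\<dots> = (\<Sum>v\<in>V. \<Sum>a<k. if v \<in> lack c a then 1 else 0)" by (rule sum.swap)
  also have "\<dots> = (\<Sum>v\<in>V. card (miss c v))"
    by (intro sum.cong) (auto simp: sum.If_cases miss_def Int_def lessThan_def)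
  finally show ?thesis .
qed

end

context tight_graph
begin

text \<open>
The counting step behind Vizing's adjacency lemma. Let \<open>R\<close> be the set of all vertices reached by
fans from the edge of colour \<open>b\<close> at \<open>u\<close>. Since they are linked to \<open>u\<close>, no two vertices of \<open>R\<close> lack the
same colour, and no colour that they lack is missing at \<open>u\<close>, so each of these colours leads to a vertex of \<open>R\<close>
again. Every vertex lacks some colour. Hence there is no room for a vertex of \<open>R\<close> lacking two colours, and
all colours on edges from \<open>u\<close> to \<open>R\<close>, among them \<open>b\<close>, are lacked in \<open>R\<close>.
\<close>
lemma full_small_neighbour:
  assumes "proper c" "a \<in> small c" "b \<in> small c" "u \<in> lack c a" "u \<notin> lack c b"
  obtains p where "{u, p} \<in> E" "p \<in> lack c b" "u \<in> kempe c a b p" "p \<notin> deficient"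
proof -
  have u: "u \<in> V" using assms lack_V by blast
  obtain v0 where v0: "{u, v0} \<in> E" "c {u, v0} = b" using not_lack_edge[OF u assms(5)] by metis
  define R where "R = {v. \<exists>ws. fan c u v0 (v # ws)}"
  have RE: "{u, v} \<in> E" if "v \<in> R" for v using that fan_edge by (fastforce simp: R_def)
  then have RV: "R \<subseteq> V" using edge_in_V by blast
  have finR: "finite R" using finite_subset[OF RV finite_V] .
  have v0R: "v0 \<in> R" using v0 by (auto simp: R_def intro: exI[of _ "[]"])
  have link: "d \<noteq> a \<and> u \<in> kempe c a d v" if "v \<in> R" "d \<in> miss c v" for v d
    using that fan_linked[OF assms(1) _ _ assms(2,4)] v0(2) assms(3) by (auto simp: R_def)
  define S where "S = Sigma R (miss c)"
  define C where "C = (\<lambda>x. c {u, x}) ` R"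
  have inj: "inj_on snd S"
  proof (rule inj_onI)
    fix x y assume x: "x \<in> S" and y: "y \<in> S" and e: "snd x = snd y"
    obtain v d where xv: "x = (v, d)" "v \<in> R" "d \<in> miss c v" using x by (auto simp: S_def)
    obtain w where yw: "y = (w, d)" "w \<in> R" "d \<in> miss c w" using y e xv by (auto simp: S_def)
    have "v = w"
      by (rule linked_unique[OF assms(1,2) missD(1)[OF xv(3)] _ missD(2)[OF xv(3)] missD(2)[OF yw(3)]])
        (use link xv yw in auto)
    then show "x = y" using xv yw by simp
  qed
  have sub: "snd ` S \<subseteq> C"
  proof
    fix d assume "d \<in> snd ` S"
    then obtain v where v: "v \<in> R" "d \<in> miss c v" by (auto simp: S_def)
    have d: "d < k" "v \<in> lack c d" "d \<noteq> a" using missD v link by blast+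
    have "u \<notin> lack c d"
    proof
      assume "u \<in> lack c d"
      then have "v = u"
        using linked_unique[OF assms(1,2) d(1) d(3)[symmetric] d(2)] link[OF v] kempe_refl by metis
      then show False using RE[OF v(1)] edge_neq by blast
    qed
    then obtain y where y: "{u, y} \<in> E" "c {u, y} = d" using not_lack_edge[OF u] by metis
    obtain ws where ws: "fan c u v0 (v # ws)" using v(1) by (auto simp: R_def)
    have "y \<in> R"
    proof (cases "y \<in> set (v # ws)")
      case True
      then obtain ps vs where "v # ws = ps @ y # vs" by (meson split_list)
      then have "fan c u v0 (y # vs)" using fan_suffix[of c u v0 ps y vs] ws by simp
      then show ?thesis by (auto simp: R_def)
    next
      case False
      then have "fan c u v0 (y # v # ws)" using ws y d(2) by simp
      then show ?thesis unfolding R_def by blast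
    qed
    then show "d \<in> C" using y by (auto simp: C_def)
  qed
  have ge1: "1 \<le> card (miss c v)" if "v \<in> R" for v
    using miss_nonempty[OF assms(1)] RV that finite_miss by (metis One_nat_def Suc_leI card_gt_0_iff subsetD)
  have cS: "card S = (\<Sum>v\<in>R. card (miss c v))"
    unfolding S_def using finR finite_miss by simp
  have finC: "finite C" using finR by (simp add: C_def)
  have "card C \<le> card R" unfolding C_def using finR by (rule card_image_le)
  moreover have "card S \<le> card C" using card_mono[OF finC sub] card_image[OF inj] by simp
  moreover have "(\<Sum>v\<in>R. 1) \<le> (\<Sum>v\<in>R. card (miss c v))" using ge1 by (rule sum_mono)
  ultimately have eq: "card S = card R" "card C = card S" using cS by auto
  \<comment> \<open>Both bounds meet, so each summand of the number of missing colours is at its minimum 1.\<close>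
  have one: "1 = card (miss c v)" if "v \<in> R" for v
    by (rule sum_mono_inv[where I = R and f = "\<lambda>_. 1" and g = "\<lambda>v. card (miss c v)"])
      (use eq cS ge1 that finR in auto)
  have "snd ` S = C" using card_subset_eq[OF finC sub] eq card_image[OF inj] by simp
  moreover have "b \<in> C" using v0R v0(2) by (auto simp: C_def)
  ultimately obtain p where p: "p \<in> R" "b \<in> miss c p" by (auto simp: S_def)
  have "p \<notin> deficient" using one[OF p(1)] card_miss_full[OF assms(1)] RV p(1) by auto
  then show thesis using that[OF RE[OF p(1)] missD(2)[OF p(2)]] link[OF p] by blast
qed

text \<open>
The other end of the chain of \<open>v\<close> lacks \<open>a\<close> but not \<open>b\<close>, so the preceding lemma links it to a
non-deficient vertex lacking \<open>b\<close>. That vertex can only be \<open>v\<close>.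
\<close>
lemma small_diff_full:
  assumes "proper c" "a \<in> small c" "b \<in> small c" "v \<in> lack c b" "v \<notin> lack c a"
  shows "v \<notin> deficient"
proof -
  have ne: "a \<noteq> b" using assms by auto
  have b: "b < k" using smallD assms by blast
  obtain g where ga: "kempe c a b v \<inter> lack c a = {g}" and gb: "kempe c a b v \<inter> lack c b = {v}"
    by (rule linked_end[OF assms(1,2) b ne assms(4)])
  have g: "g \<in> lack c a" "g \<in> kempe c a b v" using ga by auto
  have "g \<notin> lack c b" using g gb assms(5) by auto
  then obtain p where p: "p \<in> lack c b" "g \<in> kempe c a b p" "p \<notin> deficient"
    using full_small_neighbour[OF assms(1-3) g(1)] by metis
  have "v = p" by (rule linked_unique[OF assms(1,2) b ne assms(4) p(1) g(2) p(2)])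
  then show ?thesis using p by simp
qed

end

context tight_graph
begin

lemma sum_card_miss:
  assumes "proper c" shows "(\<Sum>v\<in>V. card (miss c v)) = k + 2 * card (small c)"
proof -
  have "(\<Sum>a<k. card (lack c a)) = (\<Sum>a<k. 1 + (if a \<in> small c then 2 else 0))"
    using card_lack_cases[OF assms] by (intro sum.cong) (auto simp: small_def)
  also have "\<dots> = k + 2 * card {a \<in> {..<k}. a \<in> small c}"
    unfolding sum.distrib by (simp add: sum.If_cases Int_def)
  also have "{a \<in> {..<k}. a \<in> small c} = small c" using smallD(1) by auto
  finally show ?thesis using sum_lack_miss[OF assms] by simp
qed

end

text \<open>
The number of small colours is the same for all colourings because it is determined by the degrees.
\<close>
section \<open>Deficient vertices\<close>

locale two_small = tight_graph +
  fixes s :: nat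
  assumes card_small: "proper c \<Longrightarrow> card (small c) = s"
    and two_le_s: "2 \<le> s"
    and order_gt: "3 < card V"
    and colourable: "\<exists>c. proper c"
begin

lemma finite_small: "finite (small c)"
  by (simp add: small_def)

lemma other_small:
  assumes "proper c" obtains b where "b \<in> small c" "b \<noteq> a"
proof -
  have "\<not> small c \<subseteq> {a}"
    using card_mono[of "{a}" "small c"] card_small[OF assms] two_le_s by auto
  then obtain b where "b \<in> small c" "b \<noteq> a" by auto
  then show ?thesis by (rule that)
qed

text \<open>
If \<open>v\<close> lacks some other small colour then \<open>small_diff_full\<close> applies directly; if it lacks only big
ones, one of them is first made small without touching the colour \<open>a\<close>.
\<close>
lemma deficient_lacks_small:
  assumes "proper c" "v \<in> deficient" "a \<in> small c"
  shows "v \<in> lack c a"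
proof (rule ccontr)
  assume v: "v \<notin> lack c a"
  have vV: "v \<in> V" using assms deficient_V by blast
  obtain d where d: "d < k" "v \<in> lack c d" by (rule obtain_miss[OF assms(1) vV])
  show False
  proof (cases "d \<in> small c")
    case True
    then show False using small_diff_full[OF assms(1,3) True d(2) v] assms(2) by blast
  next
    case False
    obtain b where b: "b \<in> small c" "b \<noteq> a" by (rule other_small[OF assms(1)])
    obtain c' g where c': "proper c'" "lack c' d = insert v (lack c b - {g})" "d \<in> small c'"
      "\<And>e. e \<noteq> b \<Longrightarrow> e \<noteq> d \<Longrightarrow> lack c' e = lack c e"
      "\<And>e. e \<noteq> b \<Longrightarrow> e \<noteq> d \<Longrightarrow> e \<in> small c' \<longleftrightarrow> e \<in> small c"
      using promote[OF assms(1) b(1) d(1) False d(2)] by metis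
    have ad: "a \<noteq> d" using False assms(3) by auto
    have "a \<in> small c'" "v \<notin> lack c' a" "v \<in> lack c' d" using c' ad b assms(3) v by auto
    then show False using small_diff_full[OF c'(1) _ c'(3)] assms(2) by blast
  qed
qed

lemma deficient_lack_subset: "proper c \<Longrightarrow> a \<in> small c \<Longrightarrow> deficient \<subseteq> lack c a"
  by (rule subsetI) (rule deficient_lacks_small)

lemma card_lack_full:
  assumes "proper c" "a \<in> small c" shows "card (lack c a - deficient) + card deficient = 3"
  using deficient_lack_subset[OF assms] smallD(2)[OF assms(2)] finite_deficient card_mono[OF finite_lack, of deficient c a]
  by (simp add: card_Diff_subset)

text \<open>
An exchange on the chain would take \<open>u\<close> out of the set of vertices lacking \<open>a\<close>, although \<open>a\<close>
stays small.
\<close>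
lemma linked_not_deficient:
  assumes "proper c" "a \<in> small c" "b < k" "a \<noteq> b" "v \<in> lack c b" "u \<in> lack c a"
    "u \<in> kempe c a b v" "u \<noteq> v"
  shows "u \<notin> deficient"
proof
  assume u: "u \<in> deficient"
  note sw = linked_swap[OF assms(1-7)]
  have "u \<in> insert v (lack c a - {u})" using deficient_lacks_small[OF sw(1) u sw(5)] sw(2) by simp
  then show False using assms(8) by simp
qed

text \<open>
If the deficient vertices were the only ones to lack a small colour, any other vertex would have
to be linked to one of them.
\<close>
lemma card_deficient_le: "card deficient \<le> 2"
proof (rule ccontr)
  assume "\<not> card deficient \<le> 2"
  obtain c where c: "proper c" using colourable by blast
  have eq: "lack c a = deficient" if "a \<in> small c" for a
    using card_seteq[OF finite_lack deficient_lack_subset[OF c that]] smallD(2)[OF that] \<open>\<not> card deficient \<le> 2\<close>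
    by simp
  obtain a where a: "a \<in> small c" using other_small[OF c] by metis
  have "card deficient = 3" using eq[OF a] smallD(2)[OF a] by simp
  then have "\<not> V \<subseteq> deficient" using order_gt card_mono[OF finite_deficient, of V] by auto
  then obtain v where v: "v \<in> V" "v \<notin> deficient" by blast
  obtain d where d: "d < k" "v \<in> lack c d" by (rule obtain_miss[OF c v(1)])
  have ds: "d \<notin> small c" using eq d(2) v(2) by blast
  then have ad: "a \<noteq> d" using a by auto
  obtain g where "kempe c a d v \<inter> lack c a = {g}" by (rule linked_end[OF c a d(1) ad d(2)])
  then have g: "g \<in> kempe c a d v" "g \<in> lack c a" by auto
  have "g \<noteq> v" using g(2) eq[OF a] v(2) by auto
  then have "g \<notin> deficient" by (rule linked_not_deficient[OF c a d(1) ad d(2) g(2,1)])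
  then show False using g(2) eq[OF a] by simp
qed

text \<open>
The vertex \<open>w\<close> is the only non-deficient vertex lacking \<open>b\<close>, so it is the neighbour of \<open>v\<close> that
\<open>full_small_neighbour\<close> provides, once \<open>v\<close> lacks a small colour.
\<close>
lemma adjacent_small:
  assumes "card deficient = 2" "proper c" "b \<in> small c" "v \<in> V" "v \<notin> deficient" "v \<notin> lack c b"
    "w \<in> lack c b" "w \<notin> deficient"
  shows "{v, w} \<in> E"
proof -
  obtain d where d: "d < k" "v \<in> lack c d" by (rule obtain_miss[OF assms(2,4)])
  have "card (lack c b - deficient) = 1" using card_lack_full[OF assms(2,3)] assms(1) by simp
  then obtain w' where w': "lack c b - deficient = {w'}" by (auto simp: card_1_singleton_iff)
  have only: "p = w" if "p \<in> lack c b" "p \<notin> deficient" for p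
    using w' that assms(7,8) by (metis DiffI singletonD)
  show ?thesis
  proof (cases "d \<in> small c")
    case True
    obtain p where "{v, p} \<in> E" "p \<in> lack c b" "p \<notin> deficient"
      by (rule full_small_neighbour[OF assms(2) True assms(3) d(2) assms(6)])
    then show ?thesis using only by blast
  next
    case False
    obtain a where a: "a \<in> small c" "a \<noteq> b" by (rule other_small[OF assms(2)])
    obtain c' g where c': "proper c'" "lack c' d = insert v (lack c a - {g})" "d \<in> small c'"
      "\<And>e. e \<noteq> a \<Longrightarrow> e \<noteq> d \<Longrightarrow> lack c' e = lack c e"
      "\<And>e. e \<noteq> a \<Longrightarrow> e \<noteq> d \<Longrightarrow> e \<in> small c' \<longleftrightarrow> e \<in> small c"
      using promote[OF assms(2) a(1) d(1) False d(2)] by metis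
    have bd: "b \<noteq> d" using False assms(3) by auto
    have lb: "lack c' b = lack c b" "b \<in> small c'" "v \<in> lack c' d" "v \<notin> lack c' b"
      using c' bd a assms(3,6) by auto
    obtain p where "{v, p} \<in> E" "p \<in> lack c' b" "p \<notin> deficient"
      by (rule full_small_neighbour[OF c'(1,3) lb(2,3,4)])
    then show ?thesis using only lb(1) by metis
  qed
qed

lemma adjacent_full:
  assumes "card deficient = 2" "v \<in> V - deficient" "w \<in> V - deficient" "v \<noteq> w"
  shows "{v, w} \<in> E"
proof -
  have unique: "{v, w} \<in> E" if c: "proper c" and d: "d \<in> small c" and w: "w \<in> lack c d" for c d
  proof -
    have "card (lack c d - deficient) = 1" using card_lack_full[OF c d] assms(1) by simp
    then obtain w' where "lack c d - deficient = {w'}" by (auto simp: card_1_singleton_iff)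
    then have "v \<notin> lack c d" using assms w by (metis DiffD2 DiffI singletonD)
    then show ?thesis using adjacent_small[OF assms(1) c d] assms w by blast
  qed
  obtain c where c: "proper c" using colourable by blast
  have wV: "w \<in> V" using assms by blast
  obtain d where d: "d < k" "w \<in> lack c d" by (rule obtain_miss[OF c wV])
  show ?thesis
  proof (cases "d \<in> small c")
    case True then show ?thesis using unique[OF c True d(2)] by blast
  next
    case False
    obtain a where a: "a \<in> small c" using other_small[OF c] by metis
    obtain c' g where "proper c'" "lack c' d = insert w (lack c a - {g})" "d \<in> small c'"
      using promote[OF c a d(1) False d(2)] by metis
    then show ?thesis using unique[of c' d] by blast
  qed
qed

text \<open>
Recolour the edge with a colour lacked by \<open>v\<close> that has been made small if necessary, so that deficient
vertices lack it anyway. Now two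
vertices lack the old colour of the edge, which has thus become small and must be lacked by the other
deficient vertex too.
\<close>
lemma deficient_edge_colour:
  assumes "proper c" "u \<in> deficient" "u' \<in> deficient" "u \<noteq> u'" "v \<in> V - deficient" "{u, v} \<in> E"
  shows "u' \<in> lack c (c {u, v})"
proof -
  let ?D = "c {u, v}"
  have vV: "v \<in> V" using assms by blast
  obtain d where d: "d < k" "v \<in> lack c d" by (rule obtain_miss[OF assms(1) vV])
  have Dd: "?D \<noteq> d" using lackD'[OF d(2) assms(6)] .
  have "\<exists>c'. proper c' \<and> d \<in> small c' \<and> v \<in> lack c' d \<and> lack c' ?D = lack c ?D \<and> c' {u, v} = ?D"
  proof (cases "d \<in> small c")
    case True then show ?thesis using assms(1) d(2) by blast
  next
    case False
    obtain a where a: "a \<in> small c" using other_small[OF assms(1)] by metis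
    have Da: "?D \<noteq> a" using lackD[OF deficient_lacks_small[OF assms(1,2) a] assms(6)] .
    obtain c' g where "proper c'" "lack c' d = insert v (lack c a - {g})" "d \<in> small c'"
      "\<And>e. e \<noteq> a \<Longrightarrow> e \<noteq> d \<Longrightarrow> lack c' e = lack c e"
      "\<And>e f. f \<noteq> a \<Longrightarrow> f \<noteq> d \<Longrightarrow> c' e = f \<longleftrightarrow> c e = f"
      using promote[OF assms(1) a d(1) False d(2)] by metis
    then show ?thesis using Da Dd by (intro exI[of _ c']) auto
  qed
  then obtain c' where c': "proper c'" "d \<in> small c'" "v \<in> lack c' d" "lack c' ?D = lack c ?D"
    "c' {u, v} = ?D" by blast
  have ud: "u \<in> lack c' d" using deficient_lacks_small[OF c'(1) assms(2) c'(2)] .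
  let ?c = "c'({u, v} := d)"
  have p: "proper ?c" using proper_recolour[OF c'(1) assms(6) d(1) ud c'(3)] .
  have l: "lack ?c ?D = lack c' ?D \<union> {u, v}"
    using lack_recolour_old[OF c'(1) assms(6), of d] Dd c'(5) by simp
  have "?D \<in> small ?c"
    by (rule small_if_two[OF p proper_range[OF assms(1,6)], of u v]) (use l edge_neq[OF assms(6)] in auto)
  then have "u' \<in> lack ?c ?D" using deficient_lacks_small[OF p assms(3)] by blast
  then show ?thesis using l c'(4) assms by auto
qed

text \<open>
By the preceding lemma, the edges between the two deficient vertices and the rest have pairwise
distinct colours, all of them big. As each of the \<open>n - 2\<close> other vertices is on the same number \<open>t\<close> of
these edges, there are \<open>(n - 2)t\<close> of them, but only \<open>k - s \<le> n - 4 + t\<close> big colours.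
\<close>
lemma no_deficient_edge:
  assumes "card deficient = 2" "u \<in> deficient" "v \<in> V - deficient"
  shows "{u, v} \<notin> E"
proof
  assume uv: "{u, v} \<in> E"
  obtain c where c: "proper c" using colourable by blast
  define W where "W = V - deficient"
  define M where "M = (SIGMA v:W. nbrs v \<inter> deficient)"
  have cW: "card W + 2 = card V"
    unfolding W_def using assms(1) deficient_V finite_deficient finite_V order_gt by (simp add: card_Diff_subset)
  have finW: "finite W" using finite_V by (simp add: W_def)
  have nb: "card (nbrs w \<inter> deficient) + card W = k" if w: "w \<in> W" for w
  proof -
    have "{w} \<notin> E" using edge_card[of "{w}"] by auto
    then have "nbrs w = (W - {w}) \<union> (nbrs w \<inter> deficient)"
      using adjacent_full[OF assms(1)] w nbrs_V[of w] edge_neq by (auto simp: W_def nbrs_def)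
    then have "card (nbrs w) = card ((W - {w}) \<union> (nbrs w \<inter> deficient))" by simp
    also have "\<dots> = card (W - {w}) + card (nbrs w \<inter> deficient)"
      by (rule card_Un_disjoint) (use finW finite_deficient in \<open>auto simp: W_def\<close>)
    also have "card (W - {w}) = card W - 1" using w by simp
    finally have "card (nbrs w) + 1 = card W + card (nbrs w \<inter> deficient)"
      using w finW card_gt_0_iff[of W] by auto
    moreover have "Suc (card (nbrs w)) = k"
      using w degree_less[of w] degree_nbrs[of w] by (auto simp: W_def deficient_def)
    ultimately show ?thesis by simp
  qed
  have vW: "v \<in> W" using assms(3) by (simp add: W_def)
  define t where "t = card (nbrs v \<inter> deficient)"
  have t: "card (nbrs w \<inter> deficient) = t" if "w \<in> W" for w using nb[OF that] nb[OF vW] by (simp add: t_def)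
  have t1: "1 \<le> t" "t \<le> 2"
  proof -
    have "u \<in> nbrs v \<inter> deficient" using uv assms by (auto simp: nbrs_def insert_commute)
    then show "1 \<le> t" unfolding t_def using finite_deficient
      by (metis One_nat_def Suc_leI card_gt_0_iff empty_iff finite_Int)
    show "t \<le> 2" unfolding t_def using card_mono[OF finite_deficient, of "nbrs v \<inter> deficient"] assms(1) by simp
  qed
  have cM: "card M = card W * t"
    unfolding M_def using finW finite_deficient t by simp
  have Me: "w \<in> V - deficient" "x \<in> deficient" "{x, w} \<in> E" "c {w, x} = c {x, w}" if "(w, x) \<in> M" for w x
    using that by (auto simp: M_def W_def nbrs_def insert_commute)
  have inj: "inj_on (\<lambda>(w, x). c {w, x}) M"
  proof (rule inj_onI)
    fix p q assume p: "p \<in> M" and q: "q \<in> M" and eq: "(case p of (w, x) \<Rightarrow> c {w, x}) = (case q of (w, x) \<Rightarrow> c {w, x})"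
    obtain w x where px: "p = (w, x)" by (cases p)
    obtain w' x' where qx: "q = (w', x')" by (cases q)
    have P: "(w, x) \<in> M" and Q: "(w', x') \<in> M" and e: "c {x, w} = c {x', w'}"
      using p q eq px qx by (auto simp: insert_commute)
    have "x = x'"
    proof (rule ccontr)
      assume "x \<noteq> x'"
      then have "x' \<in> lack c (c {x, w})" using deficient_edge_colour[OF c Me(2)[OF P] Me(2)[OF Q] _ Me(1,3)[OF P]] by blast
      then show False using lackD[OF _ Me(3)[OF Q]] e by metis
    qed
    then have "w = w'" using proper_eq[OF c Me(3)[OF P], of w'] Me(3)[OF Q] e by simp
    then show "p = q" using \<open>x = x'\<close> px qx by simp
  qed
  have "(\<lambda>(w, x). c {w, x}) ` M \<subseteq> {..<k} - small c"
  proof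
    fix d assume "d \<in> (\<lambda>(w, x). c {w, x}) ` M"
    then obtain w x where wx: "(w, x) \<in> M" "d = c {x, w}" by (auto simp: insert_commute)
    have "d \<notin> small c"
      using deficient_lacks_small[OF c Me(2)[OF wx(1)], of d] lackD[OF _ Me(3)[OF wx(1)], of c d] wx(2) by blast
    then show "d \<in> {..<k} - small c" using proper_range[OF c Me(3)[OF wx(1)]] wx(2) by simp
  qed
  then have "card M \<le> card ({..<k} - small c)" using card_inj_on_le[OF inj] by simp
  also have "\<dots> = k - s"
    using card_small[OF c] finite_small[of c] smallD(1) by (subst card_Diff_subset) auto
  finally have "card W * t \<le> k - 2" using cM two_le_s by simp
  moreover have "t + card W = k" using nb[OF vW] by (simp add: t_def)
  ultimately have "card W * t + 2 \<le> t + card W \<or> k < 2" by linarith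
  moreover have "2 \<le> card W" using cW order_gt by simp
  moreover have "t = 1 \<or> t = 2" using t1 by auto
  ultimately show False using \<open>t + card W = k\<close> by auto
qed

end

section \<open>Bad edges and a single deficient vertex\<close>

context two_small
begin

text \<open>
Meaningful only if \<open>w\<close> does not lack the colour \<open>d\<close>.
\<close>
definition nb :: "('a set \<Rightarrow> nat) \<Rightarrow> 'a \<Rightarrow> nat \<Rightarrow> 'a" where
  "nb c w d = (THE y. {w, y} \<in> E \<and> c {w, y} = d)"

definition linked :: "('a set \<Rightarrow> nat) \<Rightarrow> nat \<Rightarrow> 'a \<Rightarrow> 'a \<Rightarrow> bool" where
  "linked c a w y \<longleftrightarrow> y \<notin> deficient \<and> (\<exists>b \<in> miss c y. b \<noteq> a \<and> w \<in> kempe c a b y)"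

text \<open>
The edges at the non-deficient vertices lacking \<open>a\<close> whose other end is not linked to them; an edge is
recorded by its end \<open>w\<close> and its colour \<open>d\<close>. An edge to a deficient vertex counts as bad.
\<close>
definition bad :: "('a set \<Rightarrow> nat) \<Rightarrow> nat \<Rightarrow> ('a \<times> nat) set" where
  "bad c a = {(w, d). w \<in> lack c a - deficient \<and> d < k \<and> d \<noteq> a \<and> \<not> linked c a w (nb c w d)}"

lemma nb_eq: "proper c \<Longrightarrow> {w, y} \<in> E \<Longrightarrow> nb c w (c {w, y}) = y"
  unfolding nb_def using proper_eq by blast

lemma nb_edge:
  assumes "proper c" "w \<in> lack c a - deficient" "a < k" "d < k" "d \<noteq> a"
  shows "{w, nb c w d} \<in> E" "c {w, nb c w d} = d"
proof -
  have wV: "w \<in> V" using assms lack_V by blast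
  have "w \<notin> lack c d" using full_lack_unique[OF assms(1) wV _ _ assms(4) _ assms(3)] assms by blast
  then obtain y where "{w, y} \<in> E" "c {w, y} = d" using not_lack_edge[OF wV] by metis
  then show "{w, nb c w d} \<in> E" "c {w, nb c w d} = d" using nb_eq[OF assms(1), of w y] by auto
qed

lemma badD:
  assumes "proper c" "a \<in> small c" "(w, d) \<in> bad c a"
  shows "w \<in> lack c a" "w \<notin> deficient" "d < k" "d \<noteq> a" "{w, nb c w d} \<in> E" "c {w, nb c w d} = d"
    "\<And>b. nb c w d \<notin> deficient \<Longrightarrow> b \<in> miss c (nb c w d) \<Longrightarrow> b = a \<or> w \<notin> kempe c a b (nb c w d)"
proof -
  have w: "w \<in> lack c a - deficient" "d < k" "d \<noteq> a" and l: "\<not> linked c a w (nb c w d)"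
    using assms(3) by (auto simp: bad_def)
  then show "w \<in> lack c a" "w \<notin> deficient" "d < k" "d \<noteq> a" by auto
  show "{w, nb c w d} \<in> E" "c {w, nb c w d} = d"
    using nb_edge[OF assms(1) w(1) smallD(1)[OF assms(2)] w(2,3)] by auto
  show "\<And>b. nb c w d \<notin> deficient \<Longrightarrow> b \<in> miss c (nb c w d) \<Longrightarrow> b = a \<or> w \<notin> kempe c a b (nb c w d)"
    using l by (auto simp: linked_def)
qed

text \<open>
An edge of small colour is a fan of length one.
\<close>
lemma small_not_bad:
  assumes "proper c" "a \<in> small c" "(w, d) \<in> bad c a" shows "d \<notin> small c"
proof
  assume d: "d \<in> small c"
  note B = badD[OF assms]
  let ?y = "nb c w d"
  have "?y \<notin> lack c d" using lackD'[OF _ B(5)] B(6) by blast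
  then have yNF: "?y \<notin> deficient" using deficient_lacks_small[OF assms(1) _ d] by blast
  have yV: "?y \<in> V" using edge_in_V[OF B(5)] by blast
  obtain b where b: "b \<in> miss c ?y" using miss_nonempty[OF assms(1) yV] by blast
  have "b \<noteq> a \<and> w \<in> kempe c a b ?y"
    by (rule fan_linked[OF assms(1) _ _ assms(2) B(1) b, of ?y "[]"]) (use B d in auto)
  then show False using B(7)[OF yNF b] by blast
qed

lemma finite_bad: "finite (bad c a)"
  by (rule finite_subset[of _ "V \<times> {..<k}"]) (use finite_V lack_V in \<open>auto simp: bad_def\<close>)

text \<open>
Each of the \<open>n - 3\<close> vertices that do not lack \<open>a\<close> is linked to at most one of those that do, hence is the
other end of at most one edge that is not bad.
\<close>
lemma card_bad_ge:
  assumes "proper c" "a \<in> small c"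
  shows "(3 - card deficient) * (k - 1) + 3 \<le> card (bad c a) + card V"
proof -
  have a: "a < k" using smallD assms by blast
  define W where "W = lack c a - deficient"
  define P where "P = W \<times> ({..<k} - {a}) - bad c a"
  have finW: "finite W" using finite_lack by (simp add: W_def)
  have cW: "card W = 3 - card deficient" using card_lack_full[OF assms] by (simp add: W_def)
  have PD: "w \<in> W" "d < k" "d \<noteq> a" "linked c a w (nb c w d)" if "(w, d) \<in> P" for w d
    using that by (auto simp: P_def bad_def W_def)
  have inj: "inj_on (\<lambda>(w, d). nb c w d) P"
  proof (rule inj_onI)
    fix p q assume p: "p \<in> P" and q: "q \<in> P"
      and eq: "(case p of (w, d) \<Rightarrow> nb c w d) = (case q of (w, d) \<Rightarrow> nb c w d)"
    obtain w d where pw: "p = (w, d)" by (cases p)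
    obtain w' d' where qw: "q = (w', d')" by (cases q)
    have P: "(w, d) \<in> P" and Q: "(w', d') \<in> P" and e: "nb c w d = nb c w' d'" using p q pw qw eq by auto
    let ?y = "nb c w d"
    obtain b where b: "?y \<notin> deficient" "b \<in> miss c ?y" "b \<noteq> a" "w \<in> kempe c a b ?y" using PD(4)[OF P] by (auto simp: linked_def)
    obtain b' where b': "b' \<in> miss c ?y" "w' \<in> kempe c a b' ?y" using PD(4)[OF Q] e by (auto simp: linked_def)
    have yV: "?y \<in> V" using missD(2)[OF b(2)] lack_V by blast
    have "b' = b" using full_lack_unique[OF assms(1) yV b(1) missD(2)[OF b'(1)] missD(1)[OF b'(1)] missD(2)[OF b(2)] missD(1)[OF b(2)]] .
    then have "w = w'" using linked_unique_left[OF assms missD(1)[OF b(2)] b(3)[symmetric] missD(2)[OF b(2)] _ _ b(4)] b'(2)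
        PD(1)[OF P] PD(1)[OF Q] by (auto simp: W_def)
    moreover have "d = d'"
      using nb_edge(2)[OF assms(1) PD(1)[OF P, unfolded W_def] a PD(2,3)[OF P]]
        nb_edge(2)[OF assms(1) PD(1)[OF Q, unfolded W_def] a PD(2,3)[OF Q]] \<open>w = w'\<close> e by metis
    ultimately show "p = q" using pw qw by simp
  qed
  have sub: "(\<lambda>(w, d). nb c w d) ` P \<subseteq> V - lack c a"
  proof
    fix y assume "y \<in> (\<lambda>(w, d). nb c w d) ` P"
    then obtain w d where P: "(w, d) \<in> P" and y: "y = nb c w d" by auto
    obtain b where b: "y \<notin> deficient" "b \<in> miss c y" "b \<noteq> a" using PD(4)[OF P] y by (auto simp: linked_def)
    have yV: "y \<in> V" using missD(2)[OF b(2)] lack_V by blast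
    have "y \<notin> lack c a" using full_lack_unique[OF assms(1) yV b(1) missD(2)[OF b(2)] missD(1)[OF b(2)] _ a] b(3) by blast
    then show "y \<in> V - lack c a" using yV by blast
  qed
  have "card P \<le> card (V - lack c a)" using card_inj_on_le[OF inj sub] finite_V by simp
  also have "\<dots> = card V - 3"
    using card_Diff_subset[OF finite_lack lack_V] smallD(2)[OF assms(2)] by simp
  finally have cP: "card P + 3 \<le> card V" using order_gt by simp
  have "bad c a \<subseteq> W \<times> ({..<k} - {a})" by (auto simp: bad_def W_def)
  then have "card (W \<times> ({..<k} - {a})) = card P + card (bad c a)"
    unfolding P_def using finite_bad[of c a] card_mono[of "W \<times> ({..<k} - {a})" "bad c a"] finW
    by (simp add: card_Diff_subset)
  moreover have "card (W \<times> ({..<k} - {a})) = (3 - card deficient) * (k - 1)"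
    using a cW by (simp add: card_cartesian_product)
  ultimately show ?thesis using cP by simp
qed

text \<open>
The basic use of a bad edge: its ends can be made to lack the same small colour, leaving the
colour of the edge and all classes other than \<open>a\<close> and \<open>b\<close> alone. If the ends lack \<open>a\<close> already, which is the case
\<open>b = a\<close>, nothing has to be done.
\<close>
lemma merge_ends:
  assumes "proper c" "a \<in> small c" "w \<in> lack c a" "{w, y} \<in> E" "b \<in> miss c y"
    "b = a \<or> w \<notin> kempe c a b y"
  obtains c' where "proper c'" "small c' = small c" "w \<in> lack c' a" "y \<in> lack c' a"
    "\<And>d. d \<noteq> a \<Longrightarrow> d \<noteq> b \<Longrightarrow> lack c' d = lack c d"
    "\<And>e d. d \<noteq> a \<Longrightarrow> d \<noteq> b \<Longrightarrow> c' e = d \<longleftrightarrow> c e = d" "c' {w, y} = c {w, y}"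
proof (cases "b = a")
  case True
  then show ?thesis using that[of c] assms missD(2)[OF assms(5)] by simp
next
  case False
  let ?X = "kempe c a b y"
  have b: "b < k" "y \<in> lack c b" using missD assms by blast+
  obtain g where g: "?X \<inter> lack c a = {g}" by (rule linked_end[OF assms(1,2) b(1) False[symmetric] b(2)])
  then have g': "g \<in> lack c a" "g \<in> ?X" by auto
  note sw = linked_swap[OF assms(1,2) b(1) False[symmetric] b(2) g']
  have w: "w \<notin> ?X" using assms(6) False by blast
  have "small (kempe_swap c a b ?X) = small c"
  proof (rule set_eqI)
    fix d show "d \<in> small (kempe_swap c a b ?X) \<longleftrightarrow> d \<in> small c"
      using sw(5,6) sw(7)[of d] assms(2) by (cases "d = a"; cases "d = b") auto
  qed
  moreover have "w \<in> lack (kempe_swap c a b ?X) a" "y \<in> lack (kempe_swap c a b ?X) a"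
    using sw(2) w g' assms(3) by auto
  ultimately show ?thesis
    by (intro that[of "kempe_swap c a b ?X"]) (simp_all add: sw(1,4) kempe_swap_other kempe_swap_edge_out[OF w])
qed

text \<open>
Both edges could be recoloured, with \<open>a\<close> and with \<open>b\<close>, which is too much for their common colour: the first
recolouring makes it small and then \<open>small_edge_ends\<close> forbids the second.
\<close>
lemma two_monochromatic_pairs:
  assumes "proper c" "a < k" "b < k" "a \<noteq> b" "{w, y} \<in> E" "{v, t} \<in> E" "{w, y} \<noteq> {v, t}"
    "c {w, y} = c {v, t}" "w \<in> lack c a" "y \<in> lack c a" "v \<in> lack c b" "t \<in> lack c b"
  shows False
proof -
  let ?c = "c({w, y} := a)" and ?d = "c {w, y}"
  have p: "proper ?c" using proper_recolour[OF assms(1,5,2,9,10)] .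
  have da: "?d \<noteq> a" using lackD[OF assms(9,5)] .
  have db: "b \<noteq> ?d" using lackD[OF assms(11,6)] assms(8) by simp
  have l: "lack ?c ?d = lack c ?d \<union> {w, y}" using lack_recolour_old[OF assms(1,5) da] .
  have s: "?d \<in> small ?c"
    by (rule small_if_two[OF p proper_range[OF assms(1,5)], of w y]) (use l edge_neq[OF assms(5)] in auto)
  have lb: "lack ?c b = lack c b" using lack_recolour_other[of b a c w y] assms(4) db by simp
  have "?c {v, t} = ?d" using assms(7,8) by simp
  then show False using small_edge_ends[OF p assms(6) _ assms(3)] s lb assms(11,12) by simp
qed

text \<open>
After merging the ends, recolouring the edge makes \<open>d\<close> a small colour, so that \<open>u\<close> has to lack it.
\<close>
lemma bad_needs_deficient_colour:
  assumes "proper c" "a \<in> small c" "(w, d) \<in> bad c a" "nb c w d \<notin> deficient" "u \<in> deficient"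
  shows "u \<in> lack c d"
proof -
  note B = badD[OF assms(1-3)]
  let ?y = "nb c w d"
  have yV: "?y \<in> V" using edge_in_V[OF B(5)] by blast
  obtain b where b: "b \<in> miss c ?y" using miss_nonempty[OF assms(1) yV] by blast
  have db: "d \<noteq> b" using lackD'[OF missD(2)[OF b] B(5)] B(6) by blast
  obtain c1 where c1: "proper c1" "small c1 = small c" "w \<in> lack c1 a" "?y \<in> lack c1 a"
    "\<And>e. e \<noteq> a \<Longrightarrow> e \<noteq> b \<Longrightarrow> lack c1 e = lack c e" "c1 {w, ?y} = c {w, ?y}"
    using merge_ends[OF assms(1,2) B(1,5) b B(7)[OF assms(4) b]] by metis
  have a: "a < k" using smallD assms by blast
  let ?c = "c1({w, ?y} := a)"
  have cd: "c1 {w, ?y} = d" using c1(6) B(6) by simp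
  have p: "proper ?c" using proper_recolour[OF c1(1) B(5) a c1(3,4)] .
  have l: "lack ?c d = lack c1 d \<union> {w, ?y}"
    using lack_recolour_old[OF c1(1) B(5), of a] cd B(4) by simp
  have "d \<in> small ?c"
    by (rule small_if_two[OF p B(3), of w ?y]) (use l edge_neq[OF B(5)] in auto)
  then have "u \<in> lack ?c d" using deficient_lacks_small[OF p assms(5)] by blast
  moreover have "u \<noteq> w" "u \<noteq> ?y" using B(2) assms by auto
  ultimately show ?thesis using l c1(5)[OF B(4) db] by auto
qed

lemma card_small_sum:
  assumes "proper c" shows "(\<Sum>v\<in>V. card (miss c v)) = k + 2 * s"
  using sum_card_miss[OF assms] card_small[OF assms] by simp

lemma card_miss_one_deficient:
  assumes "deficient = {u}" "proper c" shows "card (miss c u) + (card V - 1) = k + 2 * s"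
proof -
  have uV: "u \<in> V" using assms(1) deficient_V by blast
  have "(\<Sum>v\<in>V. card (miss c v)) = card (miss c u) + (\<Sum>v\<in>V - {u}. card (miss c v))"
    by (rule sum.remove[OF finite_V uV])
  also have "(\<Sum>v\<in>V - {u}. card (miss c v)) = (\<Sum>v\<in>V - {u}. 1)"
    using card_miss_full[OF assms(2)] assms(1) by (intro sum.cong) auto
  finally show ?thesis using card_small_sum[OF assms(2)] uV by simp
qed

text \<open>
An edge that is bad for \<open>a\<close> either leads to \<open>u\<close> or has a big colour lacked by \<open>u\<close>. Compared with the lower bound
for the number of bad edges, this shows that all neighbours of \<open>u\<close> lack \<open>a\<close>. But \<open>a\<close> was an arbitrary small colour,
there are two of them, and a neighbour of \<open>u\<close> lacks only one colour.
\<close>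
lemma one_deficient_isolated:
  assumes "deficient = {u}" shows "degree G u = 0"
proof -
  have uV: "u \<in> V" using assms deficient_V by blast
  have sub: "nbrs u \<subseteq> lack c a" if c: "proper c" and a: "a \<in> small c" for c a
  proof -
    define h where "h = card (miss c u - small c)"
    define W where "W = lack c a - deficient"
    have ak: "a < k" using smallD a by blast
    have finW: "finite W" using finite_lack by (simp add: W_def)
    have cW: "card W = 2" using card_lack_full[OF c a] assms by (simp add: W_def)
    have bad: "bad c a \<subseteq> (W \<times> (miss c u - small c)) \<union> (\<lambda>w. (w, c {w, u})) ` (nbrs u \<inter> W)"
    proof
      fix p assume p: "p \<in> bad c a"
      obtain w d where pw: "p = (w, d)" by (cases p)
      then have b: "(w, d) \<in> bad c a" using p by simp
      note B = badD[OF c a b]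
      have wW: "w \<in> W" using B by (simp add: W_def)
      show "p \<in> (W \<times> (miss c u - small c)) \<union> (\<lambda>w. (w, c {w, u})) ` (nbrs u \<inter> W)"
      proof (cases "nb c w d = u")
        case True
        then have "{w, u} \<in> E" "c {w, u} = d" using B(5,6) by auto
        then show ?thesis using wW pw by (auto simp: nbrs_def insert_commute)
      next
        case False
        then have "u \<in> lack c d" using bad_needs_deficient_colour[OF c a b] assms by auto
        then show ?thesis using wW pw small_not_bad[OF c a b] B(3) by (auto simp: miss_def)
      qed
    qed
    have "card (bad c a) \<le> card (W \<times> (miss c u - small c)) + card ((\<lambda>w. (w, c {w, u})) ` (nbrs u \<inter> W))"
      using card_mono[OF _ bad] finW finite_miss[of c u] card_Un_le le_trans by (metis (no_types, lifting) finite_Diff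
          finite_Int finite_SigmaI finite_UnI finite_imageI)
    also have "\<dots> \<le> 2 * h + card (nbrs u \<inter> W)"
      using card_image_le[of "nbrs u \<inter> W" "\<lambda>w. (w, c {w, u})"] finW cW
      by (simp add: card_cartesian_product h_def)
    finally have b1: "card (bad c a) \<le> 2 * h + card (nbrs u \<inter> W)" .
    have b2: "2 * (k - 1) + 3 \<le> card (bad c a) + card V" using card_bad_ge[OF c a] assms by simp
    note m1 = card_miss_one_deficient[OF assms c]
    have "small c \<subseteq> miss c u" using deficient_lacks_small[OF c] assms smallD(1) by (auto simp: miss_def)
    then have m2: "card (miss c u) = s + h"
      using card_small[OF c] finite_small[of c] finite_miss[of c u] card_mono[of "miss c u" "small c"]
      by (simp add: h_def card_Diff_subset)
    have m3: "card (miss c u) + card (nbrs u) = k" using card_miss[OF c uV] degree_nbrs[of u] by simp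
    have "card (nbrs u) \<le> card (nbrs u \<inter> W)" using b1 b2 m1 m2 m3 order_gt ak by linarith
    then have "nbrs u \<inter> W = nbrs u"
      using card_seteq[OF finite_nbrs[of u], of "nbrs u \<inter> W"] by simp
    then show ?thesis by (auto simp: W_def)
  qed
  obtain c where c: "proper c" using colourable by blast
  obtain a where a: "a \<in> small c" using other_small[OF c] by metis
  obtain b where b: "b \<in> small c" "b \<noteq> a" by (rule other_small[OF c])
  have "nbrs u = {}"
  proof (rule ccontr)
    assume "nbrs u \<noteq> {}"
    then obtain y where y: "y \<in> nbrs u" by blast
    have yV: "y \<in> V" using y nbrs_V by blast
    have "y \<notin> deficient" using y assms edge_neq by (auto simp: nbrs_def)
    then show False
      using full_lack_unique[OF c yV _ _ smallD(1)[OF a] _ smallD(1)[OF b(1)]] sub[OF c a] sub[OF c b(1)] y b(2) by blast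
  qed
  then show ?thesis by (simp add: degree_nbrs)
qed

text \<open>
Now \<open>u\<close> is isolated and the bound is attained: in every colouring all edges of big colour at
vertices lacking a small colour are bad. So if \<open>d\<close> is big, the ends of an edge of colour \<open>d\<close> can be made to lack \<open>a\<close>,
and then those of another such edge to lack \<open>b\<close>.
\<close>
lemma one_deficient_all_small:
  assumes "deficient = {u}" "proper c" shows "s = k"
proof (rule ccontr)
  assume "s \<noteq> k"
  have iso: "{u, y} \<notin> E" "{y, u} \<notin> E" for y
    using one_deficient_isolated[OF assms(1)] degree_nbrs[of u] finite_nbrs[of u]
    by (auto simp: nbrs_def insert_commute)
  have uV: "u \<in> V" using assms(1) deficient_V by blast
  have all_bad: "(w, d) \<in> bad c a"
    if c: "proper c" and a: "a \<in> small c" and w: "w \<in> lack c a - deficient" and d: "d < k" "d \<notin> small c" for c a w d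
  proof -
    define W where "W = lack c a - deficient"
    have finW: "finite W" using finite_lack by (simp add: W_def)
    have cW: "card W = 2" using card_lack_full[OF c a] assms by (simp add: W_def)
    have sub: "bad c a \<subseteq> W \<times> ({..<k} - small c)"
    proof
      fix p assume p: "p \<in> bad c a"
      obtain w d where pw: "p = (w, d)" by (cases p)
      then have b: "(w, d) \<in> bad c a" using p by simp
      show "p \<in> W \<times> ({..<k} - small c)"
        using pw badD(1-3)[OF c a b] small_not_bad[OF c a b] by (simp add: W_def)
    qed
    have cb: "card ({..<k} - small c) = k - s"
      using card_small[OF c] finite_small[of c] smallD(1) by (subst card_Diff_subset) auto
    have sk: "s \<le> k" using card_small[OF c] smallD(1) card_mono[of "{..<k}" "small c"] by auto
    have "card (miss c u) + (card V - 1) = k + 2 * s" by (rule card_miss_one_deficient[OF assms(1) c])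
    moreover have "card (miss c u) = k" using card_miss[OF c uV] one_deficient_isolated[OF assms(1)] by simp
    ultimately have "card V = 2 * s + 1" using order_gt by linarith
    moreover have "2 * (k - 1) + 3 \<le> card (bad c a) + card V" using card_bad_ge[OF c a] assms by simp
    ultimately have "card (W \<times> ({..<k} - small c)) \<le> card (bad c a)"
      using cW cb sk smallD(1)[OF a] by (simp add: card_cartesian_product)
    then have "bad c a = W \<times> ({..<k} - small c)"
      using card_seteq[OF _ sub] finW by simp
    then show ?thesis using w d by (simp add: W_def)
  qed
  obtain a where a: "a \<in> small c" using other_small[OF assms(2)] by metis
  obtain b where b: "b \<in> small c" "b \<noteq> a" by (rule other_small[OF assms(2)])
  have ak: "a < k" "b < k" using smallD a b by blast+
  have "\<not> {..<k} \<subseteq> small c"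
    using \<open>s \<noteq> k\<close> card_small[OF assms(2)] smallD(1) by (metis card_lessThan lessThan_iff subsetI subset_antisym)
  then obtain d where d: "d < k" "d \<notin> small c" by auto
  have full: "\<exists>w. w \<in> lack c' e - deficient" if "proper c'" "e \<in> small c'" for c' e
  proof -
    have "card (lack c' e - deficient) \<noteq> 0" using card_lack_full[OF that] assms(1) by simp
    then show ?thesis by (metis card.empty ex_in_conv)
  qed
  obtain w where w: "w \<in> lack c a - deficient" using full[OF assms(2) a] by blast
  note B = badD[OF assms(2) a all_bad[OF assms(2) a w d]]
  let ?y = "nb c w d"
  have yNF: "?y \<notin> deficient" using B(5) iso assms(1) by auto
  have yV: "?y \<in> V" using edge_in_V[OF B(5)] by blast
  obtain e where e: "e \<in> miss c ?y" using miss_nonempty[OF assms(2) yV] by blast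
  obtain c1 where c1: "proper c1" "small c1 = small c" "w \<in> lack c1 a" "?y \<in> lack c1 a" "c1 {w, ?y} = c {w, ?y}"
    using merge_ends[OF assms(2) a B(1,5) e B(7)[OF yNF e]] by metis
  have s1: "a \<in> small c1" "b \<in> small c1" "d \<notin> small c1" using c1(2) a b d by auto
  obtain v where v: "v \<in> lack c1 b - deficient" using full[OF c1(1) s1(2)] by blast
  note B1 = badD[OF c1(1) s1(2) all_bad[OF c1(1) s1(2) v d(1) s1(3)]]
  let ?t = "nb c1 v d"
  have tNF: "?t \<notin> deficient" using B1(5) iso assms(1) by auto
  have tV: "?t \<in> V" using edge_in_V[OF B1(5)] by blast
  obtain e' where e': "e' \<in> miss c1 ?t" using miss_nonempty[OF c1(1) tV] by blast
  have wV: "w \<in> V" using w lack_V by blast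
  have vne: "v \<noteq> w" "v \<noteq> ?y"
    using full_lack_unique[OF c1(1) wV B(2) c1(3) ak(1) _ ak(2)] full_lack_unique[OF c1(1) yV yNF c1(4) ak(1) _ ak(2)]
      B1(1) b(2) by blast+
  then have edges: "{w, ?y} \<noteq> {v, ?t}" by (auto simp: doubleton_eq_iff)
  have cw: "c1 {w, ?y} = d" using c1(5) B(6) by simp
  have ea: "a \<noteq> e'"
  proof
    assume "a = e'"
    then have tl: "?t \<in> lack c1 a" using missD(2)[OF e'] by simp
    have wy: "w \<noteq> ?y" using edge_neq[OF B(5)] .
    have uwy: "u \<noteq> w" "u \<noteq> ?y" "u \<noteq> ?t" using B(2) yNF tNF assms(1) by auto
    have "{u, w, ?y, ?t} \<subseteq> lack c1 a" using deficient_lacks_small[OF c1(1) _ s1(1)] assms(1) c1(3,4) tl by auto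
    then have "card {u, w, ?y, ?t} \<le> 3" using no_large_lack[OF c1(1) ak(1)] by blast
    then have "?t = w \<or> ?t = ?y" using wy uwy by (auto simp: card_insert_if split: if_splits)
    then have "{w, ?y} = {v, ?t}"
      using proper_eqE[OF c1(1) B(5) B1(5)] cw B1(6) by auto
    then show False using edges by simp
  qed
  obtain c2 where c2: "proper c2" "v \<in> lack c2 b" "?t \<in> lack c2 b"
    "\<And>f. f \<noteq> b \<Longrightarrow> f \<noteq> e' \<Longrightarrow> lack c2 f = lack c1 f"
    "\<And>g f. f \<noteq> b \<Longrightarrow> f \<noteq> e' \<Longrightarrow> c2 g = f \<longleftrightarrow> c1 g = f" "c2 {v, ?t} = c1 {v, ?t}"
    using merge_ends[OF c1(1) s1(2) B1(1,5) e' B1(7)[OF tNF e']] by metis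
  have de: "d \<noteq> b" "d \<noteq> e'" using B1(4) lackD'[OF missD(2)[OF e'] B1(5)] B1(6) by auto
  have "lack c2 a = lack c1 a" using c2(4)[of a] b(2) ea by blast
  moreover have "c2 {w, ?y} = d" using c2(5)[OF de] cw by blast
  moreover have "c2 {v, ?t} = d" using c2(6) B1(6) by simp
  ultimately show False
    using two_monochromatic_pairs[OF c2(1) ak b(2)[symmetric] B(5) B1(5) edges] c1(3,4) c2(2,3) by simp
qed

end

section \<open>Regular graphs\<close>

locale full_two_small = two_small +
  assumes no_deficient: "deficient = {}"
begin

lemma lack_unique:
  "proper c \<Longrightarrow> v \<in> lack c a \<Longrightarrow> a < k \<Longrightarrow> v \<in> lack c b \<Longrightarrow> b < k \<Longrightarrow> a = b"
  using full_lack_unique[of c v a b] no_deficient lack_V by blast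

lemma bad_unlinked:
  "proper c \<Longrightarrow> a \<in> small c \<Longrightarrow> (w, d) \<in> bad c a \<Longrightarrow> b \<in> miss c (nb c w d)
    \<Longrightarrow> b = a \<or> w \<notin> kempe c a b (nb c w d)"
  using badD(7)[of c a w d b] no_deficient by blast

lemma lack_miss: "a < k \<Longrightarrow> v \<in> lack c a \<Longrightarrow> a \<in> miss c v"
  by (simp add: miss_def)

text \<open>
The two exchanges that merge the ends of the two edges involve disjoint pairs of colours, so they
do not interfere.
\<close>
lemma no_disjoint_bad:
  assumes "proper c" "a \<in> small c" "b \<in> small c" "a \<noteq> b"
    and w: "(w, d) \<in> bad c a" "nb c w d \<notin> lack c b"
    and v: "(v, d) \<in> bad c b" "nb c v d \<notin> lack c a"
    and e: "e \<in> miss c (nb c w d)" "e' \<in> miss c (nb c v d)" "e \<noteq> e'"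
  shows False
proof -
  let ?y = "nb c w d" and ?t = "nb c v d"
  note B = badD[OF assms(1,2) w(1)] and B' = badD[OF assms(1,3) v(1)]
  have ak: "a < k" "b < k" using smallD assms by blast+
  obtain c1 where c1: "proper c1" "small c1 = small c" "w \<in> lack c1 a" "?y \<in> lack c1 a"
    "\<And>f. f \<noteq> a \<Longrightarrow> f \<noteq> e \<Longrightarrow> lack c1 f = lack c f"
    "\<And>g f. f \<noteq> a \<Longrightarrow> f \<noteq> e \<Longrightarrow> c1 g = f \<longleftrightarrow> c g = f" "c1 {w, ?y} = c {w, ?y}"
    using merge_ends[OF assms(1,2) B(1,5) e(1) bad_unlinked[OF assms(1,2) w(1) e(1)]] by metis
  have be: "b \<noteq> e" using w(2) missD(2)[OF e(1)] by auto
  have e'a: "e' \<noteq> a" using v(2) missD(2)[OF e(2)] by auto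
  have de: "d \<noteq> e" "d \<noteq> e'"
    using lackD'[OF missD(2)[OF e(1)] B(5)] B(6) lackD'[OF missD(2)[OF e(2)] B'(5)] B'(6) by auto
  have c1v: "c1 {v, ?t} = d" using c1(6)[OF B(4) de(1)] B'(6) by simp
  have vb: "v \<in> lack c1 b" using c1(5)[of b] assms(4) be B'(1) by blast
  have e'm: "e' \<in> miss c1 ?t" using c1(5)[of e'] e(2,3) e'a by (simp add: miss_def)
  have cc: "kempe c1 b e' ?t = kempe c b e' ?t"
    by (rule kempe_cong) (use c1(6)[of b] c1(6)[of e'] assms(4) be e'a e(3) in blast)
  have un: "e' = b \<or> v \<notin> kempe c1 b e' ?t"
    using bad_unlinked[OF assms(1,3) v(1) e(2)] cc by simp
  have s1: "b \<in> small c1" using c1(2) assms(3) by simp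
  obtain c2 where c2: "proper c2" "v \<in> lack c2 b" "?t \<in> lack c2 b"
    "\<And>f. f \<noteq> b \<Longrightarrow> f \<noteq> e' \<Longrightarrow> lack c2 f = lack c1 f"
    "\<And>g f. f \<noteq> b \<Longrightarrow> f \<noteq> e' \<Longrightarrow> c2 g = f \<longleftrightarrow> c1 g = f" "c2 {v, ?t} = c1 {v, ?t}"
    using merge_ends[OF c1(1) s1 vb B'(5) e'm un] by metis
  have "lack c2 a = lack c1 a" using c2(4)[of a] assms(4) e'a by blast
  moreover have "c2 {w, ?y} = d" using c2(5)[OF B'(4) de(2)] c1(7) B(6) by simp
  moreover have "c2 {v, ?t} = d" using c2(6) c1v by simp
  moreover have "{w, ?y} \<noteq> {v, ?t}"
  proof
    assume "{w, ?y} = {v, ?t}"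
    then have "w = v \<or> ?y = v" by (auto simp: doubleton_eq_iff)
    then show False using lack_unique[OF assms(1) B(1) ak(1) _ ak(2)] B'(1) assms(4) w(2) by blast
  qed
  ultimately show False
    using two_monochromatic_pairs[OF c2(1) ak assms(4) B(5) B'(5)] c1(3,4) c2(2,3) by simp
qed

text \<open>
Here both edges join a vertex lacking \<open>a\<close> to a vertex lacking \<open>b\<close>. One exchange serves both: it makes the far end
of \<open>w1\<close> lack \<open>a\<close> like \<open>w1\<close>, and \<open>w2\<close> lack \<open>b\<close> like its own far end. No case distinction on how the four vertices are linked is necessary if
the exchange takes place on the union of the two chains.
\<close>
lemma no_two_crossing_bad:
  assumes "proper c" "a \<in> small c" "b \<in> small c" "a \<noteq> b" "w1 \<noteq> w2"
    and w: "(w1, d) \<in> bad c a" "nb c w1 d \<in> lack c b" "(w2, d) \<in> bad c a" "nb c w2 d \<in> lack c b"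
  shows False
proof -
  let ?y1 = "nb c w1 d" and ?y2 = "nb c w2 d"
  note B1 = badD[OF assms(1,2) w(1)] and B2 = badD[OF assms(1,2) w(3)]
  have ak: "a < k" "b < k" using smallD assms by blast+
  let ?X1 = "kempe c a b ?y1" and ?X2 = "kempe c a b w2"
  define X where "X = ?X1 \<union> ?X2"
  have V: "?y1 \<in> V" "w2 \<in> V" using edge_in_V[OF B1(5)] edge_in_V[OF B2(5)] by auto
  have cl: "closed_under c {a, b} X"
    unfolding X_def by (rule closed_under_Un[OF kempe_closed[OF V(1)] kempe_closed[OF V(2)]])
  have db: "d \<noteq> b" using lackD'[OF w(2) B1(5)] B1(6) by simp
  have u1: "w1 \<notin> ?X1" using bad_unlinked[OF assms(1,2) w(1) lack_miss[OF ak(2) w(2)]] assms(4) by auto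
  have u2: "w2 \<notin> kempe c a b ?y2" using bad_unlinked[OF assms(1,2) w(3) lack_miss[OF ak(2) w(4)]] assms(4) by auto
  have "w1 \<notin> ?X2"
  proof
    assume "w1 \<in> ?X2"
    then have "w1 \<in> kempe c b a w2" by (simp add: kempe_commute)
    then have "w2 = w1"
      by (rule linked_unique[OF assms(1,3) ak(1) assms(4)[symmetric] B2(1) B1(1) _ kempe_refl])
    then show False using assms(5) by simp
  qed
  then have w1: "w1 \<notin> X" using u1 by (simp add: X_def)
  have y12: "?y1 \<noteq> ?y2"
  proof
    assume "?y1 = ?y2"
    then have "w1 = w2" using proper_eq[OF assms(1), of ?y1 w1 w2] B1(5,6) B2(5,6) by (simp add: insert_commute)
    then show False using assms(5) by simp
  qed
  have "?y2 \<notin> ?X1"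
  proof
    assume "?y2 \<in> ?X1"
    then have "?y1 = ?y2"
      by (rule linked_unique[OF assms(1,2) ak(2) assms(4) w(2,4) _ kempe_refl])
    then show False using y12 by simp
  qed
  moreover have "?y2 \<notin> ?X2" using kempe_sym u2 by blast
  ultimately have y2: "?y2 \<notin> X" by (simp add: X_def)
  have y1: "?y1 \<in> X" "w2 \<in> X" using kempe_refl by (simp_all add: X_def)
  let ?c = "kempe_swap c a b X"
  have p: "proper ?c" by (rule proper_swap[OF assms(1) cl ak])
  have "w1 \<in> lack ?c a" "?y1 \<in> lack ?c a"
    unfolding lack_swap_left[OF cl assms(4)] using w1 y1 B1(1) w(2) by auto
  moreover have "w2 \<in> lack ?c b" "?y2 \<in> lack ?c b"
    unfolding lack_swap_right[OF cl assms(4)] using y1 y2 B2(1) w(4) by auto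
  moreover have "?c {w1, ?y1} = d" "?c {w2, ?y2} = d"
    using kempe_swap_other[OF B1(4) db] B1(6) B2(6) by blast+
  moreover have "w1 \<noteq> ?y2" using lack_unique[OF assms(1) B1(1) ak(1) _ ak(2)] w(4) assms(4) by blast
  then have "{w1, ?y1} \<noteq> {w2, ?y2}" using assms(5) by (auto simp: doubleton_eq_iff)
  ultimately show False
    using two_monochromatic_pairs[OF p ak assms(4) B1(5) B2(5)] by simp
qed

definition bad_ends :: "('a set \<Rightarrow> nat) \<Rightarrow> nat \<Rightarrow> nat \<Rightarrow> 'a set" where
  "bad_ends c a d = {w. (w, d) \<in> bad c a}"

lemma bad_ends_subset: "bad_ends c a d \<subseteq> lack c a"
  by (auto simp: bad_ends_def bad_def)

lemma finite_bad_ends: "finite (bad_ends c a d)"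
  using finite_subset[OF bad_ends_subset finite_lack] .

lemma card_bad_ends_le: "a \<in> small c \<Longrightarrow> card (bad_ends c a d) \<le> 3"
  using card_mono[OF finite_lack bad_ends_subset] smallD(2) by metis

definition crossing :: "('a set \<Rightarrow> nat) \<Rightarrow> nat \<Rightarrow> nat \<Rightarrow> nat \<Rightarrow> 'a set" where
  "crossing c a b d = {w \<in> bad_ends c a d. nb c w d \<in> lack c b}"

lemma card_crossing_le:
  assumes "proper c" "a \<in> small c" "b \<in> small c" "a \<noteq> b"
  shows "card (crossing c a b d) \<le> 1"
proof -
  have "x = y" if "x \<in> crossing c a b d" "y \<in> crossing c a b d" for x y
    using that no_two_crossing_bad[OF assms, of x y d] by (auto simp: crossing_def bad_ends_def)
  then show ?thesis by (metis card_le_Suc0_iff_eq One_nat_def card.infinite zero_le)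
qed

text \<open>
A non-crossing bad edge at \<open>v\<close> forces the far ends of all non-crossing bad edges on the side of \<open>a\<close> to lack the
same colour \<open>e\<close> as its own far end. Two such edges would make \<open>e\<close> small and would be crossing edges for \<open>a\<close> and \<open>e\<close>.
\<close>
lemma card_noncrossing_le:
  assumes "proper c" "a \<in> small c" "b \<in> small c" "a \<noteq> b"
    "v \<in> bad_ends c b d - crossing c b a d"
  shows "card (bad_ends c a d - crossing c a b d) \<le> 1"
proof -
  let ?A = "bad_ends c a d - crossing c a b d"
  have v: "(v, d) \<in> bad c b" "nb c v d \<notin> lack c a" using assms(5) by (auto simp: crossing_def bad_ends_def)
  note B = badD[OF assms(1,3) v(1)]
  let ?t = "nb c v d"
  have tV: "?t \<in> V" using edge_in_V[OF B(5)] by blast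
  obtain e where e: "e \<in> miss c ?t" using miss_nonempty[OF assms(1) tV] by blast
  have common: "nb c x d \<in> lack c e" if "x \<in> ?A" for x
  proof -
    have x: "(x, d) \<in> bad c a" "nb c x d \<notin> lack c b" using that by (auto simp: crossing_def bad_ends_def)
    note B = badD[OF assms(1,2) x(1)]
    have "nb c x d \<in> V" using edge_in_V[OF B(5)] by blast
    then obtain f where f: "f \<in> miss c (nb c x d)" using miss_nonempty[OF assms(1)] by blast
    have "f = e" using no_disjoint_bad[OF assms(1-4) x v f e] by blast
    then show ?thesis using missD(2)[OF f] by simp
  qed
  have "x = y" if x: "x \<in> ?A" and y: "y \<in> ?A" for x y
  proof (rule ccontr)
    assume ne: "x \<noteq> y"
    have bx: "(x, d) \<in> bad c a" and by': "(y, d) \<in> bad c a" using x y by (auto simp: bad_ends_def)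
    note Bx = badD[OF assms(1,2) bx] and By = badD[OF assms(1,2) by']
    have "nb c x d \<noteq> nb c y d"
    proof
      assume "nb c x d = nb c y d"
      then show False using proper_eq[OF assms(1), of "nb c x d" x y] Bx(5,6) By(5,6) ne by (simp add: insert_commute)
    qed
    then have es: "e \<in> small c" using small_if_two[OF assms(1) missD(1)[OF e]] common x y by blast
    have ae: "a \<noteq> e" using v(2) missD(2)[OF e] by auto
    show False by (rule no_two_crossing_bad[OF assms(1,2) es ae ne bx common[OF x] by' common[OF y]])
  qed
  then show ?thesis by (metis card_le_Suc0_iff_eq One_nat_def card.infinite zero_le)
qed

lemma card_bad_ends_split:
  "card (bad_ends c a d) = card (crossing c a b d) + card (bad_ends c a d - crossing c a b d)"
proof -
  have "crossing c a b d \<subseteq> bad_ends c a d" by (auto simp: crossing_def)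
  then show ?thesis using finite_bad_ends by (metis card_Diff_subset card_mono finite_subset le_add_diff_inverse)
qed

lemma bad_ends_bound:
  assumes "proper c" "a \<in> small c" "b \<in> small c" "a \<noteq> b"
  shows "card (bad_ends c a d) + card (bad_ends c b d) \<le> 4"
    and "crossing c a b d = {} \<Longrightarrow> crossing c b a d = {} \<Longrightarrow>
      card (bad_ends c a d) + card (bad_ends c b d) \<le> 3"
proof -
  let ?A = "bad_ends c a d - crossing c a b d" and ?P = "bad_ends c b d - crossing c b a d"
  have cr: "card (crossing c a b d) \<le> 1" "card (crossing c b a d) \<le> 1"
    using card_crossing_le assms by auto
  have sp: "card (bad_ends c a d) = card (crossing c a b d) + card ?A"
    "card (bad_ends c b d) = card (crossing c b a d) + card ?P"
    using card_bad_ends_split by blast+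
  have l3: "card (bad_ends c a d) \<le> 3" "card (bad_ends c b d) \<le> 3"
    using card_bad_ends_le assms by auto
  have cases: "?A = {} \<or> ?P = {} \<or> card ?A \<le> 1 \<and> card ?P \<le> 1"
    using card_noncrossing_le[OF assms] card_noncrossing_le[OF assms(1,3,2) assms(4)[symmetric]] by blast
  show "card (bad_ends c a d) + card (bad_ends c b d) \<le> 4"
    using cases cr sp l3 by (elim disjE conjE) simp_all
  show "card (bad_ends c a d) + card (bad_ends c b d) \<le> 3"
    if "crossing c a b d = {}" "crossing c b a d = {}"
    using cases that l3 by (elim disjE conjE) simp_all
qed

text \<open>
Merging the ends of a crossing edge makes both of them lack \<open>a\<close>. After that no edge of colour \<open>d\<close> is
bad on the side of \<open>b\<close>, since its ends could be merged in turn. If the far end of such an edge lacks \<open>a\<close>,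
the exchange for it involves \<open>a\<close> too, but it does not affect the two ends merged before.
\<close>
lemma crossing_improve:
  assumes "proper c" "a \<in> small c" "b \<in> small c" "a \<noteq> b" "w \<in> crossing c a b d"
  obtains c' where "proper c'" "small c' = small c"
    "card (bad_ends c' a d) + card (bad_ends c' b d) \<le> 3"
proof -
  have w: "(w, d) \<in> bad c a" "nb c w d \<in> lack c b" using assms(5) by (auto simp: crossing_def bad_ends_def)
  let ?y = "nb c w d"
  note B = badD[OF assms(1,2) w(1)]
  have ak: "a < k" "b < k" using smallD assms by blast+
  have bm: "b \<in> miss c ?y" using lack_miss ak w by blast
  have db: "d \<noteq> b" using lackD'[OF w(2) B(5)] B(6) by simp
  obtain c1 where c1: "proper c1" "small c1 = small c" "w \<in> lack c1 a" "?y \<in> lack c1 a" "c1 {w, ?y} = c {w, ?y}"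
    using merge_ends[OF assms(1,2) B(1,5) bm bad_unlinked[OF assms(1,2) w(1) bm]] by metis
  have cd: "c1 {w, ?y} = d" using c1(5) B(6) by simp
  have s1: "a \<in> small c1" "b \<in> small c1" using c1(2) assms by auto
  have "bad_ends c1 b d = {}"
  proof (rule ccontr)
    assume "bad_ends c1 b d \<noteq> {}"
    then obtain v where v: "(v, d) \<in> bad c1 b" by (auto simp: bad_ends_def)
    note B1 = badD[OF c1(1) s1(2) v]
    let ?t = "nb c1 v d"
    have tV: "?t \<in> V" using edge_in_V[OF B1(5)] by blast
    obtain e where e: "e \<in> miss c1 ?t" using miss_nonempty[OF c1(1) tV] by blast
    have de: "d \<noteq> e" using lackD'[OF missD(2)[OF e] B1(5)] B1(6) by simp
    have vne: "v \<noteq> w" "v \<noteq> ?y"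
      using lack_unique[OF c1(1) B1(1) ak(2) _ ak(1)] c1(3,4) assms(4) by blast+
    then have edges: "{w, ?y} \<noteq> {v, ?t}" by (auto simp: doubleton_eq_iff)
    have tne: "?t \<noteq> w" "?t \<noteq> ?y"
      using proper_eqE[OF c1(1) B(5) B1(5)] cd B1(6) edges by auto
    show False
    proof (cases "e = a")
      case False
      obtain c2 where c2: "proper c2" "v \<in> lack c2 b" "?t \<in> lack c2 b"
        "\<And>f. f \<noteq> b \<Longrightarrow> f \<noteq> e \<Longrightarrow> lack c2 f = lack c1 f"
        "\<And>g f. f \<noteq> b \<Longrightarrow> f \<noteq> e \<Longrightarrow> c2 g = f \<longleftrightarrow> c1 g = f" "c2 {v, ?t} = c1 {v, ?t}"
        using merge_ends[OF c1(1) s1(2) B1(1,5) e bad_unlinked[OF c1(1) s1(2) v e]] by metis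
      have "lack c2 a = lack c1 a" using c2(4)[of a] assms(4) False by blast
      moreover have "c2 {w, ?y} = d" using c2(5)[OF db de] cd by blast
      moreover have "c2 {v, ?t} = d" using c2(6) B1(6) by simp
      ultimately show False
        using two_monochromatic_pairs[OF c2(1) ak assms(4) B(5) B1(5) edges] c1(3,4) c2(2,3) by simp
    next
      case True
      let ?X = "kempe c1 b a ?t"
      have tl: "?t \<in> lack c1 a" using missD(2)[OF e] True by simp
      have vX: "v \<notin> ?X" using bad_unlinked[OF c1(1) s1(2) v e] True assms(4) by auto
      obtain g where g: "?X \<inter> lack c1 b = {g}"
        by (rule linked_end[OF c1(1) s1(2) ak(1) assms(4)[symmetric] tl])
      then have g': "g \<in> lack c1 b" "g \<in> ?X" by auto
      note sw = linked_swap[OF c1(1) s1(2) ak(1) assms(4)[symmetric] tl g']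
      let ?c = "kempe_swap c1 b a ?X"
      have vg: "v \<noteq> g" using vX g' by auto
      have "w \<in> lack ?c a" "?y \<in> lack ?c a" "v \<in> lack ?c b" "?t \<in> lack ?c b"
        using sw(2,3) c1(3,4) tne B1(1) vg by auto
      moreover have "?c {w, ?y} = d" "?c {v, ?t} = d"
        using kempe_swap_other[OF db B(4)] cd B1(6) by blast+
      ultimately show False
        using two_monochromatic_pairs[OF sw(1) ak assms(4) B(5) B1(5) edges] by simp
    qed
  qed
  then have "card (bad_ends c1 a d) + card (bad_ends c1 b d) \<le> 3"
    using card_bad_ends_le[OF s1(1), of d] by simp
  then show thesis using that[OF c1(1,2)] by blast
qed

lemma order_eq: assumes "proper c" shows "card V = k + 2 * s"
proof -
  have "(\<Sum>v\<in>V. card (miss c v)) = (\<Sum>v\<in>V. 1)"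
    using card_miss_full[OF assms] no_deficient by (intro sum.cong) auto
  then show ?thesis using card_small_sum[OF assms] by simp
qed

text \<open>
Here the lower bound on bad edges means that on average at least two of the three vertices lacking \<open>a\<close> have a bad
edge of a given big colour.
\<close>
lemma card_bad_sum:
  assumes "proper c" "a \<in> small c"
  shows "2 * (k - s) \<le> (\<Sum>d\<in>{..<k} - small c. card (bad_ends c a d))"
proof -
  have "small c \<subseteq> {..<k}" using smallD(1) by auto
  then have k: "s \<le> k" "0 < k"
    using card_small[OF assms(1)] card_mono[of "{..<k}" "small c"] smallD(1)[OF assms(2)] by auto
  have "bad c a \<subseteq> (\<lambda>(d, w). (w, d)) ` (SIGMA d:{..<k} - small c. bad_ends c a d)"
  proof
    fix p assume p: "p \<in> bad c a"
    obtain w d where pw: "p = (w, d)" by (cases p)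
    then have b: "(w, d) \<in> bad c a" using p by simp
    then have "(d, w) \<in> (SIGMA d:{..<k} - small c. bad_ends c a d)"
      using small_not_bad[OF assms b] badD(3)[OF assms b] by (simp add: bad_ends_def)
    then show "p \<in> (\<lambda>(d, w). (w, d)) ` (SIGMA d:{..<k} - small c. bad_ends c a d)"
      using pw by force
  qed
  then have "card (bad c a) \<le> card (SIGMA d:{..<k} - small c. bad_ends c a d)"
    by (rule surj_card_le[rotated]) (use finite_bad_ends in auto)
  also have "\<dots> = (\<Sum>d\<in>{..<k} - small c. card (bad_ends c a d))"
    using finite_bad_ends by simp
  finally show ?thesis using card_bad_ge[OF assms] no_deficient order_eq[OF assms(1)] k by simp
qed

text \<open>
For two small colours \<open>a\<close> and \<open>b\<close>, a big colour has on average at least four bad ends and never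
more than four. So each big colour has exactly four of them in every colouring. But this requires a crossing
edge, and then there is a colouring with fewer bad ends of that colour.
\<close>
lemma all_small: "s = k"
proof (rule ccontr)
  assume ne: "s \<noteq> k"
  obtain c where c: "proper c" using colourable by blast
  obtain a where a: "a \<in> small c" using other_small[OF c] by metis
  obtain b where b: "b \<in> small c" "b \<noteq> a" by (rule other_small[OF c])
  have card_big: "card ({..<k} - small c) = k - s"
    using card_small[OF c] finite_small[of c] smallD(1) by (subst card_Diff_subset) auto
  have "s \<le> k" using card_small[OF c] smallD(1) card_mono[of "{..<k}" "small c"] by auto
  then have pos: "0 < k - s" using ne by simp
  then have "{..<k} - small c \<noteq> {}" using card_big by (metis card.empty less_irrefl)
  then obtain d where d: "d \<in> {..<k} - small c" by blast
  have contra: "\<not> card (bad_ends c' a d) + card (bad_ends c' b d) \<le> 3"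
    if c': "proper c'" "small c' = small c" for c'
  proof
    assume le3: "card (bad_ends c' a d) + card (bad_ends c' b d) \<le> 3"
    have s': "a \<in> small c'" "b \<in> small c'" using a b c'(2) by auto
    let ?S = "{..<k} - small c"
    let ?f = "\<lambda>d. card (bad_ends c' a d) + card (bad_ends c' b d)"
    have "4 * (k - s) \<le> (\<Sum>d\<in>?S. ?f d)"
      using card_bad_sum[OF c'(1) s'(1)] card_bad_sum[OF c'(1) s'(2)] c'(2) by (simp add: sum.distrib)
    also have "\<dots> = ?f d + (\<Sum>d\<in>?S - {d}. ?f d)" by (rule sum.remove) (use d in auto)
    also have "(\<Sum>d\<in>?S - {d}. ?f d) \<le> (\<Sum>d\<in>?S - {d}. 4)"
      by (rule sum_mono) (rule bad_ends_bound(1)[OF c'(1) s' b(2)[symmetric]])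
    also have "(\<Sum>d\<in>?S - {d}. 4) = 4 * (k - s - 1)" using d card_big by simp
    finally show False using le3 pos by simp
  qed
  show False
  proof (cases "crossing c a b d = {} \<and> crossing c b a d = {}")
    case True then show False using bad_ends_bound(2)[OF c a b(1) b(2)[symmetric]] contra[OF c] by simp
  next
    case False
    then consider w where "w \<in> crossing c a b d" | w where "w \<in> crossing c b a d" by blast
    then show False
    proof cases
      case 1
      obtain c' where "proper c'" "small c' = small c"
        "card (bad_ends c' a d) + card (bad_ends c' b d) \<le> 3"
        by (rule crossing_improve[OF c a b(1) b(2)[symmetric] 1])
      then show False using contra by blast
    next
      case 2
      obtain c' where "proper c'" "small c' = small c"
        "card (bad_ends c' b d) + card (bad_ends c' a d) \<le> 3"
        by (rule crossing_improve[OF c b(1) a b(2) 2])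
      then show False using contra by (simp add: add.commute)
    qed
  qed
qed

end

section \<open>Disjoint cliques\<close>

context two_small
begin

lemma all_small_structure:
  assumes "card deficient \<le> 1" "proper c"
  shows "s = k" "\<And>u y. u \<in> deficient \<Longrightarrow> {u, y} \<notin> E" "card V = (3 - card deficient) * k + card deficient"
proof -
  have case0: "s = k \<and> card V = 3 * k" if "deficient = {}"
  proof -
    interpret full_two_small G k s by unfold_locales (rule that)
    show ?thesis using all_small order_eq[OF assms(2)] by simp
  qed
  have case1: "s = k \<and> degree G u = 0 \<and> card V = 2 * k + 1" if u: "deficient = {u}" for u
  proof -
    have iso: "degree G u = 0" and sk: "s = k"
      using one_deficient_isolated[OF u] one_deficient_all_small[OF u assms(2)] by auto
    have uV: "u \<in> V" using u deficient_V by blast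
    have "card (miss c u) + (card V - 1) = k + 2 * s" by (rule card_miss_one_deficient[OF u assms(2)])
    moreover have "card (miss c u) = k" using card_miss[OF assms(2) uV] iso by simp
    ultimately show ?thesis using sk iso order_gt by auto
  qed
  have "deficient = {} \<or> (\<exists>u. deficient = {u})"
    using assms(1) finite_deficient by (metis card_0_eq card_1_singletonE le_Suc_eq le_zero_eq One_nat_def)
  then show "s = k" "card V = (3 - card deficient) * k + card deficient" using case0 case1 by auto
  fix u y assume "u \<in> deficient"
  then have "nbrs u = {}" using \<open>deficient = {} \<or> (\<exists>u. deficient = {u})\<close> case1 degree_nbrs[of u] finite_nbrs[of u] by auto
  then show "{u, y} \<notin> E" by (auto simp: nbrs_def)
qed

text \<open>
All edges have small colours, so the neighbours of \<open>w\<close> are linked to \<open>w\<close> and therefore lack pairwise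
distinct colours other than \<open>a\<close>. As \<open>w\<close> has \<open>k - 1\<close> neighbours, every such colour occurs.
\<close>
lemma unique_neighbour_lacking:
  assumes "card deficient \<le> 1" "proper c" "w \<in> V - deficient" "w \<in> lack c a" "a < k" "b < k" "b \<noteq> a"
  shows "\<exists>!y. {w, y} \<in> E \<and> y \<in> lack c b"
proof -
  note st = all_small_structure[OF assms(1,2)]
  have "small c = {..<k}"
    using card_seteq[of "{..<k}" "small c"] smallD(1) card_small[OF assms(2)] st(1) by auto
  then have sm: "d \<in> small c" if "d < k" for d using that by simp
  have link: "d \<noteq> a \<and> w \<in> kempe c a d y" if "{w, y} \<in> E" "d \<in> miss c y" for y d
    by (rule fan_linked[OF assms(2) _ _ sm[OF assms(5)] assms(4) that(2), of y "[]"])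
      (use that sm proper_range[OF assms(2)] in auto)
  have one: "\<exists>d. miss c y = {d}" if "y \<in> nbrs w" for y
  proof -
    have "y \<in> V" "y \<notin> deficient" using that edge_in_V st(2)[of y w] by (auto simp: nbrs_def insert_commute)
    then show ?thesis using card_miss_full[OF assms(2)] by (simp add: card_1_singleton_iff)
  qed
  define f where "f y = the_elem (miss c y)" for y
  have f: "miss c y = {f y}" if n: "y \<in> nbrs w" for y
  proof -
    obtain d where "miss c y = {d}" using one[OF n] by blast
    then show ?thesis by (simp add: f_def)
  qed
  have inj: "inj_on f (nbrs w)"
  proof (rule inj_onI)
    fix x y assume x: "x \<in> nbrs w" and y: "y \<in> nbrs w" and e: "f x = f y"
    have mx: "f x \<in> miss c x" "f x \<in> miss c y" using f[OF x] f[OF y] e by simp_all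
    have "f x \<noteq> a \<and> w \<in> kempe c a (f x) x" "f x \<noteq> a \<and> w \<in> kempe c a (f x) y"
      using link[of x "f x"] link[of y "f x"] x y mx by (simp_all add: nbrs_def)
    then show "x = y"
      using linked_unique[OF assms(2) sm[OF assms(5)] missD(1)[OF mx(1)] _ missD(2)[OF mx(1)] missD(2)[OF mx(2)]]
      by metis
  qed
  have sub: "f ` nbrs w \<subseteq> {..<k} - {a}"
  proof
    fix d assume "d \<in> f ` nbrs w"
    then obtain y where y: "y \<in> nbrs w" "d = f y" by blast
    then have "d \<in> miss c y" using f[OF y(1)] by simp
    then show "d \<in> {..<k} - {a}" using link[of y d] y(1) missD(1)[of d c y] by (auto simp: nbrs_def)
  qed
  have "card (nbrs w) = k - 1"
    using assms(3) degree_less[of w] degree_nbrs[of w] by (auto simp: deficient_def)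
  then have "card (f ` nbrs w) = card ({..<k} - {a})" using card_image[OF inj] assms(5) by simp
  then have "f ` nbrs w = {..<k} - {a}" using card_subset_eq[OF _ sub] by simp
  then obtain y where y: "y \<in> nbrs w" "f y = b" using assms(6,7) by (metis DiffI imageE lessThan_iff singletonD)
  show ?thesis
  proof (rule ex1I[of _ y])
    have "b \<in> miss c y" using f[OF y(1)] y(2) by simp
    then show "{w, y} \<in> E \<and> y \<in> lack c b" using missD(2) y(1) by (auto simp: nbrs_def)
    fix z assume z: "{w, z} \<in> E \<and> z \<in> lack c b"
    then have zn: "z \<in> nbrs w" by (simp add: nbrs_def)
    have "b \<in> miss c z" using z assms(6) by (simp add: miss_def)
    then have "f z = b" using f[OF zn] by simp
    then show "z = y" using inj zn y by (auto simp: inj_on_def)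
  qed
qed

text \<open>
Suppose that \<open>v\<close> lacks \<open>b\<close> and is not adjacent to \<open>u\<close>. Then \<open>u\<close> has another neighbour \<open>v2\<close> lacking \<open>b\<close>. The
exchange on the chain between \<open>w\<close> and \<open>v\<close> makes \<open>w\<close> lack \<open>b\<close> as well, so \<open>u\<close> gets two neighbours lacking \<open>b\<close>.
\<close>
lemma adjacent_trans:
  assumes "card deficient \<le> 1" "{w, u} \<in> E" "{w, v} \<in> E" "u \<noteq> v"
  shows "{u, v} \<in> E"
proof (rule ccontr)
  assume nuv: "{u, v} \<notin> E"
  obtain c where c: "proper c" using colourable by blast
  note st = all_small_structure[OF assms(1) c]
  have ne: "w \<noteq> u" "w \<noteq> v" using assms edge_neq by blast+
  have V: "w \<in> V - deficient" "u \<in> V - deficient" "v \<in> V - deficient"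
    using edge_in_V[OF assms(2)] edge_in_V[OF assms(3)] st(2)[of w u] st(2)[of u w] st(2)[of v w] assms(2,3)
    by (auto simp: insert_commute)
  have sm: "d \<in> small c" if "d < k" for d
    using card_seteq[of "{..<k}" "small c"] smallD(1) card_small[OF c] st(1) that by auto
  obtain a where a: "a < k" "w \<in> lack c a" using obtain_miss[OF c] V by blast
  obtain b where b: "b < k" "v \<in> lack c b" using obtain_miss[OF c] V by blast
  obtain d where d: "d < k" "u \<in> lack c d" using obtain_miss[OF c] V by blast
  have link: "e \<noteq> a \<and> w \<in> kempe c a e y" if "{w, y} \<in> E" "e < k" "y \<in> lack c e" for y e
    by (rule fan_linked[OF c _ _ sm[OF a(1)] a(2), of y y "[]"])
      (use that sm proper_range[OF c] in \<open>auto simp: miss_def\<close>)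
  have ab: "b \<noteq> a" "w \<in> kempe c a b v" and ad: "d \<noteq> a" "w \<in> kempe c a d u"
    using link[OF assms(3) b] link[OF assms(2) d] by auto
  have bd: "b \<noteq> d"
    using unique_neighbour_lacking[OF assms(1) c V(1) a(2,1) b(1) ab(1)] assms(2-4) b(2) d(2) by metis
  obtain v2 where v2: "{u, v2} \<in> E" "v2 \<in> lack c b"
    using unique_neighbour_lacking[OF assms(1) c V(2) d(2,1) b(1) bd] by blast
  have v2v: "v2 \<noteq> v" using v2(1) nuv by auto
  have v2w: "v2 \<noteq> w" using full_lack_unique[OF c _ _ a(2,1) _ b(1)] V(1) v2(2) ab(1) by blast
  note sw = linked_swap[OF c sm[OF a(1)] b(1) ab(1)[symmetric] b(2) a(2) ab(2)]
  let ?c = "kempe_swap c a b (kempe c a b v)"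
  have l: "w \<in> lack ?c b" "v2 \<in> lack ?c b" using sw(3) v2(2) v2v by auto
  have ud: "u \<in> lack ?c d" using sw(4)[of d] ad(1) bd d(2) by auto
  have "{u, w} \<in> E" using assms(2) by (simp add: insert_commute)
  then show False
    using unique_neighbour_lacking[OF assms(1) sw(1) V(2) ud d(1) b(1) bd] l v2(1) v2w by blast
qed

end

section \<open>Isomorphism with the named graphs\<close>

definition pairs :: "'a set \<Rightarrow> 'a set set" where
  "pairs A = {e. e \<subseteq> A \<and> card e = 2}"

text \<open>
Disjoint unions can be taken apart only if the edges are sets of vertices, which the type of
graphs does not ensure.
\<close>
definition edges_inside :: "'a ugraph \<Rightarrow> bool" where
  "edges_inside H \<longleftrightarrow> edges H \<subseteq> Pow (vertices H)"

lemma card_pairs: "finite A \<Longrightarrow> 2 * card (pairs A) = card A * (card A - 1)"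
proof -
  assume A: "finite A"
  have "even (card A * (card A - 1))" by (cases "card A") auto
  then show ?thesis using n_subsets[OF A, of 2] choose_two[of "card A"] by (simp add: pairs_def)
qed

lemma finite_pairs: "finite A \<Longrightarrow> finite (pairs A)"
  unfolding pairs_def by simp

lemma pairs_card_two: "card B = 2 \<Longrightarrow> pairs B = {B}"
proof -
  assume B: "card B = 2"
  then have "finite B" by (metis card.infinite zero_neq_numeral)
  then have "e = B" if "e \<subseteq> B" "card e = 2" for e using that B card_subset_eq by metis
  then show ?thesis using B by (auto simp: pairs_def)
qed

lemma pairs_card_one: "card B = 1 \<Longrightarrow> pairs B = {}"
proof -
  assume B: "card B = 1"
  then have "finite B" by (metis card.infinite zero_neq_one)
  then have "card e \<noteq> 2" if "e \<subseteq> B" for e using card_mono[OF _ that] B by auto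
  then show ?thesis unfolding pairs_def by blast
qed

lemma image_pairs:
  assumes "bij_betw f A B" shows "(`) f ` pairs A = pairs B"
proof -
  have inj: "inj_on f A" and im: "f ` A = B" using assms by (auto simp: bij_betw_def)
  have "card (f ` e) = card e" if "e \<subseteq> A" for e using card_image inj_on_subset[OF inj that] by blast
  then have "f ` e \<in> pairs B" if "e \<in> pairs A" for e using that im by (auto simp: pairs_def)
  moreover have "e \<in> (`) f ` pairs A" if e: "e \<in> pairs B" for e
  proof -
    obtain d where d: "d \<subseteq> A" "e = f ` d" using e im by (auto simp: pairs_def subset_image_iff)
    then have "d \<in> pairs A" using e card_image[OF inj_on_subset[OF inj d(1)]] by (simp add: pairs_def)
    then show ?thesis using d by blast
  qed
  ultimately show ?thesis by blast
qed

lemma complete_graph_pairs: "complete_graph n = UGraph {..<n} (pairs {..<n})"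
  by (simp add: complete_graph_def pairs_def)

lemma edges_inside_complete: "edges_inside (complete_graph n)"
  unfolding edges_inside_def complete_graph_def ugraph.sel by blast

lemma edges_inside_complement: "edges_inside (complement H)"
  unfolding edges_inside_def complement_def ugraph.sel by blast

lemma edges_inside_disjoint_union:
  assumes "edges_inside H" "edges_inside K" shows "edges_inside (disjoint_union H K)"
proof -
  have "Inl ` e \<subseteq> vertices H <+> vertices K" if "e \<in> edges H" for e
    using that assms(1) by (auto simp: edges_inside_def)
  moreover have "Inr ` e \<subseteq> vertices H <+> vertices K" if "e \<in> edges K" for e
    using that assms(2) by (auto simp: edges_inside_def)
  ultimately show ?thesis
    unfolding edges_inside_def disjoint_union_def ugraph.sel by blast
qed

lemma iso_complete_graph:
  assumes "D \<subseteq> Pow A"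
  shows "graph_iso (UGraph A D) (complete_graph n) \<longleftrightarrow> finite A \<and> card A = n \<and> D = pairs A"
proof
  assume "graph_iso (UGraph A D) (complete_graph n)"
  then obtain f where f: "bij_betw f A {..<n}" "(`) f ` D = pairs {..<n}"
    by (auto simp: graph_iso_def complete_graph_pairs)
  have A: "finite A \<and> card A = n" using bij_betw_finite[OF f(1)] bij_betw_same_card[OF f(1)] by simp
  have "(`) f ` D = (`) f ` pairs A" using f(2) image_pairs[OF f(1)] by simp
  moreover have "inj_on ((`) f) (Pow A)" using f(1) inj_on_image_Pow by (auto simp: bij_betw_def)
  moreover have "pairs A \<subseteq> Pow A" by (auto simp: pairs_def)
  ultimately have "D = pairs A" using inj_on_image_eq_iff[of "(`) f" "Pow A"] assms by metis
  then show "finite A \<and> card A = n \<and> D = pairs A" using A by blast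
next
  assume A: "finite A \<and> card A = n \<and> D = pairs A"
  then obtain f where f: "bij_betw f A {..<n}"
    by (metis bij_betw_iff_card card_lessThan finite_lessThan)
  then show "graph_iso (UGraph A D) (complete_graph n)"
    using image_pairs[OF f] A by (auto simp: graph_iso_def complete_graph_pairs)
qed

lemma edges_complement_complete: "complement (complete_graph n) = UGraph {..<n} {}"
  by (simp add: complement_def complete_graph_def)

lemma iso_empty_graph:
  "graph_iso (UGraph A D) (complement (complete_graph n)) \<longleftrightarrow> finite A \<and> card A = n \<and> D = {}"
proof
  assume "graph_iso (UGraph A D) (complement (complete_graph n))"
  then obtain f where f: "bij_betw f A {..<n}" "(`) f ` D = {}"
    by (auto simp: graph_iso_def edges_complement_complete)
  then show "finite A \<and> card A = n \<and> D = {}"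
    using bij_betw_finite[OF f(1)] bij_betw_same_card[OF f(1)] by simp
next
  assume A: "finite A \<and> card A = n \<and> D = {}"
  then obtain f where f: "bij_betw f A {..<n}"
    by (metis bij_betw_iff_card card_lessThan finite_lessThan)
  then show "graph_iso (UGraph A D) (complement (complete_graph n))"
    using A by (auto simp: graph_iso_def edges_complement_complete)
qed

lemma iso_disjoint_unionI:
  assumes "graph_iso (UGraph A C) H" "graph_iso (UGraph B D) K" "A \<inter> B = {}"
    "C \<subseteq> Pow A" "D \<subseteq> Pow B"
  shows "graph_iso (UGraph (A \<union> B) (C \<union> D)) (disjoint_union H K)"
proof -
  obtain f where f: "bij_betw f A (vertices H)" "(`) f ` C = edges H"
    using assms(1) by (auto simp: graph_iso_def)
  obtain g where g: "bij_betw g B (vertices K)" "(`) g ` D = edges K"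
    using assms(2) by (auto simp: graph_iso_def)
  define h where "h x = (if x \<in> A then Inl (f x) else Inr (g x))" for x
  have hA: "h ` e = Inl ` f ` e" if "e \<subseteq> A" for e
    using that by (auto simp: h_def image_iff subset_iff)
  have hB: "h ` e = Inr ` g ` e" if "e \<subseteq> B" for e
  proof -
    have "h x = Inr (g x)" if "x \<in> e" for x using that \<open>e \<subseteq> B\<close> assms(3) by (auto simp: h_def)
    then show ?thesis by (force simp: image_iff)
  qed
  have "inj_on h (A \<union> B)"
    using f(1) g(1) assms(3) by (auto simp: inj_on_def bij_betw_def h_def)
  moreover have "h ` (A \<union> B) = vertices H <+> vertices K"
    unfolding image_Un hA[OF order.refl] hB[OF order.refl] using f(1) g(1) by (simp add: bij_betw_def Plus_def)
  ultimately have "bij_betw h (A \<union> B) (vertices H <+> vertices K)" by (simp add: bij_betw_def)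
  moreover have "(`) h ` C = (\<lambda>e. Inl ` f ` e) ` C"
    by (rule image_cong[OF refl], rule hA) (use assms(4) in blast)
  then have "(`) h ` C = (`) Inl ` edges H" unfolding f(2)[symmetric] by (simp add: image_image)
  moreover have "(`) h ` D = (\<lambda>e. Inr ` g ` e) ` D"
    by (rule image_cong[OF refl], rule hB) (use assms(5) in blast)
  then have "(`) h ` D = (`) Inr ` edges K" unfolding g(2)[symmetric] by (simp add: image_image)
  ultimately show ?thesis
    unfolding graph_iso_def disjoint_union_def by (intro exI[of _ h]) (simp add: image_Un)
qed

lemma image_filter_eq: "T \<subseteq> g ` F \<Longrightarrow> g ` {x \<in> F. g x \<in> T} = T"
  unfolding image_def by blast

text \<open>
The parts are the preimages of the two summands; following the isomorphism by a projection of the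
sum type gives the isomorphisms of the parts.
\<close>
lemma iso_disjoint_unionE:
  assumes "graph_iso (UGraph W F) (disjoint_union H K)" "F \<subseteq> Pow W" "edges_inside H" "edges_inside K"
  obtains A B C D where "W = A \<union> B" "A \<inter> B = {}" "F = C \<union> D" "C \<subseteq> Pow A" "D \<subseteq> Pow B"
    "graph_iso (UGraph A C) H" "graph_iso (UGraph B D) K"
proof -
  obtain f where f: "bij_betw f W (vertices H <+> vertices K)"
    and e: "(`) f ` F = (`) Inl ` edges H \<union> (`) Inr ` edges K"
    using assms(1) by (auto simp: graph_iso_def disjoint_union_def)
  have inj: "inj_on f W" and im: "f ` W = vertices H <+> vertices K" using f by (auto simp: bij_betw_def)
  define A where "A = {x \<in> W. f x \<in> Inl ` vertices H}"
  define B where "B = {x \<in> W. f x \<in> Inr ` vertices K}"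
  define C where "C = {x \<in> F. f ` x \<in> (`) Inl ` edges H}"
  define D where "D = {x \<in> F. f ` x \<in> (`) Inr ` edges K}"
  have "W = A \<union> B" using im by (auto simp: A_def B_def Plus_def)
  moreover have "A \<inter> B = {}" by (auto simp: A_def B_def)
  moreover have eF: "f ` x \<in> (`) Inl ` edges H \<or> f ` x \<in> (`) Inr ` edges K" if "x \<in> F" for x
    using imageI[OF that, of "(`) f"] unfolding e by blast
  then have "F = C \<union> D" by (auto simp: C_def D_def)
  moreover have CA: "C \<subseteq> Pow A"
  proof
    fix x assume x: "x \<in> C"
    then obtain h where h: "h \<in> edges H" "f ` x = Inl ` h" by (auto simp: C_def)
    have "h \<subseteq> vertices H" using h assms(3) by (auto simp: edges_inside_def)
    then have "f ` x \<subseteq> Inl ` vertices H" using h(2) by blast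
    then show "x \<in> Pow A" using x assms(2) by (auto simp: A_def C_def)
  qed
  moreover have DB: "D \<subseteq> Pow B"
  proof
    fix x assume x: "x \<in> D"
    then obtain h where h: "h \<in> edges K" "f ` x = Inr ` h" by (auto simp: D_def)
    have "h \<subseteq> vertices K" using h assms(4) by (auto simp: edges_inside_def)
    then have "f ` x \<subseteq> Inr ` vertices K" using h(2) by blast
    then show "x \<in> Pow B" using x assms(2) by (auto simp: B_def D_def)
  qed
  moreover have "graph_iso (UGraph A C) H"
  proof -
    have fA: "f ` A = Inl ` vertices H" using im by (force simp: A_def Plus_def)
    have "inj_on (projl \<circ> f) A"
      using inj by (auto simp: inj_on_def A_def)
    moreover have "(projl \<circ> f) ` A = vertices H"
      unfolding image_comp[symmetric] fA by (simp add: image_image)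
    moreover have "(`) (projl \<circ> f) ` C = edges H"
    proof -
      have "(`) Inl ` edges H \<subseteq> (`) f ` F" unfolding e by blast
      then have fX: "(`) f ` C = (`) Inl ` edges H" unfolding C_def by (rule image_filter_eq)
      have "(`) (projl \<circ> f) ` C = (\<lambda>x. projl ` f ` x) ` C"
        by (rule image_cong[OF refl]) (simp add: image_comp)
      also have "\<dots> = (`) projl ` (`) f ` C" by (rule image_image[symmetric])
      finally show ?thesis unfolding fX by (simp add: image_image)
    qed
    ultimately show ?thesis unfolding graph_iso_def bij_betw_def by (intro exI[of _ "projl \<circ> f"]) simp
  qed
  moreover have "graph_iso (UGraph B D) K"
  proof -
    have fB: "f ` B = Inr ` vertices K" using im by (force simp: B_def Plus_def)
    have "inj_on (projr \<circ> f) B"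
      using inj by (auto simp: inj_on_def B_def)
    moreover have "(projr \<circ> f) ` B = vertices K"
      unfolding image_comp[symmetric] fB by (simp add: image_image)
    moreover have "(`) (projr \<circ> f) ` D = edges K"
    proof -
      have "(`) Inr ` edges K \<subseteq> (`) f ` F" unfolding e by blast
      then have fX: "(`) f ` D = (`) Inr ` edges K" unfolding D_def by (rule image_filter_eq)
      have "(`) (projr \<circ> f) ` D = (\<lambda>x. projr ` f ` x) ` D"
        by (rule image_cong[OF refl]) (simp add: image_comp)
      also have "\<dots> = (`) projr ` (`) f ` D" by (rule image_image[symmetric])
      finally show ?thesis unfolding fX by (simp add: image_image)
    qed
    ultimately show ?thesis unfolding graph_iso_def bij_betw_def by (intro exI[of _ "projr \<circ> f"]) simp
  qed
  ultimately show thesis using that by blast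
qed

lemma iso_complementI:
  assumes "simple_graph G" "graph_iso (complement G) H"
  shows "graph_iso G (complement H)"
proof -
  obtain f where f: "bij_betw f (vertices G) (vertices H)" "(`) f ` edges (complement G) = edges H"
    using assms(2) by (auto simp: graph_iso_def complement_def)
  have G: "edges G \<subseteq> pairs (vertices G)" using assms(1) by (auto simp: simple_graph_def pairs_def)
  have inj: "inj_on ((`) f) (pairs (vertices G))"
    by (rule inj_on_subset[OF inj_on_image_Pow[OF bij_betw_imp_inj_on[OF f(1)]]]) (auto simp: pairs_def)
  have cH: "edges (complement H) = pairs (vertices H) - edges H"
    by (auto simp: complement_def pairs_def)
  have cG: "edges (complement G) = pairs (vertices G) - edges G"
    by (auto simp: complement_def pairs_def)
  have "edges (complement H) = pairs (vertices H) - (`) f ` (pairs (vertices G) - edges G)"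
    unfolding cH f(2)[symmetric] cG ..
  also have "\<dots> = (`) f ` (pairs (vertices G) - (pairs (vertices G) - edges G))"
    by (subst inj_on_image_set_diff[OF inj]) (auto simp: image_pairs[OF f(1)])
  also have "pairs (vertices G) - (pairs (vertices G) - edges G) = edges G" using G by blast
  finally show ?thesis using f(1) unfolding graph_iso_def by (auto simp: complement_def)
qed

text \<open>
Number the edges of the matching, and the two ends of each edge.
\<close>
lemma iso_matching:
  assumes "finite M" "card M = q" "\<And>e. e \<in> M \<Longrightarrow> card e = 2"
    "\<And>e e'. e \<in> M \<Longrightarrow> e' \<in> M \<Longrightarrow> e \<noteq> e' \<Longrightarrow> e \<inter> e' = {}"
  shows "graph_iso (UGraph (\<Union>M) M) (copies q (complete_graph 2))"
proof -
  obtain h where h: "bij_betw h M {..<q}"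
    using assms(1,2) by (metis bij_betw_iff_card card_lessThan finite_lessThan)
  have "\<forall>e\<in>M. \<exists>g. bij_betw g e {..<2::nat}"
    using assms(3) by (metis bij_betw_iff_card card.infinite card_lessThan finite_lessThan zero_neq_numeral)
  then obtain g where g: "\<And>e. e \<in> M \<Longrightarrow> bij_betw (g e) e {..<2::nat}" by metis
  define p where "p x = (THE e. e \<in> M \<and> x \<in> e)" for x
  have p: "p x = e" if "e \<in> M" "x \<in> e" for e x
    unfolding p_def using that assms(4) by (intro the_equality) blast+
  define f where "f x = (h (p x), g (p x) x)" for x
  have fe: "f ` e = Pair (h e) ` {..<2}" if e: "e \<in> M" for e
  proof -
    have "f ` e = (\<lambda>x. (h e, g e x)) ` e" using p[OF e] by (auto simp: f_def)
    also have "\<dots> = Pair (h e) ` g e ` e" by (simp add: image_image)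
    finally show ?thesis using g[OF e] by (simp add: bij_betw_def)
  qed
  have inj: "inj_on f (\<Union>M)"
  proof (rule inj_onI)
    fix x y assume "x \<in> \<Union>M" "y \<in> \<Union>M" and eq: "f x = f y"
    then obtain d e where d: "d \<in> M" "x \<in> d" and e: "e \<in> M" "y \<in> e" by blast
    have "h d = h e" and gg: "g d x = g e y" using eq p[OF d] p[OF e] by (auto simp: f_def)
    then have "d = e" using h d(1) e(1) by (auto simp: bij_betw_def inj_on_def)
    then show "x = y" using gg g[OF d(1)] d(2) e(2) by (auto simp: bij_betw_def inj_on_def)
  qed
  have hM: "h ` M = {..<q}" using h by (simp add: bij_betw_def)
  have "f ` \<Union>M = (\<Union>e\<in>M. f ` e)" by (rule image_Union)
  also have "\<dots> = (\<Union>e\<in>M. Pair (h e) ` {..<2})" using fe by simp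
  also have "\<dots> = (\<Union>i\<in>h ` M. Pair i ` {..<2})" by simp
  also have "\<dots> = {..<q} \<times> {..<2}" unfolding hM by auto
  finally have vert: "bij_betw f (\<Union>M) ({..<q} \<times> {..<2})" using inj by (simp add: bij_betw_def)
  have two: "pairs {..<2::nat} = {{..<2}}" by (rule pairs_card_two) simp
  have "(`) f ` M = (\<lambda>e. Pair (h e) ` {..<2}) ` M" using fe by (intro image_cong) auto
  also have "\<dots> = (\<lambda>i. Pair i ` {..<2}) ` {..<q}" unfolding hM[symmetric] by (simp add: image_image)
  also have "\<dots> = {Pair i ` e |i e. i < q \<and> e \<in> pairs {..<2::nat}}" unfolding two by auto
  finally show ?thesis
    using vert unfolding graph_iso_def copies_def complete_graph_pairs by auto
qed

lemma iso_path_two: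
  assumes "z \<noteq> x" "z \<noteq> y" "x \<noteq> y"
  shows "graph_iso (UGraph {z, x, y} {{z, x}, {z, y}}) (complete_bipartite 1 2)"
proof -
  define f where "f v = (if v = z then Inl (0::nat) else if v = x then Inr 0 else Inr (1::nat))" for v
  have two: "{..<2::nat} = {0, 1}" by auto
  have "bij_betw f {z, x, y} ({..<1::nat} <+> {..<2::nat})"
    using assms unfolding two by (auto simp: bij_betw_def inj_on_def f_def Plus_def)
  moreover have "(`) f ` {{z, x}, {z, y}} = {{Inl 0, Inr 0}, {Inl 0, Inr 1}}"
    using assms by (auto simp: f_def)
  moreover have "{{Inl i, Inr j} | i j. i < 1 \<and> j < (2::nat)} = {{Inl (0::nat), Inr 0}, {Inl 0, Inr 1}}"
    by (auto simp: less_2_cases_iff)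
  ultimately show ?thesis unfolding graph_iso_def complete_bipartite_def by auto
qed

lemma iso_card_edges:
  assumes "graph_iso G H" "edges G \<subseteq> Pow (vertices G)"
  shows "card (edges G) = card (edges H)" "card (vertices G) = card (vertices H)"
proof -
  obtain f where f: "bij_betw f (vertices G) (vertices H)" "(`) f ` edges G = edges H"
    using assms(1) by (auto simp: graph_iso_def)
  have "inj_on ((`) f) (edges G)"
    using f(1) inj_on_image_Pow inj_on_subset[OF _ assms(2)] by (auto simp: bij_betw_def)
  then show "card (edges G) = card (edges H)" using card_image f(2) by metis
  show "card (vertices G) = card (vertices H)" using bij_betw_same_card[OF f(1)] .
qed

section \<open>The stability index and edge counts\<close>

lemma colouring_mono: "proper_edge_colouring G k c \<Longrightarrow> k \<le> l \<Longrightarrow> proper_edge_colouring G l c"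
  by (auto simp: proper_edge_colouring_def)

context sgraph
begin

lemma colouring_exists: "\<exists>k c. proper_edge_colouring G k c"
proof -
  obtain c :: "'a set \<Rightarrow> nat" and k where "c ` E = {i. i < k}" "inj_on c E"
    using finite_imp_inj_to_nat_seg[OF finite_E] by blast
  then have "proper_edge_colouring G k c" by (auto simp: proper_edge_colouring_def inj_on_def)
  then show ?thesis by blast
qed

lemma chromatic_index_le_iff: "chromatic_index G \<le> k \<longleftrightarrow> (\<exists>c. proper_edge_colouring G k c)"
proof
  have "\<exists>c. proper_edge_colouring G (chromatic_index G) c"
    unfolding chromatic_index_def by (rule LeastI_ex[OF colouring_exists])
  then show "\<exists>c. proper_edge_colouring G k c" if "chromatic_index G \<le> k"
    using colouring_mono[OF _ that] by blast
next
  assume "\<exists>c. proper_edge_colouring G k c"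
  then show "chromatic_index G \<le> k" unfolding chromatic_index_def by (rule Least_le)
qed

lemma simple_delete: "sgraph (delete_edges G F)"
  using simple by unfold_locales (auto simp: simple_graph_def delete_edges_def)

lemma stability_le:
  assumes "F \<subseteq> E" "proper_edge_colouring (delete_edges G F) l c" "l < chromatic_index G"
  shows "chromatic_edge_stability_index G \<le> card F"
proof -
  have "chromatic_index (delete_edges G F) \<le> l"
    using assms(2) sgraph.chromatic_index_le_iff[OF simple_delete] by blast
  then show ?thesis
    unfolding chromatic_edge_stability_index_def by (intro Least_le exI[of _ F]) (use assms in auto)
qed

lemma stability_attained:
  assumes "chromatic_index G = Suc l"
  obtains F c where "F \<subseteq> E" "card F = chromatic_edge_stability_index G"
    "proper_edge_colouring (delete_edges G F) l c"
proof -
  \<comment> \<open>Deleting all edges shows that the minimum is taken over a non-empty set.\<close>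
  have "proper_edge_colouring (delete_edges G E) 0 c" for c
    by (simp add: proper_edge_colouring_def delete_edges_def)
  then have "chromatic_index (delete_edges G E) \<le> 0"
    using sgraph.chromatic_index_le_iff[OF simple_delete] by blast
  then have "\<exists>k F. F \<subseteq> E \<and> card F = k \<and> chromatic_index (delete_edges G F) < chromatic_index G"
    using assms by (intro exI[of _ "card E"] exI[of _ E]) auto
  then have "\<exists>F\<subseteq>E. card F = chromatic_edge_stability_index G \<and>
      chromatic_index (delete_edges G F) < chromatic_index G"
    unfolding chromatic_edge_stability_index_def by (rule LeastI_ex)
  then obtain F where F: "F \<subseteq> E" "card F = chromatic_edge_stability_index G"
    "chromatic_index (delete_edges G F) \<le> l" using assms by auto
  then obtain c where "proper_edge_colouring (delete_edges G F) l c"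
    using sgraph.chromatic_index_le_iff[OF simple_delete] by blast
  then show thesis using that F by blast
qed

text \<open>
The last colour is renamed to the removed colour.
\<close>
lemma remove_colour_class:
  assumes "proper_edge_colouring G (Suc l) c" "a \<le> l"
  shows "\<exists>c'. proper_edge_colouring (delete_edges G {e \<in> E. c e = a}) l c'"
proof -
  define c' where "c' e = (if c e = l then a else c e)" for e
  have lt: "c e < Suc l" if "e \<in> E" for e using assms(1) that by (simp add: proper_edge_colouring_def)
  have ne: "c e \<noteq> c e'" if "e \<in> E" "e' \<in> E" "e \<noteq> e'" "e \<inter> e' \<noteq> {}" for e e'
    using assms(1) that by (simp add: proper_edge_colouring_def)
  have "c' e < l" if "e \<in> E" "c e \<noteq> a" for e
    using lt[OF that(1)] that(2) assms(2) by (auto simp: c'_def)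
  moreover have "c' e \<noteq> c' e'" if "e \<in> E" "e' \<in> E" "e \<noteq> e'" "e \<inter> e' \<noteq> {}" "c e \<noteq> a" "c e' \<noteq> a" for e e'
    using ne[OF that(1-4)] that(5,6) by (auto simp: c'_def)
  ultimately have "proper_edge_colouring (delete_edges G {e \<in> E. c e = a}) l c'"
    unfolding proper_edge_colouring_def delete_edges_def by simp
  then show ?thesis by blast
qed

lemma edges_pairs: "E \<subseteq> pairs V"
  using simple by (auto simp: simple_graph_def pairs_def)

lemma edges_Pow: "E \<subseteq> Pow V"
  using edge_subset by blast

lemma sum_degree: "(\<Sum>v\<in>V. degree G v) = 2 * card E"
proof -
  have "(\<Sum>v\<in>V. degree G v) = (\<Sum>v\<in>V. \<Sum>e\<in>E. if v \<in> e then 1 else 0)"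
    unfolding degree_def using finite_E by (intro sum.cong) (auto simp: sum.If_cases Int_def)
  also have "\<dots> = (\<Sum>e\<in>E. \<Sum>v\<in>V. if v \<in> e then 1 else 0)" by (rule sum.swap)
  also have "\<dots> = (\<Sum>e\<in>E. 2)"
  proof (intro sum.cong refl)
    fix e assume e: "e \<in> E"
    have "(\<Sum>v\<in>V. if v \<in> e then 1 else (0::nat)) = card (V \<inter> e)"
      using finite_V by (simp add: sum.If_cases)
    then show "(\<Sum>v\<in>V. if v \<in> e then 1 else (0::nat)) = 2"
      using edge_card[OF e] edge_subset[OF e] by (simp add: Int_absorb1)
  qed
  finally show ?thesis by simp
qed

lemma degree_le_max: "v \<in> V \<Longrightarrow> degree G v \<le> max_degree G"
  unfolding max_degree_def using finite_V by simp

lemma max_degree_attained: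
  assumes "E \<noteq> {}" obtains v where "v \<in> V" "degree G v = max_degree G"
proof -
  have "V \<noteq> {}" using assms edge_subset edge_card by fastforce
  then have "max_degree G \<in> degree G ` V" unfolding max_degree_def using finite_V by (intro Max_in) auto
  then show thesis using that by auto
qed

lemma degree_less_order: assumes "v \<in> V" shows "degree G v < card V"
proof -
  have "nbrs v \<subseteq> V - {v}" using nbrs_V[of v] edge_neq[of v] by (auto simp: nbrs_def)
  then have "card (nbrs v) \<le> card (V - {v})" using finite_V by (intro card_mono) auto
  moreover have "card (V - {v}) < card V" using assms finite_V by (intro psubset_card_mono) auto
  ultimately show ?thesis by (simp add: degree_nbrs)
qed

lemma UGraph_collapse: "UGraph V E = G"
  by simp

end

lemma coloured_pairs_le:
  fixes c :: "'a set \<Rightarrow> nat"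
  assumes "finite A" "D \<subseteq> pairs A" "card A \<le> 2 * r + 1" "\<And>e. e \<in> D \<Longrightarrow> c e < m"
    "\<And>e e'. e \<in> D \<Longrightarrow> e' \<in> D \<Longrightarrow> e \<noteq> e' \<Longrightarrow> e \<inter> e' \<noteq> {} \<Longrightarrow> c e \<noteq> c e'"
  shows "card D \<le> m * r"
proof -
  have finD: "finite D" using finite_subset[OF assms(2) finite_pairs[OF assms(1)]] .
  have class_le: "card {e \<in> D. c e = a} \<le> r" for a
  proof -
    let ?M = "{e \<in> D. c e = a}"
    have two: "card e = 2" "finite e" if "e \<in> ?M" for e
      using that assms(2) finite_subset[OF _ assms(1)] by (auto simp: pairs_def)
    have "card (\<Union>?M) = (\<Sum>e\<in>?M. card e)"
      by (rule card_Union_disjoint) (use two(2) assms(5) in \<open>auto simp: pairwise_def disjnt_def\<close>)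
    also have "\<dots> = 2 * card ?M" using two(1) by simp
    finally have "2 * card ?M = card (\<Union>?M)" by simp
    also have "\<dots> \<le> card A" using assms(1,2) by (intro card_mono) (auto simp: pairs_def)
    finally show ?thesis using assms(3) by linarith
  qed
  have "c ` D \<subseteq> {..<m}" using assms(4) by auto
  then have "card D = (\<Sum>a<m. card {e \<in> D. c e = a})"
    using sum.group[OF finD _ , of "{..<m}" c "\<lambda>_. 1::nat"] by simp
  also have "\<dots> \<le> (\<Sum>a<m. r)" by (rule sum_mono) (rule class_le)
  finally show ?thesis by simp
qed

context sgraph
begin

lemma deleted_card_ge:
  assumes "F \<subseteq> E" "proper_edge_colouring (delete_edges G F) l c" "card V \<le> 2 * r + 1"
  shows "card E \<le> card F + l * r"
proof -
  have "card (E - F) \<le> l * r"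
    by (rule coloured_pairs_le[OF finite_V _ assms(3), of _ c])
      (use edges_pairs assms(2) in \<open>auto simp: proper_edge_colouring_def delete_edges_def\<close>)
  then show ?thesis using card_Diff_subset[OF finite_subset[OF assms(1) finite_E] assms(1)] by simp
qed

text \<open>
Colour classes within \<open>A\<close> have at most \<open>m\<close> edges, so at most \<open>2m\<^sup>2\<close> of the \<open>(2m + 1)m\<close> edges of \<open>A\<close>
survive.
\<close>
lemma deleted_in_clique_ge:
  assumes "F \<subseteq> E" "proper_edge_colouring (delete_edges G F) (2 * m) c"
    "A \<subseteq> V" "card A = 2 * m + 1" "pairs A \<subseteq> E"
  shows "m \<le> card (F \<inter> pairs A)"
proof -
  have finA: "finite A" using finite_subset[OF assms(3) finite_V] .
  have "pairs A - F \<subseteq> E - F" using assms(5) by blast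
  then have "c e < 2 * m" "e' \<in> pairs A - F \<Longrightarrow> e \<noteq> e' \<Longrightarrow> e \<inter> e' \<noteq> {} \<Longrightarrow> c e \<noteq> c e'"
    if "e \<in> pairs A - F" for e e'
    using that assms(2) unfolding proper_edge_colouring_def delete_edges_def ugraph.sel by blast+
  then have "card (pairs A - F) \<le> 2 * m * m"
    by (intro coloured_pairs_le[OF finA, of _ _ c]) (use assms(4) in auto)
  moreover have "card (pairs A - F) + card (F \<inter> pairs A) = card (pairs A)"
    using card_Diff_subset_Int[of "pairs A" F] finite_pairs[OF finA] card_mono[of "pairs A" "pairs A \<inter> F"]
    by (simp add: Int_commute)
  moreover have "card (pairs A) = (2 * m + 1) * m" using card_pairs[OF finA] assms(4) by simp
  ultimately show ?thesis by (simp add: algebra_simps)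
qed

text \<open>
Delete a smallest class of a colouring with \<open>\<Delta> + 1\<close> colours.
\<close>
lemma stability_le_average:
  assumes "class2 G" "card E < (max_degree G + 1) * (q + 1)"
  shows "chromatic_edge_stability_index G \<le> q"
proof -
  let ?l = "max_degree G"
  have ci: "chromatic_index G = Suc ?l" using assms(1) by (simp add: class2_def)
  then obtain c where c: "proper_edge_colouring G (Suc ?l) c"
    using chromatic_index_le_iff[of "Suc ?l"] by auto
  have "\<exists>a\<le>?l. card {e \<in> E. c e = a} \<le> q"
  proof (rule ccontr)
    assume "\<not> ?thesis"
    then have ge: "q + 1 \<le> card {e \<in> E. c e = a}" if "a < Suc ?l" for a
      using that by (metis Suc_eq_plus1 Suc_leI less_Suc_eq_le not_le)
    have "c ` E \<subseteq> {..<Suc ?l}" using c by (auto simp: proper_edge_colouring_def)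
    then have total: "(\<Sum>a<Suc ?l. card {e \<in> E. c e = a}) = card E"
      using sum.group[OF finite_E, of "{..<Suc ?l}" c "\<lambda>_. 1::nat"] by simp
    have "(\<Sum>a<Suc ?l. q + 1) \<le> (\<Sum>a<Suc ?l. card {e \<in> E. c e = a})"
      by (rule sum_mono) (use ge in auto)
    then have "(\<Sum>a<Suc ?l. q + 1) \<le> card E" unfolding total .
    then show False using assms(2) by simp
  qed
  then obtain a where a: "a \<le> ?l" "card {e \<in> E. c e = a} \<le> q" by blast
  obtain c' where c': "proper_edge_colouring (delete_edges G {e \<in> E. c e = a}) ?l c'"
    using remove_colour_class[OF c a(1)] by blast
  have "chromatic_edge_stability_index G \<le> card {e \<in> E. c e = a}"
    by (rule stability_le[OF _ c']) (use ci in auto)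
  then show ?thesis using a(2) by simp
qed

lemma stability_eqI:
  assumes "class2 G" "card E < (max_degree G + 1) * (q + 1)"
    "\<And>F c. F \<subseteq> E \<Longrightarrow> proper_edge_colouring (delete_edges G F) (max_degree G) c \<Longrightarrow> q \<le> card F"
  shows "chromatic_edge_stability_index G = q"
proof -
  have "chromatic_index G = Suc (max_degree G)" using assms(1) by (simp add: class2_def)
  then obtain F c where F: "F \<subseteq> E" "card F = chromatic_edge_stability_index G"
    "proper_edge_colouring (delete_edges G F) (max_degree G) c" by (rule stability_attained)
  show ?thesis using assms(3)[OF F(1,3)] F(2) stability_le_average[OF assms(1,2)] by simp
qed

lemma stability_dense:
  assumes "class2 G" "card V = 2 * q + 3" "card E = max_degree G * (q + 1) + q"
  shows "chromatic_edge_stability_index G = q"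
proof (rule stability_eqI[OF assms(1)])
  show "card E < (max_degree G + 1) * (q + 1)" using assms(3) by simp
  fix F c assume F: "F \<subseteq> E" "proper_edge_colouring (delete_edges G F) (max_degree G) c"
  have "card E \<le> card F + max_degree G * (q + 1)"
    by (rule deleted_card_ge[OF F]) (use assms(2) in simp)
  then show "q \<le> card F" using assms(3) by simp
qed

lemma stability_cliques:
  assumes "class2 G" "finite \<A>" "pairwise disjnt \<A>" "max_degree G = 2 * m"
    "\<And>A. A \<in> \<A> \<Longrightarrow> A \<subseteq> V \<and> card A = 2 * m + 1 \<and> pairs A \<subseteq> E"
    "q = card \<A> * m" "card E < (2 * m + 1) * (q + 1)"
  shows "chromatic_edge_stability_index G = q"
proof (rule stability_eqI[OF assms(1)])
  show "card E < (max_degree G + 1) * (q + 1)" using assms by simp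
  fix F c assume F: "F \<subseteq> E" "proper_edge_colouring (delete_edges G F) (max_degree G) c"
  have finF: "finite F" using finite_subset[OF F(1) finite_E] .
  have "q = (\<Sum>A\<in>\<A>. m)" using assms(6) by simp
  also have "\<dots> \<le> (\<Sum>A\<in>\<A>. card (F \<inter> pairs A))"
    by (rule sum_mono) (use deleted_in_clique_ge[OF F(1)] F(2) assms(4,5) in auto)
  also have "\<dots> = card (\<Union>A\<in>\<A>. F \<inter> pairs A)"
  proof (rule card_UN_disjoint[symmetric, OF assms(2)])
    show "\<forall>A\<in>\<A>. finite (F \<inter> pairs A)" using finF by simp
    show "\<forall>A\<in>\<A>. \<forall>B\<in>\<A>. A \<noteq> B \<longrightarrow> F \<inter> pairs A \<inter> (F \<inter> pairs B) = {}"
    proof (intro ballI impI)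
      fix A B assume "A \<in> \<A>" "B \<in> \<A>" "A \<noteq> B"
      then have "A \<inter> B = {}" using assms(3) by (auto simp: pairwise_def disjnt_def)
      then have "e = {}" if "e \<subseteq> A" "e \<subseteq> B" for e using that by blast
      then have "e \<notin> pairs B" if "e \<in> pairs A" for e
        using that by (metis (mono_tags, lifting) card.empty mem_Collect_eq pairs_def zero_neq_numeral)
      then show "F \<inter> pairs A \<inter> (F \<inter> pairs B) = {}" by blast
    qed
  qed
  also have "\<dots> \<le> card F" using finF by (intro card_mono) auto
  finally show "q \<le> card F" .
qed

lemma tight_if_stability:
  assumes "class2 G" "card V = 2 * q + 3" "chromatic_edge_stability_index G = q"
  shows "tight_graph G (max_degree G + 1)"
proof -
  have cg: "colour_graph G (max_degree G + 1)"
    by unfold_locales (use degree_le_max in \<open>auto simp: less_Suc_eq_le\<close>)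
  show ?thesis
  proof (intro tight_graph.intro cg tight_graph_axioms.intro)
    show "odd (card V)" using assms(2) by simp
    fix c a assume c: "proper_edge_colouring G (max_degree G + 1) c" and a: "a < max_degree G + 1"
    obtain c' where c': "proper_edge_colouring (delete_edges G {e \<in> E. c e = a}) (max_degree G) c'"
      using remove_colour_class[of "max_degree G" c a] c a by auto
    have "chromatic_edge_stability_index G \<le> card {e \<in> E. c e = a}"
      by (rule stability_le[OF _ c']) (use assms(1) in \<open>auto simp: class2_def\<close>)
    then show "card (lack c a) \<le> 3"
      using colour_graph.card_lack[OF cg c, of a] assms(2,3) by simp
  qed
qed

end

section \<open>The stability index of the listed graphs\<close>

lemma pairs_insert: "x \<in> A \<Longrightarrow> y \<in> A \<Longrightarrow> x \<noteq> y \<Longrightarrow> {x, y} \<in> pairs A"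
  by (simp add: pairs_def)

lemma pairs_Pow: "pairs A \<subseteq> Pow A"
  by (auto simp: pairs_def)

lemma inj_on_image_Inl: "inj_on ((`) Inl) X" and inj_on_image_Inr: "inj_on ((`) Inr) Y"
  by (simp_all add: inj_on_def inj_image_eq_iff)

lemma card_edges_disjoint_union:
  assumes "finite (edges H)" "finite (edges K)" "{} \<notin> edges H"
  shows "card (edges (disjoint_union H K)) = card (edges H) + card (edges K)"
proof -
  have "(`) Inl ` edges H \<inter> (`) Inr ` edges K = {}"
  proof (rule equals0I)
    fix e assume e: "e \<in> (`) Inl ` edges H \<inter> (`) Inr ` edges K"
    obtain d where d: "e = Inl ` d" "d \<in> edges H" using IntD1[OF e] by (rule imageE)
    obtain d' where d': "e = Inr ` d'" using IntD2[OF e] by (rule imageE)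
    have "d \<noteq> {}" using d(2) assms(3) by metis
    then obtain x where "x \<in> d" by blast
    then have "Inl x \<in> Inr ` d'" using d(1) d' by blast
    then show False by (rule imageE) simp
  qed
  then show ?thesis
    using assms(1,2) by (simp add: disjoint_union_def card_Un_disjoint card_image inj_on_image_Inl inj_on_image_Inr)
qed

context sgraph
begin

lemma max_degree_eqI:
  assumes "v \<in> V" "degree G v = d" "\<And>w. w \<in> V \<Longrightarrow> degree G w \<le> d"
  shows "max_degree G = d"
  unfolding max_degree_def by (rule Max_eqI) (use finite_V assms in auto)

lemma degree_in_clique:
  assumes "pairs A \<subseteq> E" "\<And>e. e \<in> E \<Longrightarrow> e \<inter> A \<noteq> {} \<Longrightarrow> e \<subseteq> A" "v \<in> A"
  shows "degree G v = card A - 1"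
proof -
  have "nbrs v = A - {v}"
  proof (intro set_eqI iffI)
    fix y assume "y \<in> nbrs v"
    then have vy: "{v, y} \<in> E" by (simp add: nbrs_def)
    then have "{v, y} \<subseteq> A" by (rule assms(2)) (use assms(3) in auto)
    then show "y \<in> A - {v}" using edge_neq[OF vy] by auto
  next
    fix y assume "y \<in> A - {v}"
    then have "{v, y} \<in> pairs A" using assms(3) by (intro pairs_insert) auto
    then show "y \<in> nbrs v" using assms(1) by (auto simp: nbrs_def)
  qed
  then show ?thesis using assms(3) by (simp add: degree_nbrs)
qed

lemma stability_clique_and_pair:
  assumes "class2 G" "1 \<le> q" "V = A \<union> B" "A \<inter> B = {}" "E = pairs A \<union> D" "D \<subseteq> pairs B"
    "card A = 2 * q + 1" "card B = 2"
  shows "chromatic_edge_stability_index G = q"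
proof -
  have finA: "finite A" "finite B" using assms(3) finite_V by auto
  have DB: "D \<subseteq> {B}" using assms(6) pairs_card_two[OF assms(8)] by simp
  have sub: "pairs A \<subseteq> E" using assms(5) by blast
  have inside: "e \<subseteq> A" if "e \<in> E" "e \<inter> A \<noteq> {}" for e
    using that assms(4,5) DB by (auto simp: pairs_def)
  have dA: "degree G v = 2 * q" if "v \<in> A" for v
    using degree_in_clique[OF sub inside that] assms(7) by simp
  have dB: "degree G v \<le> 1" if "v \<in> B" for v
  proof -
    have "v \<notin> A" using that assms(4) by blast
    then have "{e \<in> E. v \<in> e} \<subseteq> {B}" using assms(5) DB by (auto simp: pairs_def)
    then show ?thesis unfolding degree_def using card_mono[of "{B}"] by simp
  qed
  have "A \<noteq> {}" using assms(7) by auto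
  then obtain v where v: "v \<in> A" by blast
  have "degree G w \<le> 2 * q" if "w \<in> V" for w
    using dA[of w] dB[of w] assms(2,3) that by fastforce
  then have md: "max_degree G = 2 * q"
    by (intro max_degree_eqI[of v]) (use v dA assms(3) in auto)
  have "card (pairs A) = (2 * q + 1) * q" using card_pairs[OF finA(1)] assms(7) by simp
  moreover have "E \<subseteq> pairs A \<union> {B}" using assms(5) DB by blast
  then have "card E \<le> card (pairs A \<union> {B})" using finite_pairs[OF finA(1)] by (intro card_mono) auto
  then have "card E \<le> card (pairs A) + card {B}" using card_Un_le[of "pairs A" "{B}"] by simp
  ultimately have cE: "card E < (2 * q + 1) * (q + 1)" using assms(2) by simp
  show ?thesis
    by (rule stability_cliques[OF assms(1), of "{A}" q]) (use md cE sub assms(3,7) in auto)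
qed

lemma stability_cliques_partition:
  assumes "class2 G" "V = A \<union> B \<union> C" "A \<inter> B = {}" "(A \<union> B) \<inter> C = {}"
    "E = pairs A \<union> pairs B \<union> pairs C" "card A = 2 * m + 1" "card B = 2 * m + 1"
    "card C = 1 \<or> card C = 2 * m + 1"
  shows "2 * chromatic_edge_stability_index G + 3 = card V"
proof -
  have fin: "finite A" "finite B" "finite C" using assms(2) finite_V by auto
  have in3: "e \<subseteq> X" if "e \<in> E" "e \<inter> X \<noteq> {}" "X \<in> {A, B, C}" for e X
    using that assms(3-5) by (auto simp: pairs_def)
  have sub: "pairs A \<subseteq> E" "pairs B \<subseteq> E" "pairs C \<subseteq> E" using assms(5) by auto
  have dA: "degree G v = 2 * m" if "v \<in> A" for v
    using degree_in_clique[OF sub(1) in3 that] assms(6) by simp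
  have dB: "degree G v = 2 * m" if "v \<in> B" for v
    using degree_in_clique[OF sub(2) in3 that] assms(7) by simp
  have dC: "degree G v \<le> 2 * m" if "v \<in> C" for v
    using degree_in_clique[OF sub(3) in3 that] assms(8) by auto
  have "A \<noteq> {}" "B \<noteq> {}" using assms(6,7) by auto
  then obtain v where v: "v \<in> A" by blast
  have md: "max_degree G = 2 * m"
    by (rule max_degree_eqI[of v]) (use v dA dB dC assms(2) in auto)
  have cV: "card V = card A + card B + card C"
    unfolding assms(2) using fin assms(3,4) by (simp add: card_Un_disjoint)
  have cA: "card (pairs A) = (2 * m + 1) * m" using card_pairs[OF fin(1)] assms(6) by simp
  have cB: "card (pairs B) = (2 * m + 1) * m" using card_pairs[OF fin(2)] assms(7) by simp
  have cE: "card E \<le> card (pairs A) + card (pairs B) + card (pairs C)"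
    unfolding assms(5) using card_Un_le[of "pairs A \<union> pairs B" "pairs C"] card_Un_le[of "pairs A" "pairs B"] by simp
  have AB: "A \<noteq> B" "C \<noteq> A" "C \<noteq> B" using assms(3,4) \<open>A \<noteq> {}\<close> \<open>B \<noteq> {}\<close> by auto
  show ?thesis
  proof (cases "card C = 1")
    case True
    have "card E < (2 * m + 1) * (2 * m + 1)"
      using cE cA cB pairs_card_one[OF True] by (simp add: algebra_simps)
    then have "chromatic_edge_stability_index G = 2 * m"
      by (intro stability_cliques[OF assms(1), of "{A, B}" m])
        (use md sub assms(2,3,6,7) AB in \<open>auto simp: pairwise_def disjnt_def\<close>)
    then show ?thesis using cV assms(6,7) True by simp
  next
    case False
    then have C: "card C = 2 * m + 1" using assms(8) by simp
    have "card (pairs C) = (2 * m + 1) * m" using card_pairs[OF fin(3)] C by simp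
    then have "card E < (2 * m + 1) * (3 * m + 1)"
      using cE cA cB by (simp add: algebra_simps)
    then have "chromatic_edge_stability_index G = 3 * m"
      by (intro stability_cliques[OF assms(1), of "{A, B, C}" m])
        (use md sub assms(2,3,4,6,7) C AB in \<open>auto simp: pairwise_def disjnt_def\<close>)
    then show ?thesis using cV assms(6,7) C by simp
  qed
qed

lemma stability_iso_cliques:
  assumes "class2 G" "graph_iso G (disjoint_union (disjoint_union (complete_graph (2 * m + 1))
      (complete_graph (2 * m + 1))) (complete_graph r))" "r = 1 \<or> r = 2 * m + 1"
  shows "2 * chromatic_edge_stability_index G + 3 = card V"
proof -
  obtain W C D F where W: "V = W \<union> C" "W \<inter> C = {}" "E = D \<union> F" "D \<subseteq> Pow W" "F \<subseteq> Pow C"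
    "graph_iso (UGraph W D) (disjoint_union (complete_graph (2 * m + 1)) (complete_graph (2 * m + 1)))"
    "graph_iso (UGraph C F) (complete_graph r)"
    by (rule iso_disjoint_unionE[of V E, unfolded UGraph_collapse, OF assms(2) edges_Pow
          edges_inside_disjoint_union[OF edges_inside_complete edges_inside_complete] edges_inside_complete])
  obtain A B D1 D2 where A: "W = A \<union> B" "A \<inter> B = {}" "D = D1 \<union> D2" "D1 \<subseteq> Pow A" "D2 \<subseteq> Pow B"
    "graph_iso (UGraph A D1) (complete_graph (2 * m + 1))" "graph_iso (UGraph B D2) (complete_graph (2 * m + 1))"
    by (rule iso_disjoint_unionE[OF W(6,4) edges_inside_complete edges_inside_complete])
  show ?thesis
    by (rule stability_cliques_partition[OF assms(1), of A B C m])
      (use W A iso_complete_graph[OF W(5)] iso_complete_graph[OF A(4)] iso_complete_graph[OF A(5)] assms(3) in auto)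
qed

lemma stability_iso_clique_pair:
  assumes "class2 G" "1 \<le> q" "card V = 2 * q + 3"
    "graph_iso G (disjoint_union (complete_graph (2 * q + 1)) H)"
    "H = complete_graph 2 \<or> H = complement (complete_graph 2)"
  shows "chromatic_edge_stability_index G = q"
proof -
  have "edges_inside H" using assms(5) edges_inside_complete edges_inside_complement by blast
  then obtain A B C D where A: "V = A \<union> B" "A \<inter> B = {}" "E = C \<union> D" "C \<subseteq> Pow A" "D \<subseteq> Pow B"
    "graph_iso (UGraph A C) (complete_graph (2 * q + 1))" "graph_iso (UGraph B D) H"
    by (rule iso_disjoint_unionE[of V E, unfolded UGraph_collapse, OF assms(4) edges_Pow edges_inside_complete])
  have C: "C = pairs A" "card A = 2 * q + 1" using iso_complete_graph[OF A(4)] A(6) by auto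
  have "card B = 2 \<and> D \<subseteq> pairs B"
    using assms(5) iso_complete_graph[OF A(5)] iso_empty_graph[of B D] A(7) by auto
  then show ?thesis using stability_clique_and_pair[OF assms(1,2) A(1,2)] A(3) C by blast
qed

lemma degree_sum_bounds:
  shows "2 * card E \<le> card V * max_degree G"
  using sum_mono[of V "degree G" "\<lambda>_. max_degree G"] degree_le_max sum_degree by simp

lemma max_degree_less_order: assumes "E \<noteq> {}" shows "max_degree G < card V"
  using max_degree_attained[OF assms] degree_less_order by metis

text \<open>
The number of edges leaves only one value for the maximum degree; the isomorphism is needed just for
the number of edges.
\<close>
lemma stability_iso_minus_edge:
  assumes "class2 G" "1 \<le> q" "card V = 2 * q + 3" "graph_iso G (complete_graph_minus_edge (2 * q + 3))"
  shows "chromatic_edge_stability_index G = q"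
proof -
  let ?n = "2 * q + 3"
  have "edges (complete_graph_minus_edge ?n) = pairs {..<?n} - {{0, 1}}"
    by (simp add: complete_graph_minus_edge_def delete_edges_def complete_graph_pairs)
  moreover have "{0, 1} \<in> pairs {..<?n}" by (rule pairs_insert) auto
  moreover have "card (pairs {..<?n}) = ?n * (q + 1)" using card_pairs[of "{..<?n}"] by simp
  ultimately have "card (edges (complete_graph_minus_edge ?n)) = ?n * (q + 1) - 1"
    by (simp add: card_Diff_singleton)
  then have cE: "card E = ?n * (q + 1) - 1" using iso_card_edges(1)[OF assms(4) edges_Pow] by simp
  then have "E \<noteq> {}" by auto
  then have "max_degree G \<le> 2 * q + 2" using max_degree_less_order assms(3) by fastforce
  moreover have "\<not> max_degree G \<le> 2 * q + 1"
  proof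
    assume "max_degree G \<le> 2 * q + 1"
    then have "?n * max_degree G \<le> ?n * (2 * q + 1)" by (rule mult_le_mono2)
    then have "2 * (?n * (q + 1) - 1) \<le> ?n * (2 * q + 1)" using degree_sum_bounds assms(3) cE by simp
    then show False by (simp add: algebra_simps)
  qed
  ultimately have "max_degree G = 2 * q + 2" by simp
  then show ?thesis by (intro stability_dense[OF assms(1,3)]) (simp add: cE algebra_simps)
qed

text \<open>
Every vertex of the complement lies on an edge, so the maximum degree is at most \<open>n - 2\<close>. The number of
edges gives the reverse inequality.
\<close>
lemma stability_iso_dense:
  assumes "class2 G" "1 \<le> q" "card V = 2 * q + 3"
    "graph_iso G (complement (disjoint_union (copies q (complete_graph 2)) (complete_bipartite 1 2)))"
  shows "chromatic_edge_stability_index G = q"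
proof -
  let ?n = "2 * q + 3"
  let ?K = "copies q (complete_graph 2)" and ?S = "complete_bipartite 1 2"
  let ?H = "disjoint_union ?K ?S"
  have two: "pairs {..<2::nat} = {{..<2}}" by (rule pairs_card_two) simp
  have eK: "edges ?K = (\<lambda>i. Pair i ` {..<2}) ` {..<q}" "vertices ?K = {..<q} \<times> {..<2}"
    unfolding copies_def complete_graph_pairs ugraph.sel two by auto
  have "inj_on (\<lambda>i. Pair i ` {..<2::nat}) {..<q}"
  proof (rule inj_onI)
    fix i j :: nat assume eq: "Pair i ` {..<2::nat} = Pair j ` {..<2}"
    have "(i, 0) \<in> Pair i ` {..<2::nat}" by auto
    then show "i = j" unfolding eq by auto
  qed
  then have cK: "card (edges ?K) = q" unfolding eK by (simp add: card_image)
  have eS: "edges ?S = {{Inl 0, Inr 0}, {Inl 0, Inr 1}}" "vertices ?S = {Inl 0, Inr 0, Inr 1}"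
    by (auto simp: complete_bipartite_def less_2_cases_iff Plus_def image_iff)
  have cS: "card (edges ?S) = 2" unfolding eS by (simp add: doubleton_eq_iff)
  have eH: "edges ?H = (`) Inl ` edges ?K \<union> (`) Inr ` edges ?S" "vertices ?H = vertices ?K <+> vertices ?S"
    by (simp_all add: disjoint_union_def)
  have "{..<2::nat} \<noteq> {}" by (simp add: lessThan_empty_iff)
  then have nonempty: "{} \<notin> edges ?K" unfolding eK by auto
  have "finite (edges ?K)" "finite (edges ?S)" unfolding eK eS by simp_all
  then have cH: "card (edges ?H) = q + 2"
    using card_edges_disjoint_union[OF _ _ nonempty, of ?S] cK cS by simp
  have pH: "edges ?H \<subseteq> pairs (vertices ?H)"
  proof -
    have "Pair i ` {..<2::nat} \<in> pairs ({..<q} \<times> {..<2})" if "i < q" for i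
      using that by (auto simp: pairs_def card_image inj_on_def)
    then have K: "edges ?K \<subseteq> pairs (vertices ?K)" unfolding eK by auto
    have S: "edges ?S \<subseteq> pairs (vertices ?S)" unfolding eS by (auto simp: pairs_def)
    have "Inl ` e \<in> pairs (vertices ?H)" if "e \<in> pairs (vertices ?K)" for e
      using that unfolding eH pairs_def by (auto simp: card_image)
    moreover have "Inr ` e \<in> pairs (vertices ?H)" if "e \<in> pairs (vertices ?S)" for e
      using that unfolding eH pairs_def by (auto simp: card_image)
    ultimately show ?thesis using K S unfolding eH by blast
  qed
  have vH: "card (vertices ?H) = ?n" "finite (vertices ?H)"
    unfolding eH(2) eK(2) eS(2) by (simp_all add: card_Plus)
  have cover: "\<exists>e\<in>edges ?H. v \<in> e" if v: "v \<in> vertices ?H" for v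
  proof -
    have K: "\<exists>e\<in>edges ?K. x \<in> e" if "x \<in> vertices ?K" for x
      using that unfolding eK by auto
    have S: "\<exists>e\<in>edges ?S. x \<in> e" if "x \<in> vertices ?S" for x
      using that unfolding eS by auto
    from v show ?thesis
      unfolding eH(2)
    proof (rule PlusE)
      fix x assume x: "x \<in> vertices ?K" "v = Inl x"
      obtain e where "e \<in> edges ?K" "x \<in> e" using K[OF x(1)] by blast
      then show ?thesis unfolding eH(1) x(2) by blast
    next
      fix x assume x: "x \<in> vertices ?S" "v = Inr x"
      obtain e where "e \<in> edges ?S" "x \<in> e" using S[OF x(1)] by blast
      then show ?thesis unfolding eH(1) x(2) by blast
    qed
  qed
  have eC: "edges (complement ?H) = pairs (vertices ?H) - edges ?H" "vertices (complement ?H) = vertices ?H"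
    by (auto simp: complement_def pairs_def)
  have "card (edges (complement ?H)) = ?n * (q + 1) - (q + 2)"
    unfolding eC using card_pairs[OF vH(2)] vH(1) cH card_Diff_subset[OF finite_subset[OF pH finite_pairs[OF vH(2)]] pH]
    by simp
  then have "card E = ?n * (q + 1) - (q + 2)" using iso_card_edges(1)[OF assms(4) edges_Pow] by simp
  then have cE: "card E = 2 * q * q + 4 * q + 1" by (simp add: algebra_simps)
  then have "E \<noteq> {}" by auto
  then obtain v where v: "v \<in> V" "degree G v = max_degree G" by (rule max_degree_attained)
  obtain f where f: "bij_betw f V (vertices ?H)" "(`) f ` E = edges (complement ?H)"
    using assms(4) eC(2) by (auto simp: graph_iso_def)
  have "f v \<in> vertices ?H" using f(1) v(1) by (auto simp: bij_betw_def)
  then obtain e where e: "e \<in> edges ?H" "f v \<in> e" using cover by blast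
  have e2: "e \<subseteq> vertices ?H" "card e = 2" using e(1) pH by (auto simp: pairs_def)
  obtain y' where y': "e = {f v, y'}" "y' \<noteq> f v" using e2(2) e(2) by (auto simp: card_2_iff doubleton_eq_iff)
  have "y' \<in> f ` V" using y'(1) e2(1) bij_betw_imp_surj_on[OF f(1)] by auto
  then obtain y where y: "y \<in> V" "f y = y'" by blast
  have vy: "{v, y} \<notin> E"
  proof
    assume "{v, y} \<in> E"
    then have "f ` {v, y} \<in> edges (complement ?H)" using f(2) by blast
    then show False using y y' e(1) unfolding eC by auto
  qed
  have "nbrs v \<subseteq> V - {v, y}" using nbrs_V[of v] edge_neq[of v] vy by (auto simp: nbrs_def)
  then have "card (nbrs v) \<le> card (V - {v, y})" using finite_V by (intro card_mono) auto
  moreover have "v \<noteq> y" using y(2) y'(2) by blast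
  then have "card (V - {v, y}) = 2 * q + 1"
    using v(1) y y'(2) assms(3) finite_V by (subst card_Diff_subset) auto
  ultimately have "max_degree G \<le> 2 * q + 1" using v(2) degree_nbrs[of v] by simp
  moreover have "\<not> max_degree G \<le> 2 * q"
  proof
    assume "max_degree G \<le> 2 * q"
    then have "?n * max_degree G \<le> ?n * (2 * q)" by (rule mult_le_mono2)
    then show False using degree_sum_bounds assms(2,3) cE by (simp add: algebra_simps)
  qed
  ultimately have "max_degree G = 2 * q + 1" by simp
  then show ?thesis by (intro stability_dense[OF assms(1,3)]) (simp add: cE algebra_simps)
qed

lemma stability_regular:
  assumes "class2 G" "E \<noteq> {}" "card V = 2 * q + 3" "regular (2 * q) G"
  shows "chromatic_edge_stability_index G = q"
proof -
  obtain v where "v \<in> V" "degree G v = max_degree G" by (rule max_degree_attained[OF assms(2)])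
  then have md: "max_degree G = 2 * q" using assms(4) by (auto simp: regular_def)
  have "2 * card E = (2 * q + 3) * (2 * q)"
    using sum_degree assms(3,4) by (simp add: regular_def)
  then have "card E = (2 * q + 3) * q" by simp
  then show ?thesis by (intro stability_dense[OF assms(1,3)]) (simp add: md algebra_simps)
qed

end

context two_small
begin

lemma two_deficient_iso:
  assumes "card deficient = 2"
  shows "graph_iso G (disjoint_union (complete_graph (card V - 2)) (complete_graph 2)) \<or>
    graph_iso G (disjoint_union (complete_graph (card V - 2)) (complement (complete_graph 2)))"
proof -
  let ?A = "V - deficient"
  define D where "D = {e \<in> E. e \<subseteq> deficient}"
  have V: "?A \<union> deficient = V" using deficient_V by blast
  have fin: "finite ?A" "finite deficient" using finite_V finite_deficient by auto
  have cA: "card ?A = card V - 2" using assms deficient_V finite_deficient by (simp add: card_Diff_subset)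
  have "e \<in> pairs ?A \<union> D" if e: "e \<in> E" for e
  proof (cases "e \<inter> ?A = {}")
    case True then show ?thesis using e edge_subset[OF e] by (auto simp: D_def)
  next
    case False
    then obtain x where x: "x \<in> e" "x \<in> ?A" by blast
    obtain y where y: "e = {x, y}" "y \<in> V" by (rule edge_at[OF e x(1)])
    have "y \<notin> deficient" using no_deficient_edge[OF assms, of y x] x(2) y(1) e by (auto simp: insert_commute)
    then show ?thesis using pairs_insert[OF x(2), of y] y edge_neq[of x y] e by auto
  qed
  moreover have "e \<in> E" if e: "e \<in> pairs ?A" for e
  proof -
    obtain x y where "e = {x, y}" "x \<noteq> y" using e by (auto simp: pairs_def card_2_iff)
    then show ?thesis using adjacent_full[OF assms, of x y] e by (auto simp: pairs_def)
  qed
  ultimately have E: "pairs ?A \<union> D = E" by (auto simp: D_def)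
  have "D \<subseteq> pairs deficient" using edge_card by (auto simp: D_def pairs_def)
  then have "D = {} \<or> D = pairs deficient" unfolding pairs_card_two[OF assms] by blast
  moreover have K: "graph_iso (UGraph ?A (pairs ?A)) (complete_graph (card V - 2))"
    using iso_complete_graph[OF pairs_Pow] fin(1) cA pairs_Pow by blast
  moreover have "graph_iso (UGraph deficient (pairs deficient)) (complete_graph 2)"
    using iso_complete_graph[OF pairs_Pow] fin(2) assms pairs_Pow by blast
  moreover have "graph_iso (UGraph deficient {}) (complement (complete_graph 2))"
    using iso_empty_graph[of deficient "{}" 2] fin(2) assms by simp
  moreover have "graph_iso (UGraph (?A \<union> deficient) (pairs ?A \<union> D)) (disjoint_union (complete_graph (card V - 2)) H)"
    if "graph_iso (UGraph deficient D) H" for H :: "nat ugraph"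
    by (rule iso_disjoint_unionI[OF K that]) (use pairs_Pow in \<open>auto simp: D_def\<close>)
  ultimately show ?thesis unfolding V E UGraph_collapse by metis
qed

text \<open>
The order of a clique is odd because exactly one of its vertices, \<open>w\<close>, lacks the colour \<open>a\<close>, and the edges
of colour \<open>a\<close> match the others.
\<close>
lemma clique_neighbourhood:
  assumes "card deficient \<le> 1" "w \<in> V - deficient"
  defines "A \<equiv> insert w (nbrs w)"
  shows "card A = k" "A \<subseteq> V - deficient" "\<And>x. x \<in> A \<Longrightarrow> nbrs x = A - {x}" "odd k"
proof -
  obtain c where c: "proper c" using colourable by blast
  note st = all_small_structure[OF assms(1) c]
  have wn: "w \<notin> nbrs w" using edge_neq[of w w] by (auto simp only: nbrs_def mem_Collect_eq)
  have deg: "Suc (card (nbrs x)) = k" if "x \<in> V - deficient" for x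
    using that degree_less[of x] degree_nbrs[of x] by (auto simp: deficient_def)
  show cA: "card A = k" unfolding A_def using wn finite_nbrs[of w] deg[OF assms(2)] by simp
  have "y \<notin> deficient" if "y \<in> nbrs w" for y using st(2)[of y w] that by (auto simp: nbrs_def insert_commute)
  then show AV: "A \<subseteq> V - deficient" unfolding A_def using assms(2) nbrs_V[of w] by auto
  show nb: "nbrs x = A - {x}" if x: "x \<in> A" for x
  proof (cases "x = w")
    case True then show ?thesis using wn by (simp add: A_def)
  next
    case False
    then have xw: "{w, x} \<in> E" using x by (simp add: A_def nbrs_def)
    have "A - {x} \<subseteq> nbrs x"
    proof
      fix y assume y: "y \<in> A - {x}"
      show "y \<in> nbrs x"
      proof (cases "y = w")
        case True then show ?thesis using xw by (simp add: nbrs_def insert_commute)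
      next
        case False
        then have "{w, y} \<in> E" using y by (simp add: A_def nbrs_def)
        then show ?thesis using adjacent_trans[OF assms(1) xw] y by (auto simp: nbrs_def)
      qed
    qed
    moreover have "card (nbrs x) \<le> card (A - {x})"
      using deg[of x] AV x cA by (simp add: subset_iff)
    ultimately show ?thesis using card_seteq[OF finite_nbrs] by blast
  qed
  have wV: "w \<in> V" using assms(2) by blast
  obtain a where a: "a < k" "w \<in> lack c a" by (rule obtain_miss[OF c wV])
  have sm: "small c = {..<k}"
    using card_seteq[of "{..<k}" "small c"] smallD(1) card_small[OF c] st(1) by auto
  have "y \<notin> lack c a" if "y \<in> nbrs w" for y
    using small_edge_ends[OF c _ _ a(1) a(2), of y] that proper_range[OF c] sm by (auto simp: nbrs_def)
  then have "A \<inter> lack c a = {w}" using a(2) by (auto simp: A_def)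
  moreover have "closed_under c {a} A"
    unfolding closed_under_def
  proof (intro conjI ballI impI)
    show "A \<subseteq> V" using AV by blast
    fix e assume e: "e \<in> E" "c e \<in> {a} \<and> e \<inter> A \<noteq> {}"
    then obtain x where x: "x \<in> e" "x \<in> A" by blast
    obtain y where y: "e = {x, y}" by (rule edge_at[OF e(1) x(1)])
    then have "y \<in> nbrs x" using e(1) by (simp add: nbrs_def)
    then show "e \<subseteq> A" using nb[OF x(2)] x y by auto
  qed
  then have "card A = 2 * card {e \<in> E. c e = a \<and> e \<subseteq> A} + card (A \<inter> lack c a)" by (rule card_closed[OF c])
  ultimately show "odd k" using cA by simp
qed

lemma clique_partition_step:
  assumes "card deficient \<le> 1" "W \<subseteq> V - deficient" "\<forall>x\<in>W. nbrs x \<subseteq> W" "card W = k + r" "0 < k"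
  obtains A where "A \<subseteq> W" "card A = k" "\<forall>x\<in>A. nbrs x = A - {x}"
    "\<forall>x\<in>W - A. nbrs x \<subseteq> W - A" "card (W - A) = r"
proof -
  have "W \<noteq> {}" using assms(4,5) by auto
  then obtain w where w: "w \<in> W" by blast
  let ?A = "insert w (nbrs w)"
  have wN: "w \<in> V - deficient" using w assms(2) by blast
  note C = clique_neighbourhood[OF assms(1) wN]
  have AW: "?A \<subseteq> W" using assms(3) w by blast
  have nbA: "\<forall>x\<in>?A. nbrs x = ?A - {x}" using C(3) by blast
  have out: "\<forall>x\<in>W - ?A. nbrs x \<subseteq> W - ?A"
  proof (intro ballI subsetI)
    fix x y assume x: "x \<in> W - ?A" and y: "y \<in> nbrs x"
    have "y \<notin> ?A"
    proof
      assume "y \<in> ?A"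
      then have "nbrs y = ?A - {y}" using nbA by blast
      moreover have "x \<in> nbrs y" using y by (simp add: nbrs_def insert_commute)
      ultimately show False using x by blast
    qed
    then show "y \<in> W - ?A" using assms(3) x y by blast
  qed
  have "card (W - ?A) = card W - card ?A" by (rule card_Diff_subset[OF _ AW]) (simp add: finite_nbrs)
  then have "card (W - ?A) = r" using C(1) assms(4) by simp
  then show thesis by (rule that[OF AW C(1) nbA out])
qed

lemma cliques_iso:
  assumes "card deficient \<le> 1"
  shows "\<exists>m>0. graph_iso G (disjoint_union
         (disjoint_union (complete_graph (2 * m + 1)) (complete_graph (2 * m + 1))) (complete_graph 1)) \<or>
       graph_iso G (disjoint_union
         (disjoint_union (complete_graph (2 * m + 1)) (complete_graph (2 * m + 1))) (complete_graph (2 * m + 1)))"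
proof -
  obtain c where c: "proper c" using colourable by blast
  note st = all_small_structure[OF assms c]
  have k2: "2 \<le> k" using two_le_s st(1) by simp
  have finNF: "finite deficient" by (rule finite_deficient)
  define W where "W = V - deficient"
  have cW: "card W = (3 - card deficient) * k" "finite W"
    using st(3) card_Diff_subset[OF finNF deficient_V] finite_V by (auto simp: W_def)
  have W_closed: "\<forall>x\<in>W. nbrs x \<subseteq> W"
  proof (intro ballI subsetI)
    fix x y assume y: "y \<in> nbrs x"
    then have "{y, x} \<in> E" by (simp add: nbrs_def insert_commute)
    then show "y \<in> W" using st(2) nbrs_V[of x] y by (auto simp: W_def)
  qed
  have le01: "card deficient = 0 \<or> card deficient = 1" using assms by linarith
  have "card W = k + (2 - card deficient) * k"
    using cW(1) le01 by (elim disjE) simp_all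
  moreover have sub: "W \<subseteq> V - deficient" "0 < k" using k2 by (auto simp: W_def)
  ultimately obtain A where A: "A \<subseteq> W" "card A = k" "\<forall>x\<in>A. nbrs x = A - {x}"
    "\<forall>x\<in>W - A. nbrs x \<subseteq> W - A" "card (W - A) = (2 - card deficient) * k"
    using clique_partition_step[OF assms sub(1) W_closed _ sub(2)] by metis
  have "card (W - A) = k + (1 - card deficient) * k"
    using A(5) le01 by (elim disjE) simp_all
  moreover have "W - A \<subseteq> V - deficient" by (auto simp: W_def)
  ultimately obtain B where B: "B \<subseteq> W - A" "card B = k" "\<forall>x\<in>B. nbrs x = B - {x}"
    "\<forall>x\<in>W - A - B. nbrs x \<subseteq> W - A - B" "card (W - A - B) = (1 - card deficient) * k"
    using clique_partition_step[OF assms _ A(4) _ sub(2)] by metis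
  have "A \<noteq> {}" using A(2) k2 by auto
  then have "odd k" using clique_neighbourhood(4)[OF assms] A(1) by (auto simp: W_def)
  then obtain m where m: "k = 2 * m + 1" by (elim oddE)
  have m0: "0 < m" using m k2 by simp
  have "\<exists>C. C \<subseteq> V \<and> V = (A \<union> B) \<union> C \<and> (A \<union> B) \<inter> C = {} \<and> (card C = 1 \<or> card C = k) \<and> (\<forall>x\<in>C. nbrs x = C - {x})"
  proof (cases "card deficient = 1")
    case True
    then obtain u where u: "deficient = {u}" by (auto simp: card_1_singleton_iff)
    have "W - A - B = {}" using B(5) True cW(2) by simp
    then have "V = (A \<union> B) \<union> deficient" using A(1) B(1) deficient_V by (auto simp: W_def)
    moreover have "(A \<union> B) \<inter> deficient = {}" using A(1) B(1) by (auto simp: W_def)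
    moreover have "nbrs u = {}" using st(2)[of u] u by (auto simp: nbrs_def)
    ultimately show ?thesis using True deficient_V u by (intro exI[of _ deficient]) auto
  next
    case False
    then have deficient: "deficient = {}" using assms finNF by (metis One_nat_def card_0_eq le_Suc_eq le_zero_eq)
    have "card (W - A - B) = k + 0" "W - A - B \<subseteq> V - deficient"
      using B(5) deficient by (auto simp: W_def)
    then obtain C where C: "C \<subseteq> W - A - B" "card C = k" "\<forall>x\<in>C. nbrs x = C - {x}"
      "card (W - A - B - C) = 0"
      using clique_partition_step[OF assms _ B(4) _ sub(2)] by metis
    have "W - A - B - C = {}" using C(4) cW(2) by simp
    then have "V = (A \<union> B) \<union> C" using A(1) B(1) C(1) deficient by (auto simp: W_def)
    moreover have "(A \<union> B) \<inter> C = {}" using C(1) by blast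
    ultimately show ?thesis using C(2,3) by (intro exI[of _ C]) auto
  qed
  then obtain C where C: "V = (A \<union> B) \<union> C" "(A \<union> B) \<inter> C = {}" "card C = 1 \<or> card C = k"
    "\<forall>x\<in>C. nbrs x = C - {x}" by blast
  have AB: "A \<inter> B = {}" using B(1) by blast
  have in_pairs: "e \<in> pairs X" if T: "e \<in> E" "x \<in> e" "x \<in> X" "nbrs x = X - {x}" for e x X
  proof -
    obtain y where y: "e = {x, y}" "y \<noteq> x" by (rule edge_at[OF T(1,2)])
    then have "y \<in> nbrs x" using T(1) by (simp add: nbrs_def)
    then show ?thesis using pairs_insert[OF T(3), of y] T(4) y by auto
  qed
  have from_pairs: "e \<in> E" if X: "e \<in> pairs X" "\<forall>x\<in>X. nbrs x = X - {x}" for e X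
  proof -
    obtain x y where xy: "e = {x, y}" "x \<noteq> y" using X(1) by (auto simp: pairs_def card_2_iff)
    then have "x \<in> X" "y \<in> X" using X(1) by (auto simp: pairs_def)
    then have "y \<in> nbrs x" using X(2) xy(2) by auto
    then show ?thesis using xy by (simp add: nbrs_def)
  qed
  have "e \<in> (pairs A \<union> pairs B) \<union> pairs C" if e: "e \<in> E" for e
  proof -
    have "e \<noteq> {}" using edge_card[OF e] by auto
    then obtain x where x: "x \<in> e" by blast
    then have "x \<in> A \<or> x \<in> B \<or> x \<in> C" using edge_subset[OF e] C(1) by blast
    then show ?thesis
    proof (elim disjE)
      assume "x \<in> A" then show ?thesis using in_pairs[OF e x, of A] A(3) by simp
    next
      assume "x \<in> B" then show ?thesis using in_pairs[OF e x, of B] B(3) by simp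
    next
      assume "x \<in> C" then show ?thesis using in_pairs[OF e x, of C] C(4) by simp
    qed
  qed
  moreover have "(pairs A \<union> pairs B) \<union> pairs C \<subseteq> E"
    using from_pairs[OF _ A(3)] from_pairs[OF _ B(3)] from_pairs[OF _ C(4)] by blast
  ultimately have E: "(pairs A \<union> pairs B) \<union> pairs C = E" by blast
  have K: "graph_iso (UGraph X (pairs X)) (complete_graph (card X))" if "X \<subseteq> V" for X
    using iso_complete_graph[OF pairs_Pow] finite_subset[OF that finite_V] pairs_Pow by blast
  have inV: "A \<subseteq> V" "B \<subseteq> V" "C \<subseteq> V" using C(1) by auto
  have "graph_iso (UGraph (A \<union> B) (pairs A \<union> pairs B)) (disjoint_union (complete_graph (card A)) (complete_graph (card B)))"
    by (rule iso_disjoint_unionI[OF K[OF inV(1)] K[OF inV(2)] AB pairs_Pow pairs_Pow])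
  then have "graph_iso (UGraph ((A \<union> B) \<union> C) ((pairs A \<union> pairs B) \<union> pairs C))
      (disjoint_union (disjoint_union (complete_graph (card A)) (complete_graph (card B))) (complete_graph (card C)))"
    by (rule iso_disjoint_unionI[OF _ K[OF inV(3)] C(2) _ pairs_Pow]) (auto simp: pairs_def)
  then have "graph_iso G (disjoint_union (disjoint_union (complete_graph k) (complete_graph k)) (complete_graph (card C)))"
    unfolding E C(1)[symmetric] UGraph_collapse A(2) B(2) .
  then show ?thesis using C(3) m m0 by (intro exI[of _ m]) auto
qed

end

context sgraph
begin

lemma complement_sgraph: "sgraph (complement G)"
  unfolding sgraph_def simple_graph_def complement_def ugraph.sel using finite_V by blast

lemma complement_nbrs:
  assumes "v \<in> V" shows "sgraph.nbrs (complement G) v = V - {v} - nbrs v"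
proof -
  have "{v, y} \<in> edges (complement G) \<longleftrightarrow> y \<in> V - {v} - nbrs v" for y
    using assms by (cases "y = v") (simp_all add: nbrs_def complement_def)
  then show ?thesis
    by (simp add: sgraph.nbrs_def[OF complement_sgraph] set_eq_iff)
qed

lemma complement_degree:
  assumes "v \<in> V" shows "degree (complement G) v + degree G v + 1 = card V"
proof -
  have sub: "nbrs v \<subseteq> V - {v}" using nbrs_V[of v] edge_neq[of v] by (auto simp: nbrs_def)
  have "card (V - {v} - nbrs v) + card (nbrs v) = card (V - {v})"
    using card_Diff_subset[OF finite_nbrs sub] card_mono[OF _ sub] finite_V by simp
  moreover have "card (V - {v}) + 1 = card V" using card_Suc_Diff1[OF finite_V assms] by simp
  ultimately show ?thesis
    using complement_nbrs[OF assms] degree_nbrs[of v] sgraph.degree_nbrs[OF complement_sgraph, of v] by simp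
qed

lemma iso_minus_edge:
  assumes "card (edges (complement G)) = 1" "2 \<le> card V"
  shows "graph_iso G (complete_graph_minus_edge (card V))"
proof -
  let ?n = "card V"
  interpret C: sgraph "complement G" by (rule complement_sgraph)
  have VC: "vertices (complement G) = V" by (simp add: complement_def)
  obtain e where e: "edges (complement G) = {e}" using assms(1) by (auto simp: card_1_singleton_iff)
  then have "card e = 2" "e \<subseteq> V" using C.edge_card[of e] C.edge_subset[of e] VC by auto
  then obtain x y where xy: "e = {x, y}" "x \<noteq> y" "x \<in> V" "y \<in> V" by (auto simp: card_2_iff)
  have "card (V - {x, y}) = card {2..<?n}" using xy finite_V by (subst card_Diff_subset) auto
  then obtain g where g: "bij_betw g (V - {x, y}) {2..<?n}"
    using finite_V by (metis bij_betw_iff_card finite_Diff finite_atLeastLessThan)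
  define f where "f v = (if v = x then 0 else if v = y then 1 else g v)" for v
  have "bij_betw f {x, y} {0, 1}" using xy(2) by (auto simp: bij_betw_def f_def)
  moreover have "bij_betw f (V - {x, y}) {2..<?n}"
    using g by (rule bij_betw_cong[THEN iffD1, rotated]) (auto simp: f_def)
  ultimately have "bij_betw f ({x, y} \<union> (V - {x, y})) ({0, 1} \<union> {2..<?n})"
    by (rule bij_betw_combine) auto
  moreover have "{x, y} \<union> (V - {x, y}) = V" using xy by blast
  moreover have "{0, 1} \<union> {2..<?n} = {..<?n}" using assms(2) by auto
  ultimately have f: "bij_betw f V {..<?n}" by simp
  have "(`) f ` {{x, y}} = {{0, 1}}" using xy(2) by (auto simp: f_def)
  then have "graph_iso (complement G) (UGraph {..<?n} {{0, 1}})"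
    unfolding graph_iso_def e xy(1) VC using f by auto
  then have "graph_iso G (complement (UGraph {..<?n} {{0, 1}}))"
    by (rule iso_complementI[OF simple])
  moreover have "complement (UGraph {..<?n} {{0, 1}}) = complete_graph_minus_edge ?n"
    by (auto simp: complement_def complete_graph_minus_edge_def delete_edges_def complete_graph_def)
  ultimately show ?thesis by simp
qed

text \<open>
The vertex \<open>z\<close> is the centre of the path \<open>K\<^sub>1\<^sub>,\<^sub>2\<close> in the complement; every other vertex has one
edge there, so the remaining edges form a matching.
\<close>
lemma iso_complement_matching_path:
  assumes "card V = 2 * q + 3" "z \<in> V" "degree (complement G) z = 2"
    "\<And>v. v \<in> V - {z} \<Longrightarrow> degree (complement G) v = 1"
  shows "graph_iso G (complement (disjoint_union (copies q (complete_graph 2)) (complete_bipartite 1 2)))"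
proof (rule iso_complementI[OF simple])
  let ?H = "complement G"
  interpret C: sgraph ?H by (rule complement_sgraph)
  have VC: "vertices ?H = V" by (simp add: complement_def)
  obtain x y where xy: "C.nbrs z = {x, y}" "x \<noteq> y"
    using assms(3) C.degree_nbrs[of z] by (auto simp: card_2_iff)
  have zx: "{z, x} \<in> edges ?H" "{z, y} \<in> edges ?H" using xy(1) by (auto simp: C.nbrs_def)
  have ne: "z \<noteq> x" "z \<noteq> y" using C.edge_neq zx by blast+
  have xyV: "x \<in> V" "y \<in> V" using C.nbrs_V[of z] xy(1) VC by auto
  have one: "e = e'" if "e \<in> edges ?H" "e' \<in> edges ?H" "v \<in> e" "v \<in> e'" "v \<noteq> z" for e e' v
  proof -
    have "v \<in> V" using C.edge_subset[OF that(1)] that(3) VC by blast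
    then have "card {e \<in> edges ?H. v \<in> e} = 1" using assms(4)[of v] that(5) by (simp add: degree_def)
    then obtain d where d: "{e \<in> edges ?H. v \<in> e} = {d}" by (rule card_1_singletonE)
    have "e \<in> {d}" "e' \<in> {d}" unfolding d[symmetric] using that by blast+
    then show ?thesis by simp
  qed
  define M where "M = edges ?H - {{z, x}, {z, y}}"
  have zM: "z \<notin> e" if "e \<in> M" for e
  proof
    assume z: "z \<in> e"
    have e: "e \<in> edges ?H" using that by (simp add: M_def)
    obtain w where w: "e = {z, w}" by (rule C.edge_at[OF e z])
    then have "w \<in> {x, y}" using e xy(1) by (auto simp: C.nbrs_def)
    then show False using that w by (auto simp: M_def)
  qed
  have disj: "e \<inter> e' = {}" if "e \<in> M" "e' \<in> M" "e \<noteq> e'" for e e'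
    using one[of e e'] that zM by (auto simp: M_def)
  have UM: "\<Union>M = V - {z, x, y}"
  proof (intro equalityI subsetI)
    fix v assume "v \<in> \<Union>M"
    then obtain e where e: "e \<in> M" "v \<in> e" by blast
    then have eH: "e \<in> edges ?H" by (simp add: M_def)
    have "x \<notin> e" using one[OF eH zx(1), of x] ne e(1) by (auto simp: M_def)
    moreover have "y \<notin> e" using one[OF eH zx(2), of y] ne e(1) by (auto simp: M_def)
    ultimately show "v \<in> V - {z, x, y}" using e zM[OF e(1)] C.edge_subset[OF eH] VC by auto
  next
    fix v assume v: "v \<in> V - {z, x, y}"
    then have "card {e \<in> edges ?H. v \<in> e} = 1" using assms(4)[of v] by (simp add: degree_def)
    then obtain e where "e \<in> edges ?H" "v \<in> e" by (auto simp: card_1_singleton_iff)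
    then show "v \<in> \<Union>M" using v by (auto simp: M_def)
  qed
  have M2: "card e = 2" if "e \<in> M" for e using that C.edge_card by (simp add: M_def)
  have finM: "finite M" using C.finite_E by (simp add: M_def)
  have "card (\<Union>M) = (\<Sum>e\<in>M. card e)"
    by (rule card_Union_disjoint) (use disj C.finite_edge in \<open>auto simp: pairwise_def disjnt_def M_def\<close>)
  also have "\<dots> = 2 * card M" using M2 by simp
  finally have "2 * card M = card (V - {z, x, y})" unfolding UM by simp
  moreover have "card {z, x, y} = 3" using ne xy(2) by simp
  then have "card (V - {z, x, y}) = 2 * q"
    using card_Diff_subset[of "{z, x, y}" V] assms(1,2) xyV by simp
  ultimately have cM: "card M = q" by simp
  have iM: "graph_iso (UGraph (\<Union>M) M) (copies q (complete_graph 2))"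
    by (rule iso_matching[OF finM cM]) (use M2 disj in auto)
  have iP: "graph_iso (UGraph {z, x, y} {{z, x}, {z, y}}) (complete_bipartite 1 2)"
    by (rule iso_path_two) (use ne xy(2) in auto)
  have "graph_iso (UGraph (\<Union>M \<union> {z, x, y}) (M \<union> {{z, x}, {z, y}}))
      (disjoint_union (copies q (complete_graph 2)) (complete_bipartite 1 2))"
    by (rule iso_disjoint_unionI[OF iM iP]) (use UM in auto)
  moreover have "\<Union>M \<union> {z, x, y} = vertices ?H" using UM assms(2) xyV VC by auto
  moreover have "M \<union> {{z, x}, {z, y}} = edges ?H" using zx by (auto simp: M_def)
  ultimately show "graph_iso ?H (disjoint_union (copies q (complete_graph 2)) (complete_bipartite 1 2))" by simp
qed

text \<open>
The hypothesis is the count of missing colours in the case of exactly one small colour. It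
determines the degrees in the complement: all are 2, or all are 1 except for a single 2, or they add up to 2.
\<close>
lemma dense_cases:
  assumes "card V = 2 * q + 3" "E \<noteq> {}"
    and sum: "(\<Sum>v\<in>V. max_degree G + 1 - degree G v) = max_degree G + 3"
  shows "graph_iso G (complete_graph_minus_edge (2 * q + 3)) \<or>
    graph_iso G (complement (disjoint_union (copies q (complete_graph 2)) (complete_bipartite 1 2))) \<or>
    regular (2 * q) G"
proof -
  let ?d = "degree (complement G)" and ?D = "max_degree G"
  interpret C: sgraph "complement G" by (rule complement_sgraph)
  have VC: "vertices (complement G) = V" by (simp add: complement_def)
  have d: "?d v + degree G v = 2 * q + 2" if "v \<in> V" for v using complement_degree[OF that] assms(1) by simp
  have le: "degree G v \<le> ?D" if "v \<in> V" for v using degree_le_max[OF that] .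
  have "1 \<le> ?D + 1 - degree G v" if "v \<in> V" for v using le[OF that] by simp
  then have "(\<Sum>v\<in>V. 1) \<le> (\<Sum>v\<in>V. ?D + 1 - degree G v)" by (rule sum_mono)
  then have lo: "2 * q \<le> ?D" using sum assms(1) by simp
  have "?D \<le> 2 * q + 2" using max_degree_less_order[OF assms(2)] assms(1) by simp
  then consider "?D = 2 * q" | "?D = 2 * q + 1" | "?D = 2 * q + 2" using lo by linarith
  then show ?thesis
  proof cases
    case 1
    have "1 = ?D + 1 - degree G v" if "v \<in> V" for v
      by (rule sum_mono_inv[where I = V and f = "\<lambda>_. 1" and g = "\<lambda>v. ?D + 1 - degree G v"])
        (use sum assms(1) 1 le that finite_V in \<open>auto simp: Suc_diff_le\<close>)
    then have "degree G v = 2 * q" if "v \<in> V" for v using that le[OF that] 1 by fastforce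
    then show ?thesis by (simp add: regular_def)
  next
    case 2
    have eq: "?D + 1 - degree G v = ?d v" if "v \<in> V" for v using d[OF that] 2 by simp
    then have sd: "(\<Sum>v\<in>V. ?d v) = 2 * q + 4" using sum 2 by simp
    have d1: "1 \<le> ?d v" if "v \<in> V" for v using d[OF that] le[OF that] 2 by simp
    have "\<exists>z\<in>V. 2 \<le> ?d z"
    proof (rule ccontr)
      assume "\<not> ?thesis"
      then have "(\<Sum>v\<in>V. ?d v) \<le> (\<Sum>v\<in>V. 1)" by (intro sum_mono) (auto simp: not_le)
      then show False using sd assms(1) by simp
    qed
    then obtain z where z: "z \<in> V" "2 \<le> ?d z" by blast
    have split: "(\<Sum>v\<in>V. ?d v) = ?d z + (\<Sum>v\<in>V - {z}. ?d v)" by (rule sum.remove[OF finite_V z(1)])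
    have "(\<Sum>v\<in>V - {z}. 1) \<le> (\<Sum>v\<in>V - {z}. ?d v)" by (rule sum_mono) (use d1 in auto)
    moreover have cz: "card (V - {z}) = 2 * q + 2" using z(1) assms(1) by simp
    ultimately have dz: "?d z = 2" "(\<Sum>v\<in>V - {z}. ?d v) = 2 * q + 2" using split sd z(2) by auto
    have "1 = ?d v" if "v \<in> V - {z}" for v
      by (rule sum_mono_inv[where I = "V - {z}" and f = "\<lambda>_. 1" and g = ?d])
        (use dz(2) cz d1 that finite_V in auto)
    then show ?thesis using iso_complement_matching_path[OF assms(1) z(1) dz(1)] by simp
  next
    case 3
    have "?D + 1 - degree G v = ?d v + 1" if "v \<in> V" for v using d[OF that] 3 by simp
    then have "(\<Sum>v\<in>V. ?d v + 1) = 2 * q + 5" using sum 3 by simp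
    then have "(\<Sum>v\<in>V. ?d v) = 2" using assms(1) by (simp add: sum.distrib sum_Suc)
    then have "card (edges (complement G)) = 1" using C.sum_degree VC by simp
    then show ?thesis using iso_minus_edge assms(1) by simp
  qed
qed

end

section \<open>The characterisation\<close>

lemma (in sgraph) stability_pos:
  assumes "class2 G" shows "0 < chromatic_edge_stability_index G"
proof (rule ccontr)
  assume zero: "\<not> 0 < chromatic_edge_stability_index G"
  have ci: "chromatic_index G = Suc (max_degree G)" using assms by (simp add: class2_def)
  obtain F c where F: "F \<subseteq> E" "card F = chromatic_edge_stability_index G"
    and c: "proper_edge_colouring (delete_edges G F) (max_degree G) c" by (rule stability_attained[OF ci])
  have "F = {}" using F(2) zero finite_subset[OF F(1) finite_E] by simp
  then have "proper_edge_colouring G (max_degree G) c" using c by (simp add: delete_edges_def)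
  then show False using chromatic_index_le_iff[of "max_degree G"] ci by auto
qed

text \<open>
Counting the edges left after the deletion of \<open>q\<close> edges gives \<open>s \<ge> 1\<close>; the case \<open>s = 1\<close> yields the
dense graphs, and \<open>s \<ge> 2\<close> the disjoint unions.
\<close>
lemma (in sgraph) extremal_structure:
  assumes cl: "class2 G" and ne: "E \<noteq> {}" and n: "card V = 2 * q + 3"
    and es: "chromatic_edge_stability_index G = q"
  shows "graph_iso G (complete_graph_minus_edge (2 * q + 3)) \<or>
    graph_iso G (disjoint_union (complete_graph (2 * q + 1)) (complete_graph 2)) \<or>
    graph_iso G (disjoint_union (complete_graph (2 * q + 1)) (complement (complete_graph 2))) \<or>
    graph_iso G (complement (disjoint_union (copies q (complete_graph 2)) (complete_bipartite 1 2))) \<or>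
    regular (2 * q) G \<or>
    (\<exists>m>0. graph_iso G (disjoint_union
         (disjoint_union (complete_graph (2 * m + 1)) (complete_graph (2 * m + 1))) (complete_graph 1)) \<or>
       graph_iso G (disjoint_union
         (disjoint_union (complete_graph (2 * m + 1)) (complete_graph (2 * m + 1))) (complete_graph (2 * m + 1))))"
proof -
  let ?l = "max_degree G"
  have ci: "chromatic_index G = Suc ?l" using cl by (simp add: class2_def)
  interpret tight_graph G "?l + 1" by (rule tight_if_stability[OF cl n es])
  obtain c where c: "proper c" using chromatic_index_le_iff[of "?l + 1"] ci by auto
  define s where "s = card (small c)"
  have miss: "card (miss c' v) = ?l + 1 - degree G v" if "proper c'" "v \<in> V" for c' v
    using card_miss[OF that] by simp
  have total: "(\<Sum>v\<in>V. ?l + 1 - degree G v) = ?l + 1 + 2 * card (small c')" if "proper c'" for c'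
    using sum_card_miss[OF that] miss[OF that] by simp
  have s_eq: "card (small c') = s" if "proper c'" for c'
    using total[OF that] total[OF c] by (simp add: s_def)
  have "(\<Sum>v\<in>V. degree G v) + (\<Sum>v\<in>V. card (miss c v)) = (\<Sum>v\<in>V. ?l + 1)"
    using card_miss[OF c] by (simp add: sum.distrib[symmetric] add.commute)
  then have count: "2 * card E + (?l + 1 + 2 * s) = (2 * q + 3) * (?l + 1)"
    using sum_degree sum_card_miss[OF c] n by (simp add: s_def)
  obtain F d where F: "F \<subseteq> E" "card F = q" "proper_edge_colouring (delete_edges G F) ?l d"
    using stability_attained[OF ci] es by metis
  have "card E \<le> card F + ?l * (q + 1)" by (rule deleted_card_ge[OF F(1,3)]) (use n in simp)
  then have "2 * card E \<le> 2 * (q + ?l * (q + 1))" using F(2) by simp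
  then have "1 \<le> s" using count by (simp add: algebra_simps)
  then consider "s = 1" | "2 \<le> s" by linarith
  then show ?thesis
  proof cases
    case 1
    have "(\<Sum>v\<in>V. ?l + 1 - degree G v) = ?l + 3" using total[OF c] 1 by (simp add: s_def)
    then show ?thesis using dense_cases[OF n ne] by blast
  next
    case 2
    have q: "0 < q" using stability_pos[OF cl] es by simp
    interpret two_small G "?l + 1" s
      by unfold_locales (use s_eq 2 n q c in auto)
    show ?thesis
    proof (cases "card deficient = 2")
      case True
      have "card V - 2 = 2 * q + 1" using n by simp
      then show ?thesis using two_deficient_iso[OF True] by metis
    next
      case False
      then have "card deficient \<le> 1" using card_deficient_le by simp
      then show ?thesis using cliques_iso by blast
    qed
  qed
qed

theorem theorem5p13:
  fixes G :: "'a ugraph" and n :: nat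
  assumes "simple_graph G"
    and "edges G \<noteq> {}"
    and "class2 G"
    and "graph_order G = n"
    and "odd n"
  shows "real (chromatic_edge_stability_index G) = (real n - 3) / 2 \<longleftrightarrow>
    (n \<ge> 5 \<and>
      (graph_iso G (complete_graph_minus_edge n) \<or>
       graph_iso G (disjoint_union (complete_graph (n - 2)) (complete_graph 2)) \<or>
       graph_iso G (disjoint_union (complete_graph (n - 2)) (complement (complete_graph 2))) \<or>
       graph_iso G (complement
         (disjoint_union (copies ((n - 3) div 2) (complete_graph 2)) (complete_bipartite 1 2))) \<or>
       regular (n - 3) G)) \<or>
    (\<exists>m::nat. m > 0 \<and>
      (graph_iso G (disjoint_union
         (disjoint_union (complete_graph (2 * m + 1)) (complete_graph (2 * m + 1)))
         (complete_graph 1)) \<or>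
       graph_iso G (disjoint_union
         (disjoint_union (complete_graph (2 * m + 1)) (complete_graph (2 * m + 1)))
         (complete_graph (2 * m + 1)))))"
proof -
  interpret sgraph G by unfold_locales (rule assms(1))
  have V: "card V = n" using assms(4) by (simp add: graph_order_def)
  obtain e where e: "e \<in> E" using assms(2) by blast
  \<comment> \<open>As there is an edge, the order is at least 3, and subtracting 3 does not truncate.\<close>
  have "2 \<le> n" using card_mono[OF finite_V edge_subset[OF e]] edge_card[OF e] V by simp
  moreover obtain j where "n = 2 * j + 1" using assms(5) by (elim oddE)
  ultimately have "n = 2 * (j - 1) + 3" by simp
  then obtain q where n: "n = 2 * q + 3" by blast
  have cV: "card V = 2 * q + 3" using V n by simp
  have arith: "n - 2 = 2 * q + 1" "(n - 3) div 2 = q" "n - 3 = 2 * q" "5 \<le> n \<longleftrightarrow> 1 \<le> q" using n by auto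
  have half: "2 * q div 2 = q" by simp
  have es: "real (chromatic_edge_stability_index G) = (real n - 3) / 2 \<longleftrightarrow>
      chromatic_edge_stability_index G = q"
    using n by auto
  show ?thesis (is "_ \<longleftrightarrow> n \<ge> 5 \<and> ?dense \<or> ?cliques")
  proof
    assume "real (chromatic_edge_stability_index G) = (real n - 3) / 2"
    then have eq: "chromatic_edge_stability_index G = q" using es by blast
    have "5 \<le> n" using stability_pos[OF assms(3)] eq arith(4) by simp
    then show "n \<ge> 5 \<and> ?dense \<or> ?cliques"
      using extremal_structure[OF assms(3,2) cV eq]
      unfolding arith(1,3) half n[symmetric] by iprover
  next
    assume "n \<ge> 5 \<and> ?dense \<or> ?cliques"
    then have "chromatic_edge_stability_index G = q"
    proof
      assume r: "n \<ge> 5 \<and> ?dense"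
      then have q: "1 \<le> q" using arith(4) by blast
      from r have "?dense" by blast
      then show ?thesis
      proof (elim disjE)
        assume "graph_iso G (complete_graph_minus_edge n)"
        then show ?thesis using stability_iso_minus_edge[OF assms(3) q cV] n by simp
      next
        assume "graph_iso G (disjoint_union (complete_graph (n - 2)) (complete_graph 2))"
        then show ?thesis using stability_iso_clique_pair[OF assms(3) q cV] unfolding arith by blast
      next
        assume "graph_iso G (disjoint_union (complete_graph (n - 2)) (complement (complete_graph 2)))"
        then show ?thesis using stability_iso_clique_pair[OF assms(3) q cV] unfolding arith by blast
      next
        assume "graph_iso G (complement
          (disjoint_union (copies ((n - 3) div 2) (complete_graph 2)) (complete_bipartite 1 2)))"
        then show ?thesis using stability_iso_dense[OF assms(3) q cV] unfolding arith(1,3) half by blast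
      next
        assume "regular (n - 3) G"
        then show ?thesis using stability_regular[OF assms(3,2) cV] unfolding arith by blast
      qed
    next
      assume "?cliques"
      then have "2 * chromatic_edge_stability_index G + 3 = card V"
        using stability_iso_cliques[OF assms(3)] by metis
      then show ?thesis using cV by simp
    qed
    then show "real (chromatic_edge_stability_index G) = (real n - 3) / 2" using es by blast
  qed
qed

end
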